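(* Let $n\ge1$ and $\beta\ge2$ ($\beta=\infty$ allowed). Let $\sigma_0=(\sigma_0^i)_{i=1}^n$ with $\sigma_0^i>0$ be an initial condition such that $S(\sigma_0)>-\infty$. Then there exists a unique strong solution $(\sigma_t)_{t\ge0}$, with initial value $\sigma_0$, to the It\^o stochastic differential equation $$\mathrm d\sigma^k_t=\frac12\Big(\coth\sigma^k_t+\sum_{l\ne k}\frac{\sinh\sigma^k_t}{\cosh\sigma^k_t-\cosh\sigma^l_t}\Big)\mathrm dt+\sqrt{\tfrac2\beta}\,\mathrm dW^k_t,\qquad k=1,\dots,n,$$ where $W_t=(W_t^1,\dots,W_t^n)$ is a standard Wiener process in $\mathbb R^n$, and $S(\sigma_t)>-\infty$ for all $t>0$ almost surely.
   Context: For $\sigma\in[0,\infty)^n$, $$S(\sigma)=\sum_{k=1}^n\log\sinh\sigma^k+\sum_{1\le k<l\le n}\log|\cosh\sigma^k-\cosh\sigma^l|+c_n,$$ where $c_n$ is a real constant depending only on $n$ and $\log 0=-\infty$. Thus $S(\sigma)>-\infty$ means that the $\sigma^k$ are nonzero and pairwise distinct. When $\beta=\infty$, $\sqrt{2/\beta}=0$. *)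

theory Defs
  imports "HOL-Probability.Probability"
begin

section \<open>Filtrations and the Wiener process\<close>

definition natural_filtration ::
    "'w measure \<Rightarrow> (real \<Rightarrow> 'w \<Rightarrow> 'b::topological_space) \<Rightarrow> real \<Rightarrow> 'w measure" where
  "natural_filtration M X t =
     sigma (space M) (\<Union>s\<in>{0..t}. {X s -` A \<inter> space M | A. A \<in> sets borel})"

definition augmented_filtration ::
    "'w measure \<Rightarrow> (real \<Rightarrow> 'w measure) \<Rightarrow> real \<Rightarrow> 'w measure" where
  "augmented_filtration M F t = sigma (space M) (sets (F t) \<union> null_sets M)"

text \<open>Only the times \<open>t \<ge> 0\<close> matter; the filtration is indexed by all reals in order to
  use the library locale. Path regularity is required almost surely.\<close>

locale wiener_process = prob_space M + filtration "space M" F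
  for M :: "'w measure" and F :: "real \<Rightarrow> 'w measure" +
  fixes W :: "real \<Rightarrow> 'w \<Rightarrow> real ^ 'n"
  assumes subalgebra_F: "\<And>t. 0 \<le> t \<Longrightarrow> subalgebra M (F t)"
    and adapted: "\<And>t. 0 \<le> t \<Longrightarrow> W t \<in> borel_measurable (F t)"
    and start_zero: "AE \<omega> in M. W 0 \<omega> = 0"
    and continuous_paths: "AE \<omega> in M. continuous_on {0..} (\<lambda>t. W t \<omega>)"
    and increment_distributed: "\<And>s t k. 0 \<le> s \<Longrightarrow> s < t \<Longrightarrow>
      distributed M lborel (\<lambda>\<omega>. (W t \<omega> - W s \<omega>) $ k) (normal_density 0 (sqrt (t - s)))"
    and increment_components_indep: "\<And>s t. 0 \<le> s \<Longrightarrow> s < t \<Longrightarrow>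
      indep_vars (\<lambda>_. borel) (\<lambda>k \<omega>. (W t \<omega> - W s \<omega>) $ k) UNIV"
    and increment_indep_past: "\<And>s t. 0 \<le> s \<Longrightarrow> s < t \<Longrightarrow>
      indep_set (sets (F s))
        (sets (vimage_algebra (space M) (\<lambda>\<omega>. W t \<omega> - W s \<omega>) borel))"

section \<open>Stochastic differential equations with additive noise\<close>

text \<open>Solutions of \<open>dX = b(X) dt + a dW\<close>, \<open>X\<^sub>0 = x0\<close>, adapted to \<open>F\<close>, on the time interval
  \<open>[0,\<infinity>)\<close>. Since \<open>a\<close> is a constant scalar and \<open>W\<^sub>0 = 0\<close> a.s., the stochastic integral of
  \<open>a\<close> up to time \<open>t\<close> is \<open>a W\<^sub>t\<close>. The set \<open>D\<close> is the set of points at which the drift \<open>b\<close> is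
  meaningful: a solution is in \<open>D\<close> at Lebesgue-almost every time, so that the values of \<open>b\<close>
  outside \<open>D\<close> play no role.\<close>

definition sde_solution ::
    "'w measure \<Rightarrow> (real \<Rightarrow> 'w measure) \<Rightarrow> (real \<Rightarrow> 'w \<Rightarrow> real ^ 'n) \<Rightarrow>
     (real ^ 'n) set \<Rightarrow> (real ^ 'n \<Rightarrow> real ^ 'n) \<Rightarrow> real \<Rightarrow> real ^ 'n \<Rightarrow>
     (real \<Rightarrow> 'w \<Rightarrow> real ^ 'n) \<Rightarrow> bool" where
  "sde_solution M F W D b a x0 X \<longleftrightarrow>
     (\<forall>t\<ge>0. X t \<in> borel_measurable (F t)) \<and>
     (AE \<omega> in M. X 0 \<omega> = x0) \<and>
     (AE \<omega> in M. continuous_on {0..} (\<lambda>t. X t \<omega>)) \<and>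
     (AE \<omega> in M. AE s in lborel. 0 \<le> s \<longrightarrow> X s \<omega> \<in> D) \<and>
     (AE \<omega> in M. \<forall>t\<ge>0. set_integrable lborel {0..t} (\<lambda>s. b (X s \<omega>))) \<and>
     (AE \<omega> in M. \<forall>t\<ge>0.
        X t \<omega> = x0 + set_lebesgue_integral lborel {0..t} (\<lambda>s. b (X s \<omega>)) + a *\<^sub>R W t \<omega>)"

text \<open>A strong solution is adapted to the augmented filtration generated by the given \<open>W\<close>
  (the initial value is deterministic).\<close>

definition strong_solution ::
    "'w measure \<Rightarrow> (real \<Rightarrow> 'w \<Rightarrow> real ^ 'n) \<Rightarrow>
     (real ^ 'n) set \<Rightarrow> (real ^ 'n \<Rightarrow> real ^ 'n) \<Rightarrow> real \<Rightarrow> real ^ 'n \<Rightarrow>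
     (real \<Rightarrow> 'w \<Rightarrow> real ^ 'n) \<Rightarrow> bool" where
  "strong_solution M W D b a x0 X \<longleftrightarrow>
     sde_solution M (augmented_filtration M (natural_filtration M W)) W D b a x0 X"

section \<open>The functional \<open>S\<close> and the coefficients\<close>

text \<open>The value \<open>-\<infinity>\<close> at negative arguments only serves to make \<open>S\<close> equal to \<open>-\<infinity>\<close>
  outside \<open>[0,\<infinity>)\<^sup>n\<close>, where it is otherwise not defined.\<close>

definition elog :: "real \<Rightarrow> ereal" where
  "elog x = (if x \<le> 0 then -\<infinity> else ereal (ln x))"

definition S :: "(nat \<Rightarrow> real) \<Rightarrow> real ^ 'n::{finite,linorder} \<Rightarrow> ereal" where
  "S c \<sigma> = (\<Sum>k\<in>UNIV. elog (sinh (\<sigma> $ k)))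
     + (\<Sum>(k, l)\<in>{(k, l). k < l}. elog \<bar>cosh (\<sigma> $ k) - cosh (\<sigma> $ l)\<bar>)
     + ereal (c CARD('n))"

definition coth :: "real \<Rightarrow> real" where
  "coth x = cosh x / sinh x"

definition drift :: "real ^ 'n \<Rightarrow> real ^ 'n" where
  "drift \<sigma> = (\<chi> k. 1 / 2 * (coth (\<sigma> $ k)
     + (\<Sum>l\<in>UNIV - {k}. sinh (\<sigma> $ k) / (cosh (\<sigma> $ k) - cosh (\<sigma> $ l)))))"

text \<open>The points at which no denominator in the drift vanishes.\<close>

definition drift_domain :: "(real ^ 'n) set" where
  "drift_domain = {\<sigma>. (\<forall>k. sinh (\<sigma> $ k) \<noteq> 0) \<and>
     (\<forall>k l. l \<noteq> k \<longrightarrow> cosh (\<sigma> $ k) - cosh (\<sigma> $ l) \<noteq> 0)}"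

text \<open>For \<open>\<beta> = \<infinity>\<close> this is \<open>0\<close>.\<close>

definition noise_coeff :: "ereal \<Rightarrow> real" where
  "noise_coeff \<beta> = sqrt (real_of_ereal (2 / \<beta>))"

section \<open>Consistency checks\<close>

lemma elog_gt_minus_infinity_iff: "elog x > -\<infinity> \<longleftrightarrow> x > 0" "elog x \<noteq> -\<infinity> \<longleftrightarrow> x > 0"
  by (auto simp: elog_def)

lemma elog_ne_infinity: "elog x \<noteq> \<infinity>"
  by (auto simp: elog_def)

lemma cosh_eq_iff_of_pos: "0 < x \<Longrightarrow> 0 < y \<Longrightarrow> cosh x = cosh y \<longleftrightarrow> x = (y::real)"
  using cosh_real_nonneg_less_iff[of x y] cosh_real_nonneg_less_iff[of y x]
  by (cases x y rule: linorder_cases) auto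

lemma sum_ereal_gt_minus_infinity_iff:
  fixes f :: "'a \<Rightarrow> ereal"
  assumes "finite A" "\<And>x. x \<in> A \<Longrightarrow> f x \<noteq> \<infinity>"
  shows "sum f A \<noteq> \<infinity> \<and> (sum f A > -\<infinity> \<longleftrightarrow> (\<forall>x\<in>A. f x > -\<infinity>))"
  using assms
proof (induction A rule: finite_induct)
  case (insert x A)
  then show ?case by (cases "f x"; cases "sum f A") auto
qed auto

lemma S_gt_minus_infinity_iff:
  fixes \<sigma> :: "real ^ 'n::{finite,linorder}"
  shows "S c \<sigma> > -\<infinity> \<longleftrightarrow> (\<forall>k. \<sigma> $ k > 0) \<and> (\<forall>k l. k \<noteq> l \<longrightarrow> \<sigma> $ k \<noteq> \<sigma> $ l)"
proof -
  let ?A = "\<Sum>k\<in>UNIV. elog (sinh (\<sigma> $ k))"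
  let ?g = "\<lambda>(k, l). elog \<bar>cosh (\<sigma> $ k) - cosh (\<sigma> $ l)\<bar>"
  let ?P = "{(k, l). k < (l::'n)}"
  have A: "?A \<noteq> \<infinity>" "?A > -\<infinity> \<longleftrightarrow> (\<forall>k. \<sigma> $ k > 0)"
    using sum_ereal_gt_minus_infinity_iff[of UNIV "\<lambda>k. elog (sinh (\<sigma> $ k))"]
    by (simp_all add: elog_ne_infinity elog_gt_minus_infinity_iff)
  have "finite ?P" by (rule finite_subset[OF subset_UNIV]) simp
  then have B: "sum ?g ?P \<noteq> \<infinity>"
    "sum ?g ?P > -\<infinity> \<longleftrightarrow> (\<forall>k l. k < l \<longrightarrow> cosh (\<sigma> $ k) \<noteq> cosh (\<sigma> $ l))"
    using sum_ereal_gt_minus_infinity_iff[of ?P ?g]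
    by (auto simp: elog_ne_infinity elog_gt_minus_infinity_iff)
  have "S c \<sigma> > -\<infinity> \<longleftrightarrow> ?A > -\<infinity> \<and> sum ?g ?P > -\<infinity>"
    using A(1) B(1) unfolding S_def by (cases ?A; cases "sum ?g ?P") auto
  also have "\<dots> \<longleftrightarrow> (\<forall>k. \<sigma> $ k > 0) \<and> (\<forall>k l. k < l \<longrightarrow> \<sigma> $ k \<noteq> \<sigma> $ l)"
    unfolding A(2) B(2) using cosh_eq_iff_of_pos by blast
  also have "\<dots> \<longleftrightarrow> (\<forall>k. \<sigma> $ k > 0) \<and> (\<forall>k l. k \<noteq> l \<longrightarrow> \<sigma> $ k \<noteq> \<sigma> $ l)"
    unfolding neq_iff[where 'a='n] by (rule conj_cong[OF refl]) (blast intro: sym)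
  finally show ?thesis .
qed

lemma S_gt_minus_infinity_imp_drift_domain: "S c \<sigma> > -\<infinity> \<Longrightarrow> \<sigma> \<in> drift_domain"
  unfolding S_gt_minus_infinity_iff drift_domain_def
  by (auto simp: abs_of_pos less_le)

lemma noise_coeff_infinity: "noise_coeff \<infinity> = 0"
  by (simp add: noise_coeff_def)

lemma noise_coeff_real: "b \<ge> 2 \<Longrightarrow> noise_coeff (ereal b) = sqrt (2 / b)"
  by (simp add: noise_coeff_def)

end

theory Submission
  imports Defs
begin

text \<open>The drift is the gradient of \<open>S / 2\<close>, which is concave on the open chamber containing
  \<open>\<sigma>0\<close>; hence it is monotone there and solutions are unique path by path as long as they stay in the
  chamber. Truncating the hyperbolic cotangents at \<open>\<epsilon>\<close> gives bounded Lipschitz drifts, for which the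
  equation is solved path by path, and it remains to show that the truncated solution does not
  leave the region where the truncation is inactive, with probability tending to \<open>1\<close> as \<open>\<epsilon> \<rightarrow> 0\<close>.
  An algebraic identity for the cross terms of the squared drift shows that \<open>- S\<close> is,
  for \<open>\<beta> \<ge> 2\<close>, a supermartingale up to exit. Instead of using stochastic calculus, this is proved for the
  Euler scheme, by a second-order Taylor expansion of a Lyapunov function and the moments of independent
  Gaussian increments, up to an error that vanishes with the step size; since the Euler scheme
  converges path by path, the bound on the exit probability carries over.\<close>

section \<open>Integral equations with additive forcing\<close>

text \<open>Since cosh x - cosh y = 2 sinh ((x + y) / 2) sinh ((x - y) / 2), the functional
  \<open>S\<close> is, up to a constant, a sum of ln sinh of finitely many linear forms \<alpha>_j.
  Drift, truncation, monotonicity and Taylor expansion thereby reduce to one variable, and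
  everything except the energy inequality is done for an arbitrary finite family of forms. With a^2
  = 2 / \<beta>, the generator applied to -S is half of a^2 \<Sum> |\<alpha>_j|^2 / sinh^2
  (\<alpha>_j x) - |grad S|^2. For a \<le> 1 its sign is the subharmonicity of exp S on the chamber.
  As -S is unbounded below, a multiple of sqrt (1 + |x|^2) is added, at the price of a growth rate
  that does not involve \<epsilon>. The barrier at the boundary is -ln (sinh \<epsilon>), so the
  exit probability decays like its reciprocal. The Taylor constants explode as \<epsilon>
  \<rightarrow> 0, which forces the order of limits: the step size at fixed \<epsilon>, then
  \<epsilon>.\<close>

lemma integral_diff_Icc:
  fixes g :: "real \<Rightarrow> 'a::euclidean_space"
  assumes "continuous_on {0..} g" "0 \<le> s" "s \<le> t"
  shows "integral {0..t} g - integral {0..s} g = integral {s..t} g"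
proof -
  have "g integrable_on {0..t}"
    by (rule integrable_continuous_interval)
       (auto intro: continuous_on_subset[OF assms(1)])
  from Henstock_Kurzweil_Integration.integral_combine[OF assms(2,3) this]
  show ?thesis by (simp add: algebra_simps)
qed

lemma norm_integral_le_const:
  fixes g :: "real \<Rightarrow> 'a::euclidean_space"
  assumes "continuous_on {s..t} g" "s \<le> t" "\<And>u. u \<in> {s..t} \<Longrightarrow> norm (g u) \<le> C"
  shows "norm (integral {s..t} g) \<le> C * (t - s)"
  using integral_bound[OF assms(2,1)] assms(3) by auto

text \<open>Integrating against the weight exp (K * u) gains a factor 1 / K. With K twice the
  Lipschitz constant this becomes the contraction factor 1/2 of the Picard operator.\<close>

lemma exp_integral_bound:
  fixes g :: "real \<Rightarrow> 'a::euclidean_space"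
  assumes "continuous_on {0..t} g" "0 \<le> t" "K > 0" "C \<ge> 0"
    "\<And>u. u \<in> {0..t} \<Longrightarrow> norm (g u) \<le> C * exp (K * u)"
  shows "norm (integral {0..t} g) \<le> C / K * exp (K * t)"
proof -
  have I: "((\<lambda>u. C * exp (K * u)) has_integral (C / K * exp (K * t) - C / K * exp (K * 0))) {0..t}"
    using assms(2,3)
    by (intro fundamental_theorem_of_calculus)
       (auto simp flip: has_real_derivative_iff_has_vector_derivative intro!: derivative_eq_intros)
  have "norm (integral {0..t} g) \<le> integral {0..t} (\<lambda>u. C * exp (K * u))"
    using assms I
    by (intro integral_norm_bound_integral integrable_continuous_interval) (auto simp: has_integral_integrable intro!: continuous_intros)
  also have "\<dots> = C / K * exp (K * t) - C / K" using integral_unique[OF I] by simp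
  also have "\<dots> \<le> C / K * exp (K * t)" using assms by simp
  finally show ?thesis .
qed

text \<open>Banach's fixed point theorem for \<open>z t = exp (- K t) *\<^sub>R (y t - p t)\<close> with \<open>K = 2 L\<close>:
  the exponential weight makes the Picard operator a contraction on the whole half-line.\<close>

lemma integral_equation_exists:
  fixes b :: "'a::euclidean_space \<Rightarrow> 'a"
  assumes lip: "L-lipschitz_on UNIV b" and bd: "\<And>x. norm (b x) \<le> B"
    and p: "continuous_on {0::real..} p"
  shows "\<exists>y. continuous_on {0..} y \<and> (\<forall>t\<ge>0. y t = p t + integral {0..t} (\<lambda>s. b (y s)))"
proof -
  \<comment> \<open>The shift keeps the weight \<open>K\<close> positive when L = 0.\<close>
  define L' where "L' = L + 1"
  have "L \<ge> 0" using lip by (rule lipschitz_on_nonneg)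
  then have L': "L' > 0" by (simp add: L'_def)
  have lip': "norm (b x - b y) \<le> L' * norm (x - y)" for x y
    using lipschitz_onD[OF lip, of x y] mult_right_mono[of L L' "norm (x - y)"]
    by (simp add: dist_norm L'_def)
  have cb: "continuous_on A b" for A
    using lipschitz_on_continuous_on[OF lip] continuous_on_subset by blast
  have B: "B \<ge> 0" using bd[of 0] norm_ge_zero order_trans by blast
  define K where "K = 2 * L'"
  have K: "K > 0" using L' by (simp add: K_def)
  define g where "g z s = b (exp (K * s) *\<^sub>R apply_bcontfun z s + p s)" for z :: "real \<Rightarrow>\<^sub>C 'a" and s
  have cg: "continuous_on {0..} (g z)" for z
    unfolding g_def
    by (intro continuous_on_compose2[OF cb[of UNIV]] continuous_intros p) auto
  \<comment> \<open>The operator has to act on bounded continuous functions on the whole line, so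
    \<open>max 0 t\<close> freezes it at its initial value 0 for negative times.\<close>
  define f where "f z t = exp (- K * max 0 t) *\<^sub>R integral {0..max 0 t} (g z)" for z t
  have gB: "norm (g z s) \<le> B" for z s by (simp add: g_def bd)
  have fB: "f z \<in> bcontfun" for z
  proof (rule bcontfun_normI)
    have lipI: "B-lipschitz_on {0..} (\<lambda>t. integral {0..t} (g z))"
    proof (rule lipschitz_on_leI)
      fix s t :: real assume st: "s \<in> {0..}" "t \<in> {0..}" "s \<le> t"
      have "dist (integral {0..s} (g z)) (integral {0..t} (g z)) = norm (integral {s..t} (g z))"
        using integral_diff_Icc[OF cg, of s t z] st by (metis atLeast_iff dist_commute dist_norm)
      also have "\<dots> \<le> B * (t - s)"
        by (rule norm_integral_le_const) (use st gB in \<open>auto intro: continuous_on_subset[OF cg]\<close>)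
      finally show "dist (integral {0..s} (g z)) (integral {0..t} (g z)) \<le> B * dist s t"
        using st by (simp add: dist_real_def)
    qed (rule B)
    show "continuous_on UNIV (f z)"
      unfolding f_def
      by (intro continuous_intros continuous_on_compose2[OF lipschitz_on_continuous_on[OF lipI]]) auto
    show "norm (f z t) \<le> B / K" for t
    proof -
      have "norm (integral {0..max 0 t} (g z)) \<le> B / K * exp (K * max 0 t)"
      proof (rule exp_integral_bound[OF _ _ K B])
        show "norm (g z u) \<le> B * exp (K * u)" if "u \<in> {0..max 0 t}" for u
          using gB[of z u] mult_left_mono[of 1 "exp (K * u)" B] that B K by (simp del: atLeastAtMost_iff)
            (smt (verit) atLeastAtMost_iff mult_nonneg_nonneg)
      qed (auto intro: continuous_on_subset[OF cg] max.cobounded1)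
      then show ?thesis
        by (simp add: f_def exp_minus field_simps)
    qed
  qed
  define \<Phi> where "\<Phi> z = Bcontfun (f z)" for z
  have \<Phi>: "apply_bcontfun (\<Phi> z) = f z" for z
    unfolding \<Phi>_def by (rule Bcontfun_inverse[OF fB])
  have contr: "dist (\<Phi> z1) (\<Phi> z2) \<le> 1/2 * dist z1 z2" for z1 z2
  proof (rule dist_bound)
    fix t :: real
    define u where "u = max 0 t"
    have u: "u \<ge> 0" by (simp add: u_def)
    have "norm (integral {0..u} (\<lambda>s. g z1 s - g z2 s)) \<le> (L' * dist z1 z2) / K * exp (K * u)"
    proof (rule exp_integral_bound[OF _ u K])
      fix s
      have "norm (g z1 s - g z2 s) \<le> L' * (exp (K * s) * dist (apply_bcontfun z1 s) (apply_bcontfun z2 s))"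
        unfolding g_def using lip'[of "exp (K * s) *\<^sub>R z1 s + p s" "exp (K * s) *\<^sub>R z2 s + p s"]
        by (simp add: dist_norm flip: scaleR_diff_right)
      also have "\<dots> \<le> L' * (exp (K * s) * dist z1 z2)"
        using L' by (intro mult_left_mono dist_bounded) auto
      finally show "norm (g z1 s - g z2 s) \<le> L' * dist z1 z2 * exp (K * s)"
        by (simp add: mult_ac)
    qed (use L' in \<open>auto intro!: continuous_intros intro: continuous_on_subset[OF cg]\<close>)
    moreover have "integral {0..u} (\<lambda>s. g z1 s - g z2 s) = integral {0..u} (g z1) - integral {0..u} (g z2)"
      by (intro Henstock_Kurzweil_Integration.integral_diff integrable_continuous_interval)
         (auto intro: continuous_on_subset[OF cg])
    ultimately have "exp (- K * u) * norm (integral {0..u} (g z1) - integral {0..u} (g z2)) \<le> 1/2 * dist z1 z2"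
      using L' by (simp add: K_def exp_minus field_simps)
    then show "dist (apply_bcontfun (\<Phi> z1) t) (apply_bcontfun (\<Phi> z2) t) \<le> 1/2 * dist z1 z2"
      unfolding \<Phi> f_def dist_norm by (simp add: u_def flip: scaleR_diff_right)
  qed
  have "\<exists>!z. \<Phi> z = z"
    using contr by (intro banach_fix_type[of "1/2"]) auto
  then obtain z where z: "\<Phi> z = z" by blast
  define y where "y t = p t + exp (K * t) *\<^sub>R apply_bcontfun z t" for t
  have "g z = (\<lambda>s. b (y s))" by (auto simp: g_def y_def add.commute)
  moreover have "apply_bcontfun z t = exp (- K * t) *\<^sub>R integral {0..t} (g z)" if "t \<ge> 0" for t
    using fun_cong[OF \<Phi>[of z], of t] that by (simp add: z f_def max_absorb2)
  ultimately have "y t = p t + integral {0..t} (\<lambda>s. b (y s))" if "t \<ge> 0" for t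
    unfolding y_def[of t] using that by (simp add: exp_minus)
  moreover have "continuous_on {0..} y"
    unfolding y_def by (intro continuous_intros p) auto
  ultimately show ?thesis by blast
qed

text \<open>The forcing \<open>p\<close> cancels in the difference, which is therefore
  differentiable even if the paths are not, and its squared norm has derivative 2 * (y - z)
  \<bullet> (f - g) \<le> 0. The one-sided condition is asked along the two paths only, so it also
  serves drifts that are monotone merely on a region.\<close>

lemma integral_equation_unique:
  fixes y z :: "real \<Rightarrow> 'a::euclidean_space"
  assumes f: "continuous_on {0..T} f" and g: "continuous_on {0..T} g"
    and y: "\<And>t. t \<in> {0..T} \<Longrightarrow> y t = p t + integral {0..t} f"
    and z: "\<And>t. t \<in> {0..T} \<Longrightarrow> z t = p t + integral {0..t} g"
    and mono: "\<And>t. t \<in> {0..T} \<Longrightarrow> (y t - z t) \<bullet> (f t - g t) \<le> 0"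
    and t: "t \<in> {0..T}"
  shows "y t = z t"
proof -
  define d where "d t = integral {0..t} (\<lambda>s. f s - g s)" for t
  have fg: "continuous_on {0..T} (\<lambda>s. f s - g s)" by (intro continuous_intros f g)
  have d: "y s - z s = d s" if "s \<in> {0..T}" for s
  proof -
    have "d s = integral {0..s} f - integral {0..s} g" unfolding d_def
      by (intro Henstock_Kurzweil_Integration.integral_diff integrable_continuous_interval
            continuous_on_subset[OF f] continuous_on_subset[OF g]) (use that in auto)
    then show ?thesis using y[OF that] z[OF that] by simp
  qed
  have der: "((\<lambda>s. d s \<bullet> d s) has_real_derivative 2 * (d s \<bullet> (f s - g s))) (at s within {0..T})"
    if "s \<in> {0..T}" for s
  proof -
    have "(d has_vector_derivative (f s - g s)) (at s within {0..T})"
      unfolding d_def by (rule integral_has_vector_derivative[OF fg that])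
    then have "(d has_derivative (\<lambda>h. h *\<^sub>R (f s - g s))) (at s within {0..T})"
      by (simp add: has_vector_derivative_def)
    from has_derivative_inner[OF this this] show ?thesis
      unfolding has_field_derivative_def
      by (rule has_derivative_eq_rhs) (auto simp: inner_commute)
  qed
  have "d t \<bullet> d t \<le> d 0 \<bullet> d 0"
  proof (rule DERIV_nonpos_imp_decreasing_open[where f="\<lambda>s. d s \<bullet> d s"])
    show "\<exists>l. ((\<lambda>s. d s \<bullet> d s) has_real_derivative l) (at s) \<and> l \<le> 0" if "0 < s" "s < t" for s
      using der[of s] mono[of s] d[of s] that t at_within_interior[of s "{0..T}"]
      by (intro exI[of _ "2 * (d s \<bullet> (f s - g s))"]) (auto simp: interior_atLeastAtMost_real)
    show "continuous_on {0..t} (\<lambda>s. d s \<bullet> d s)"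
      by (rule DERIV_continuous_on[OF has_field_derivative_subset[OF der]]) (use t in auto)
  qed (use t in auto)
  also have "\<dots> = 0" by (simp add: d_def)
  finally show ?thesis using d[OF t] inner_ge_zero[of "d t"] by simp
qed


section \<open>Pathwise convergence of the explicit Euler scheme\<close>

primrec euler :: "('a::real_vector \<Rightarrow> 'a) \<Rightarrow> 'a \<Rightarrow> (real \<Rightarrow> 'a) \<Rightarrow> real \<Rightarrow> nat \<Rightarrow> 'a" where
  "euler b x p \<delta> 0 = x"
| "euler b x p \<delta> (Suc i) = euler b x p \<delta> i + \<delta> *\<^sub>R b (euler b x p \<delta> i)
     + (p (real (Suc i) * \<delta>) - p (real i * \<delta>))"

text \<open>Discrete Gronwall. Here \<eta> bounds the oscillation of the exact solution over one
  step; adding it to the error turns the affine recursion e' \<le> e + L * \<delta> * (e + \<eta>)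
  into the geometric one e' + \<eta> \<le> (1 + L * \<delta>) * (e + \<eta>).\<close>

lemma euler_error_bound:
  fixes b :: "'a::euclidean_space \<Rightarrow> 'a"
  assumes lip: "L-lipschitz_on UNIV b"
    and yc: "continuous_on {0..} y"
    and y: "\<And>t. 0 \<le> t \<Longrightarrow> y t = p t + integral {0..t} (\<lambda>s. b (y s))"
    and \<delta>: "0 \<le> \<delta>"
    and mod: "\<And>s t. 0 \<le> s \<Longrightarrow> s \<le> t \<Longrightarrow> t \<le> s + \<delta> \<Longrightarrow> t \<le> real n * \<delta> \<Longrightarrow> norm (y t - y s) \<le> \<eta>"
    and i: "i \<le> n"
  shows "norm (y (real i * \<delta>) - euler b (p 0) p \<delta> i) + \<eta> \<le> (1 + L * \<delta>) ^ i * \<eta>"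
  using i
proof (induction i)
  case 0
  then show ?case using y[of 0] by simp
next
  case (Suc i)
  have L: "L \<ge> 0" using lip by (rule lipschitz_on_nonneg)
  define X where "X = euler b (p 0) p \<delta> i"
  define s t where "s = real i * \<delta>" and "t = real (Suc i) * \<delta>"
  have st: "0 \<le> s" "s \<le> t" "t - s = \<delta>" "t \<le> real n * \<delta>"
    using \<delta> Suc.prems mult_right_mono[of "real (Suc i)" "real n" \<delta>]
    by (auto simp: s_def t_def algebra_simps)
  have cby: "continuous_on {0..} (\<lambda>s. b (y s))"
    by (rule continuous_on_compose2[OF lipschitz_on_continuous_on[OF lip] yc]) auto
  have cst: "continuous_on {s..t} (\<lambda>u. b (y u))"
    by (rule continuous_on_subset[OF cby]) (use st in auto)
  have "integral {s..t} (\<lambda>u. b (y u) - b X) = integral {s..t} (\<lambda>u. b (y u)) - \<delta> *\<^sub>R b X"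
    using st by (subst Henstock_Kurzweil_Integration.integral_diff) 
       (auto intro!: integrable_continuous_interval cst)
  then have "y t - euler b (p 0) p \<delta> (Suc i) = (y s - X) + integral {s..t} (\<lambda>u. b (y u) - b X)"
    using y[of s] y[of t] st integral_diff_Icc[OF cby, of s t]
    by (simp add: X_def s_def t_def algebra_simps)
  moreover have "norm (integral {s..t} (\<lambda>u. b (y u) - b X)) \<le> L * (\<eta> + norm (y s - X)) * (t - s)"
  proof (rule norm_integral_le_const)
    fix u assume u: "u \<in> {s..t}"
    have "norm (b (y u) - b X) \<le> L * norm (y u - X)"
      using lipschitz_onD[OF lip, of "y u" X] by (simp add: dist_norm)
    also have "norm (y u - X) \<le> norm (y u - y s) + norm (y s - X)"
      using norm_triangle_ineq[of "y u - y s" "y s - X"] by simp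
    also have "norm (y u - y s) \<le> \<eta>" using u st by (intro mod) auto
    finally show "norm (b (y u) - b X) \<le> L * (\<eta> + norm (y s - X))"
      using L by (simp add: mult_left_mono)
  qed (use st in \<open>auto intro!: continuous_intros cst\<close>)
  ultimately have "norm (y t - euler b (p 0) p \<delta> (Suc i)) \<le> norm (y s - X) + L * (\<eta> + norm (y s - X)) * \<delta>"
    using norm_triangle_ineq[of "y s - X" "integral {s..t} (\<lambda>u. b (y u) - b X)"] st(3) by simp
  then have "norm (y t - euler b (p 0) p \<delta> (Suc i)) + \<eta> \<le> (1 + L * \<delta>) * (norm (y s - X) + \<eta>)"
    by (simp add: algebra_simps)
  also have "\<dots> \<le> (1 + L * \<delta>) * ((1 + L * \<delta>) ^ i * \<eta>)"
    using Suc L \<delta> by (intro mult_left_mono) (auto simp: X_def s_def)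
  finally show ?case by (simp add: t_def mult_ac)
qed

text \<open>The comparison is uniform over all times within one step of a grid point, because an
  exit of the continuous path may happen between grid points.\<close>

lemma euler_converges:
  fixes b :: "'a::euclidean_space \<Rightarrow> 'a"
  assumes lip: "L-lipschitz_on UNIV b"
    and yc: "continuous_on {0..} y"
    and y: "\<And>t. 0 \<le> t \<Longrightarrow> y t = p t + integral {0..t} (\<lambda>s. b (y s))"
    and T: "0 \<le> T" and e: "0 < e"
  shows "\<forall>\<^sub>F N in sequentially. \<forall>i\<le>N. \<forall>s\<in>{0..T}. \<bar>s - real i * (T / real N)\<bar> \<le> T / real N \<longrightarrow>
           norm (y s - euler b (p 0) p (T / real N) i) < e"
proof -
  have L: "L \<ge> 0" using lip by (rule lipschitz_on_nonneg)
  \<comment> \<open>The growth factor (1 + L * \<delta>) ^ i is at most exp (L * T), so the grid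
    error plus \<eta> is at most e / 2, and the oscillation within one step is below \<eta>.\<close>
  define \<eta> where "\<eta> = e / (2 * exp (L * T))"
  have \<eta>: "\<eta> > 0" using e by (simp add: \<eta>_def)
  have "uniformly_continuous_on {0..T} y"
    by (intro compact_uniformly_continuous continuous_on_subset[OF yc]) auto
  then obtain d where d: "d > 0" "\<And>s t. s \<in> {0..T} \<Longrightarrow> t \<in> {0..T} \<Longrightarrow> dist t s < d \<Longrightarrow> dist (y t) (y s) < \<eta>"
    using \<eta> unfolding uniformly_continuous_on_def by metis
  have "(\<lambda>N. T / real N) \<longlonglongrightarrow> 0"
    by (rule lim_const_over_n)
  then have "\<forall>\<^sub>F N in sequentially. T / real N < d"
    using d(1) by (rule order_tendstoD)
  then show ?thesis
    using eventually_gt_at_top[of 0]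
  proof eventually_elim
    case (elim N)
    define \<delta> where "\<delta> = T / real N"
    have \<delta>: "0 \<le> \<delta>" "\<delta> < d" "real N * \<delta> = T" using elim T by (auto simp: \<delta>_def)
    show ?case unfolding \<delta>_def[symmetric]
    proof (intro allI impI ballI)
      fix i s assume i: "i \<le> N" and s: "s \<in> {0..T}" "\<bar>s - real i * \<delta>\<bar> \<le> \<delta>"
      have ti: "real i * \<delta> \<in> {0..T}" using i \<delta> mult_right_mono[of "real i" "real N" \<delta>] by auto
      have "norm (y (real i * \<delta>) - euler b (p 0) p \<delta> i) + \<eta> \<le> (1 + L * \<delta>) ^ i * \<eta>"
      proof (rule euler_error_bound[OF lip yc y \<delta>(1) _ i])
        fix s t assume "0 \<le> s" "s \<le> t" "t \<le> s + \<delta>" "t \<le> real N * \<delta>"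
        then show "norm (y t - y s) \<le> \<eta>"
          using d(2)[of s t] \<delta> by (auto simp: dist_norm)
      qed
      also have "(1 + L * \<delta>) ^ i \<le> exp (L * \<delta>) ^ i"
        using L \<delta> by (intro power_mono exp_ge_add_one_self) auto
      also have "exp (L * \<delta>) ^ i = exp (L * (real i * \<delta>))"
        by (simp flip: exp_of_nat_mult add: mult_ac)
      also have "\<dots> \<le> exp (L * T)"
        using ti L by (auto intro!: mult_left_mono)
      also have "exp (L * T) * \<eta> = e / 2" by (simp add: \<eta>_def)
      finally have "norm (y (real i * \<delta>) - euler b (p 0) p \<delta> i) + \<eta> \<le> e / 2"
        using \<eta> by simp
      moreover have "norm (y s - y (real i * \<delta>)) < \<eta>"
        using d(2)[of "real i * \<delta>" s] ti s \<delta> by (auto simp: dist_norm)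
      ultimately show "norm (y s - euler b (p 0) p \<delta> i) < e"
        using norm_triangle_ineq[of "y s - y (real i * \<delta>)" "y (real i * \<delta>) - euler b (p 0) p \<delta> i"] e
        by simp
    qed
  qed
qed

text \<open>Only forcing values on [0,T] enter the approximations. This makes \<open>y T\<close>
  measurable with respect to the information up to time \<open>T\<close>, however the solution was
  chosen.\<close>

lemma euler_tendsto:
  fixes b :: "'a::euclidean_space \<Rightarrow> 'a"
  assumes "L-lipschitz_on UNIV b" "continuous_on {0..} y"
    and "\<And>t. 0 \<le> t \<Longrightarrow> y t = p t + integral {0..t} (\<lambda>s. b (y s))"
    and T: "0 \<le> T"
  shows "(\<lambda>N. euler b (p 0) p (T / real N) N) \<longlonglongrightarrow> y T"
proof (rule tendstoI)
  fix e :: real assume e: "e > 0"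
  have "\<forall>\<^sub>F N in sequentially. \<forall>i\<le>N. \<forall>s\<in>{0..T}. \<bar>s - real i * (T / real N)\<bar> \<le> T / real N \<longrightarrow>
           norm (y s - euler b (p 0) p (T / real N) i) < e"
    by (rule euler_converges[OF assms e])
  then show "\<forall>\<^sub>F N in sequentially. dist (euler b (p 0) p (T / real N) N) (y T) < e"
    using eventually_gt_at_top[of 0]
  proof eventually_elim
    case (elim N)
    then show ?case
      using elim(1)[rule_format, of N T] T by (simp add: dist_norm norm_minus_commute)
  qed
qed

lemma nearest_grid_point:
  assumes "0 < N" "0 \<le> s" "s \<le> T"
  obtains i where "i \<le> N" "\<bar>s - real i * (T / real N)\<bar> \<le> T / real N"
proof (cases "T = 0")
  case True
  then show ?thesis using that[of 0] assms by simp
next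
  case False
  then have T: "T > 0" using assms by simp
  define i where "i = nat \<lfloor>s * real N / T\<rfloor>"
  have i: "real i \<le> s * real N / T" "s * real N / T \<le> real i + 1"
    using assms T unfolding i_def by (auto simp: of_nat_nat)
  have "real i \<le> real N"
    using i(1) assms T by (smt (verit) divide_le_eq mult.commute mult_left_mono of_nat_0_le_iff)
  moreover have "\<bar>s - real i * (T / real N)\<bar> \<le> T / real N"
  proof -
    have "s - real i * (T / real N) = (s * real N / T - real i) * (T / real N)"
      using assms T by (simp add: field_simps)
    then have "\<bar>s - real i * (T / real N)\<bar> = \<bar>s * real N / T - real i\<bar> * (T / real N)"
      using T by (simp only: abs_mult) simp
    also have "\<dots> \<le> 1 * (T / real N)"
      using i assms T by (intro mult_right_mono) auto
    finally show ?thesis by simp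
  qed
  ultimately show ?thesis using that[of i] by simp
qed

section \<open>Wiener increments\<close>

lemma (in prob_space) normal_moments:
  assumes D: "distributed M lborel X (normal_density 0 \<sigma>)" and \<sigma>: "0 < \<sigma>"
  shows "integrable M (\<lambda>\<omega>. X \<omega> ^ k)" "integrable M (\<lambda>\<omega>. \<bar>X \<omega>\<bar> ^ k)"
    "expectation X = 0" "expectation (\<lambda>\<omega>. (X \<omega>)\<^sup>2) = \<sigma>\<^sup>2"
    "expectation (\<lambda>\<omega>. \<bar>X \<omega>\<bar> ^ 3) \<le> 2 * \<sigma> ^ 3"
proof -
  show "integrable M (\<lambda>\<omega>. X \<omega> ^ k)"
    using distributed_integrable[OF D, of "\<lambda>x. x ^ k"] integrable_normal_moment[OF \<sigma>, of 0 k] by simp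
  show "integrable M (\<lambda>\<omega>. \<bar>X \<omega>\<bar> ^ k)"
    using distributed_integrable[OF D, of "\<lambda>x. \<bar>x\<bar> ^ k"] integrable_normal_moment_abs[OF \<sigma>, of 0 k] by simp
  show X: "expectation X = 0" by (rule normal_distributed_expectation[OF \<sigma> D])
  show "expectation (\<lambda>\<omega>. (X \<omega>)\<^sup>2) = \<sigma>\<^sup>2"
    using normal_distributed_variance[OF \<sigma> D] by (simp add: X)
  have "expectation (\<lambda>\<omega>. \<bar>X \<omega>\<bar> ^ 3) = 2 * \<sigma> ^ 3 * sqrt (2 / pi)"
    using distributed_integral[OF D, of "\<lambda>x. \<bar>x\<bar> ^ 3"] integral_normal_moment_abs_odd[OF \<sigma>, of 0 1]
    by (simp add: numeral_3_eq_3)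
  also have "\<dots> \<le> 2 * \<sigma> ^ 3 * 1"
    using \<sigma> pi_gt3 by (intro mult_left_mono) auto
  finally show "expectation (\<lambda>\<omega>. \<bar>X \<omega>\<bar> ^ 3) \<le> 2 * \<sigma> ^ 3" by simp
qed

text \<open>The norm is at most CARD('n) times the largest coordinate. The constant is crude, but
  third moments of the norm are thereby reduced to those of single Gaussian components.\<close>

lemma norm_power3_le_sum:
  fixes x :: "real ^ 'n"
  shows "norm x ^ 3 \<le> real CARD('n) ^ 3 * (\<Sum>k\<in>UNIV. \<bar>x $ k\<bar> ^ 3)"
proof -
  obtain m where m: "\<And>k. \<bar>x $ k\<bar> \<le> \<bar>x $ m\<bar>"
  proof -
    have "Max (range (\<lambda>k. \<bar>x $ k\<bar>)) \<in> range (\<lambda>k. \<bar>x $ k\<bar>)" by (intro Max_in) auto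
    then obtain m where "Max (range (\<lambda>k. \<bar>x $ k\<bar>)) = \<bar>x $ m\<bar>" by (rule imageE)
    then show ?thesis using that[of m] Max_ge[of "range (\<lambda>k. \<bar>x $ k\<bar>)"] by (metis rangeI finite finite_imageI)
  qed
  have "norm x \<le> (\<Sum>k\<in>UNIV. \<bar>x $ k\<bar>)" by (rule norm_le_l1_cart)
  also have "\<dots> \<le> real CARD('n) * \<bar>x $ m\<bar>" using sum_bounded_above[of UNIV "\<lambda>k. \<bar>x $ k\<bar>"] m by simp
  finally have "norm x ^ 3 \<le> (real CARD('n) * \<bar>x $ m\<bar>) ^ 3" by (intro power_mono) auto
  also have "\<dots> = real CARD('n) ^ 3 * \<bar>x $ m\<bar> ^ 3" by (simp add: power_mult_distrib)
  also have "\<dots> \<le> real CARD('n) ^ 3 * (\<Sum>k\<in>UNIV. \<bar>x $ k\<bar> ^ 3)"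
    by (intro mult_left_mono member_le_sum[of m UNIV "\<lambda>k. \<bar>x $ k\<bar> ^ 3"]) auto
  finally show ?thesis .
qed

context wiener_process
begin

lemma W_measurable: "0 \<le> s \<Longrightarrow> s \<le> t \<Longrightarrow> W s \<in> borel_measurable (F t)"
  using adapted[of s] sets_F_mono[of s t] space_F measurable_mono[of borel borel "F s" "F t"] by auto

lemma W_measurable_M: "0 \<le> t \<Longrightarrow> W t \<in> borel_measurable M"
  using measurable_from_subalg[OF subalgebra_F adapted] by blast

context
  fixes s t :: real
  assumes s: "0 \<le> s" and st: "s < t"
begin

lemma sqrt_duration_pos: "0 < sqrt (t - s)"
  using st by simp

lemmas component_moments = normal_moments[OF increment_distributed[OF s st] sqrt_duration_pos]

lemma increment_measurable [measurable]: "(\<lambda>\<omega>. W t \<omega> - W s \<omega>) \<in> borel_measurable M"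
  using W_measurable_M[of s] W_measurable_M[of t] s st by auto

lemma increment_component_products:
  "integrable M (\<lambda>\<omega>. (W t \<omega> - W s \<omega>) $ k * (W t \<omega> - W s \<omega>) $ l)"
  "expectation (\<lambda>\<omega>. (W t \<omega> - W s \<omega>) $ k * (W t \<omega> - W s \<omega>) $ l) = (if k = l then t - s else 0)"
proof -
  define X where "X k \<omega> = (W t \<omega> - W s \<omega>) $ k" for k \<omega>
  have int: "integrable M (X k)" and E0: "expectation (X k) = 0" for k
    using component_moments(1)[of k 1] component_moments(3)[of k] unfolding X_def by (simp_all only: power_one_right)
  have "integrable M (\<lambda>\<omega>. X k \<omega> * X l \<omega>) \<and> expectation (\<lambda>\<omega>. X k \<omega> * X l \<omega>) = (if k = l then t - s else 0)"
  proof (cases "k = l")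
    case True
    then show ?thesis
      using component_moments(1)[of k 2] component_moments(4)[of k] st
      unfolding X_def by (simp add: power2_eq_square del: vector_minus_component)
  next
    case False
    have "indep_vars (\<lambda>_. borel) X {k, l}"
      using increment_components_indep[OF s st] unfolding X_def
      by (rule indep_vars_subset) auto
    then have "integrable M (\<lambda>\<omega>. \<Prod>i\<in>{k, l}. X i \<omega>)"
      "expectation (\<lambda>\<omega>. \<Prod>i\<in>{k, l}. X i \<omega>) = (\<Prod>i\<in>{k, l}. expectation (X i))"
      using int by (auto intro!: indep_vars_integrable indep_vars_lebesgue_integral)
    then show ?thesis using False E0 by simp
  qed
  then show "integrable M (\<lambda>\<omega>. (W t \<omega> - W s \<omega>) $ k * (W t \<omega> - W s \<omega>) $ l)"
    "expectation (\<lambda>\<omega>. (W t \<omega> - W s \<omega>) $ k * (W t \<omega> - W s \<omega>) $ l) = (if k = l then t - s else 0)"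
    by (simp_all add: X_def)
qed

lemma increment_inner_square:
  "integrable M (\<lambda>\<omega>. (v \<bullet> (W t \<omega> - W s \<omega>))\<^sup>2)"
  "expectation (\<lambda>\<omega>. (v \<bullet> (W t \<omega> - W s \<omega>))\<^sup>2) = (v \<bullet> v) * (t - s)"
proof -
  have eq: "(v \<bullet> (W t \<omega> - W s \<omega>))\<^sup>2 =
     (\<Sum>k\<in>UNIV. \<Sum>l\<in>UNIV. (v $ k * v $ l) * ((W t \<omega> - W s \<omega>) $ k * (W t \<omega> - W s \<omega>) $ l))" for \<omega>
    by (simp add: inner_vec_def power2_eq_square sum_product mult_ac)
  show "integrable M (\<lambda>\<omega>. (v \<bullet> (W t \<omega> - W s \<omega>))\<^sup>2)"
    unfolding eq by (intro Bochner_Integration.integrable_sum integrable_mult_right increment_component_products)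
  have "expectation (\<lambda>\<omega>. (v \<bullet> (W t \<omega> - W s \<omega>))\<^sup>2) =
     (\<Sum>k\<in>UNIV. \<Sum>l\<in>UNIV. (v $ k * v $ l) * (if k = l then t - s else 0))"
    unfolding eq
    by (subst Bochner_Integration.integral_sum, intro Bochner_Integration.integrable_sum integrable_mult_right increment_component_products,
        subst Bochner_Integration.integral_sum, intro integrable_mult_right increment_component_products)
       (simp only: integral_mult_right_zero increment_component_products)
  also have "\<dots> = (v \<bullet> v) * (t - s)"
    by (simp add: inner_vec_def if_distrib sum_distrib_right cong: if_cong)
  finally show "expectation (\<lambda>\<omega>. (v \<bullet> (W t \<omega> - W s \<omega>))\<^sup>2) = (v \<bullet> v) * (t - s)" .
qed

lemma increment_norm_square:
  "integrable M (\<lambda>\<omega>. (norm (W t \<omega> - W s \<omega>))\<^sup>2)"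
  "expectation (\<lambda>\<omega>. (norm (W t \<omega> - W s \<omega>))\<^sup>2) = real CARD('n) * (t - s)"
proof -
  have eq: "(norm (W t \<omega> - W s \<omega>))\<^sup>2 = (\<Sum>k\<in>UNIV. (W t \<omega> - W s \<omega>) $ k * (W t \<omega> - W s \<omega>) $ k)" for \<omega>
    by (simp add: power2_norm_eq_inner inner_vec_def)
  show "integrable M (\<lambda>\<omega>. (norm (W t \<omega> - W s \<omega>))\<^sup>2)"
    unfolding eq by (intro Bochner_Integration.integrable_sum increment_component_products)
  show "expectation (\<lambda>\<omega>. (norm (W t \<omega> - W s \<omega>))\<^sup>2) = real CARD('n) * (t - s)"
    unfolding eq
    by (subst Bochner_Integration.integral_sum, intro increment_component_products)
       (simp only: increment_component_products, simp)
qed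

lemma increment_norm_cube:
  "integrable M (\<lambda>\<omega>. norm (W t \<omega> - W s \<omega>) ^ 3)"
  "expectation (\<lambda>\<omega>. norm (W t \<omega> - W s \<omega>) ^ 3) \<le> 2 * real CARD('n) ^ 4 * sqrt (t - s) ^ 3"
proof -
  let ?f = "\<lambda>\<omega>. real CARD('n) ^ 3 * (\<Sum>k\<in>UNIV. \<bar>(W t \<omega> - W s \<omega>) $ k\<bar> ^ 3)"
  have int: "integrable M ?f"
    by (intro integrable_mult_right Bochner_Integration.integrable_sum component_moments)
  show int': "integrable M (\<lambda>\<omega>. norm (W t \<omega> - W s \<omega>) ^ 3)"
    by (rule Bochner_Integration.integrable_bound[OF int])
       (use norm_power3_le_sum[of "W t _ - W s _"] in \<open>auto intro!: AE_I2 intro: order_trans[OF _ abs_ge_self]\<close>)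
  have "expectation (\<lambda>\<omega>. norm (W t \<omega> - W s \<omega>) ^ 3) \<le> expectation ?f"
    by (intro integral_mono int int' norm_power3_le_sum)
  also have "\<dots> = real CARD('n) ^ 3 * (\<Sum>k\<in>UNIV. expectation (\<lambda>\<omega>. \<bar>(W t \<omega> - W s \<omega>) $ k\<bar> ^ 3))"
    by (subst integral_mult_right_zero, subst Bochner_Integration.integral_sum, rule component_moments, rule refl)
  also have "\<dots> \<le> real CARD('n) ^ 3 * (\<Sum>k\<in>(UNIV :: 'n set). 2 * sqrt (t - s) ^ 3)"
    by (intro mult_left_mono sum_mono component_moments) auto
  also have "\<dots> = 2 * real CARD('n) ^ 4 * sqrt (t - s) ^ 3"
    by (simp add: power_def numeral_eq_Suc)
  finally show "expectation (\<lambda>\<omega>. norm (W t \<omega> - W s \<omega>) ^ 3) \<le> 2 * real CARD('n) ^ 4 * sqrt (t - s) ^ 3" .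
qed

text \<open>Takes the place of conditional expectations: a bounded factor known at time
  \<open>s\<close> splits off from any integrable function of the later increment by independence.
  Boundedness of \<open>Y\<close> supplies its integrability.\<close>

lemma past_increment_product:
  fixes Y :: "'w \<Rightarrow> real" and \<phi> :: "real ^ 'n \<Rightarrow> real"
  assumes Y: "Y \<in> borel_measurable (F s)" and Yb: "\<And>\<omega>. \<bar>Y \<omega>\<bar> \<le> C"
    and \<phi>: "\<phi> \<in> borel_measurable borel" and int: "integrable M (\<lambda>\<omega>. \<phi> (W t \<omega> - W s \<omega>))"
  shows "integrable M (\<lambda>\<omega>. Y \<omega> * \<phi> (W t \<omega> - W s \<omega>))"
    "expectation (\<lambda>\<omega>. Y \<omega> * \<phi> (W t \<omega> - W s \<omega>)) = expectation Y * expectation (\<lambda>\<omega>. \<phi> (W t \<omega> - W s \<omega>))"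
    "integrable M Y"
proof -
  have YM: "Y \<in> borel_measurable M"
    using measurable_from_subalg[OF subalgebra_F[OF s] Y] .
  show Yint: "integrable M Y"
    by (rule integrable_const_bound[of _ C]) (use Yb YM in auto)
  have "indep_var borel Y borel (\<lambda>\<omega>. \<phi> (W t \<omega> - W s \<omega>))"
    unfolding indep_var_eq
  proof (intro conjI)
    show "indep_set (sigma_sets (space M) {Y -` A \<inter> space M |A. A \<in> sets borel})
        (sigma_sets (space M) {(\<lambda>\<omega>. \<phi> (W t \<omega> - W s \<omega>)) -` A \<inter> space M |A. A \<in> sets borel})"
      unfolding indep_set_def
    proof (rule indep_sets_mono_sets[OF increment_indep_past[OF s st, unfolded indep_set_def]])
      fix i :: bool
      have 1: "sigma_sets (space M) {Y -` A \<inter> space M |A. A \<in> sets borel} \<subseteq> sets (F s)"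
        using measurable_sets[OF Y] space_F[of s] sets.sigma_sets_subset[of "{Y -` A \<inter> space M |A. A \<in> sets borel}" "F s"] by auto
      have "(\<lambda>\<omega>. \<phi> (W t \<omega> - W s \<omega>)) \<in> borel_measurable (vimage_algebra (space M) (\<lambda>\<omega>. W t \<omega> - W s \<omega>) borel)"
        by (rule measurable_compose[OF measurable_vimage_algebra1 \<phi>]) simp
      from measurable_sets[OF this]
      have 2: "sigma_sets (space M) {(\<lambda>\<omega>. \<phi> (W t \<omega> - W s \<omega>)) -` A \<inter> space M |A. A \<in> sets borel}
          \<subseteq> sets (vimage_algebra (space M) (\<lambda>\<omega>. W t \<omega> - W s \<omega>) borel)"
        using sets.sigma_sets_subset[of "{(\<lambda>\<omega>. \<phi> (W t \<omega> - W s \<omega>)) -` A \<inter> space M |A. A \<in> sets borel}" "vimage_algebra (space M) (\<lambda>\<omega>. W t \<omega> - W s \<omega>) borel"] by auto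
      show "case_bool (sigma_sets (space M) {Y -` A \<inter> space M |A. A \<in> sets borel})
        (sigma_sets (space M) {(\<lambda>\<omega>. \<phi> (W t \<omega> - W s \<omega>)) -` A \<inter> space M |A. A \<in> sets borel}) i
        \<subseteq> case_bool (sets (F s)) (sets (vimage_algebra (space M) (\<lambda>\<omega>. W t \<omega> - W s \<omega>) borel)) i"
        using 1 2 by (cases i) auto
    qed
  qed (use YM \<phi> in auto)
  from indep_var_lebesgue_integral[OF this Yint int] indep_var_integrable[OF this Yint int]
  show "integrable M (\<lambda>\<omega>. Y \<omega> * \<phi> (W t \<omega> - W s \<omega>))"
    "expectation (\<lambda>\<omega>. Y \<omega> * \<phi> (W t \<omega> - W s \<omega>)) = expectation Y * expectation (\<lambda>\<omega>. \<phi> (W t \<omega> - W s \<omega>))"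
    by simp_all
qed

text \<open>The martingale property of one step of the discrete stochastic integral, obtained
  coordinate by coordinate from the scalar product rule.\<close>

lemma past_inner_increment:
  fixes Z :: "'w \<Rightarrow> real ^ 'n"
  assumes Z: "Z \<in> borel_measurable (F s)" and Zb: "\<And>\<omega>. norm (Z \<omega>) \<le> C"
  shows "integrable M (\<lambda>\<omega>. Z \<omega> \<bullet> (W t \<omega> - W s \<omega>))" "expectation (\<lambda>\<omega>. Z \<omega> \<bullet> (W t \<omega> - W s \<omega>)) = 0"
proof -
  have *: "integrable M (\<lambda>\<omega>. Z \<omega> $ k * (W t \<omega> - W s \<omega>) $ k)"
    "expectation (\<lambda>\<omega>. Z \<omega> $ k * (W t \<omega> - W s \<omega>) $ k) = 0" for k
  proof -
    have "(\<lambda>\<omega>. Z \<omega> $ k) \<in> borel_measurable (F s)" by (rule measurable_compose[OF Z]) (intro borel_measurable_continuous_onI continuous_intros)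
    moreover have "\<bar>Z \<omega> $ k\<bar> \<le> C" for \<omega> using component_le_norm_cart[of "Z \<omega>" k] Zb[of \<omega>] by simp
    moreover have "(\<lambda>x :: real ^ 'n. x $ k) \<in> borel_measurable borel"
      by (intro borel_measurable_continuous_onI continuous_intros)
    moreover have "integrable M (\<lambda>\<omega>. (W t \<omega> - W s \<omega>) $ k)"
      using component_moments(1)[of k 1] by (simp only: power_one_right)
    ultimately have p: "integrable M (\<lambda>\<omega>. Z \<omega> $ k * (W t \<omega> - W s \<omega>) $ k)"
      "expectation (\<lambda>\<omega>. Z \<omega> $ k * (W t \<omega> - W s \<omega>) $ k) =
        expectation (\<lambda>\<omega>. Z \<omega> $ k) * expectation (\<lambda>\<omega>. (W t \<omega> - W s \<omega>) $ k)"
      by (rule past_increment_product)+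
    show "integrable M (\<lambda>\<omega>. Z \<omega> $ k * (W t \<omega> - W s \<omega>) $ k)" by (rule p)
    show "expectation (\<lambda>\<omega>. Z \<omega> $ k * (W t \<omega> - W s \<omega>) $ k) = 0"
      unfolding p(2) component_moments(3) by simp
  qed
  show "integrable M (\<lambda>\<omega>. Z \<omega> \<bullet> (W t \<omega> - W s \<omega>))"
    unfolding inner_vec_def inner_real_def by (intro Bochner_Integration.integrable_sum *)
  show "expectation (\<lambda>\<omega>. Z \<omega> \<bullet> (W t \<omega> - W s \<omega>)) = 0"
    unfolding inner_vec_def inner_real_def by (subst Bochner_Integration.integral_sum) (simp_all only: *, simp)
qed

lemma past_increment_square:
  assumes Y: "Y \<in> borel_measurable (F s)" and Yb: "\<And>\<omega>. \<bar>Y \<omega>\<bar> \<le> C"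
  shows "integrable M (\<lambda>\<omega>. Y \<omega> * (v \<bullet> (W t \<omega> - W s \<omega>))\<^sup>2)"
    "expectation (\<lambda>\<omega>. Y \<omega> * (v \<bullet> (W t \<omega> - W s \<omega>))\<^sup>2) = expectation Y * ((v \<bullet> v) * (t - s))"
  using past_increment_product(1,2)[OF Y Yb _ increment_inner_square(1)]
  unfolding increment_inner_square(2)
  by (auto intro!: borel_measurable_continuous_onI continuous_intros simp del: vector_minus_component)

end

end

section \<open>A Lyapunov estimate for the Euler scheme\<close>

lemma euler_measurable:
  fixes w :: "real \<Rightarrow> 'w \<Rightarrow> 'a::euclidean_space"
  assumes [measurable]: "b \<in> borel_measurable borel" and \<delta>: "0 \<le> \<delta>"
    and w: "\<And>t. 0 \<le> t \<Longrightarrow> t \<le> real i * \<delta> \<Longrightarrow> w t \<in> borel_measurable G"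
  shows "(\<lambda>\<omega>. euler b x (\<lambda>t. w t \<omega>) \<delta> i) \<in> borel_measurable G"
  using w
proof (induction i)
  case (Suc i)
  have le: "real i * \<delta> \<le> real (Suc i) * \<delta>" using \<delta> by (simp add: mult_right_mono)
  have [measurable]: "(\<lambda>\<omega>. euler b x (\<lambda>t. w t \<omega>) \<delta> i) \<in> borel_measurable G"
    using le by (intro Suc) auto
  have [measurable]: "w (real i * \<delta>) \<in> borel_measurable G" "w (real (Suc i) * \<delta>) \<in> borel_measurable G"
    using le \<delta> by (auto intro!: Suc.prems)
  show ?case unfolding euler.simps by measurable
qed simp

lemma add_power3_le:
  fixes x y :: real
  assumes "0 \<le> x" "0 \<le> y"
  shows "(x + y) ^ 3 \<le> 8 * (x ^ 3 + y ^ 3)"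
proof -
  have "(x + y) ^ 3 \<le> (2 * max x y) ^ 3" using assms by (intro power_mono) auto
  also have "\<dots> = 8 * max x y ^ 3" by (simp add: power_mult_distrib)
  also have "\<dots> \<le> 8 * (x ^ 3 + y ^ 3)" using assms by (auto simp: max_def)
  finally show ?thesis .
qed

text \<open>\<open>P\<close> and the sum over \<open>J\<close> stand for the gradient and half the
  Hessian of \<open>V\<close>, in one-sided form and with the singular second-order part kept as a
  combination of squares of the forms \<open>v j\<close>. That part cannot be bounded crudely, as
  the drift has to compensate it in \<open>generator\<close>; the bounded second-order part \<kappa>
  can, and stays outside \<open>generator\<close>. The \<open>expansion\<close> starts inside
  \<open>U\<close> but allows any \<open>h\<close>, because a single Euler step can jump out of
  \<open>U\<close>, where \<open>V\<close> is at least the barrier \<Lambda>.\<close>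

locale euler_lyapunov = wiener_process M F W
  for M :: "'w measure" and F and W :: "real \<Rightarrow> 'w \<Rightarrow> real ^ 'n" +
  fixes b :: "real ^ 'n \<Rightarrow> real ^ 'n" and a :: real and U :: "(real ^ 'n) set"
    and V :: "real ^ 'n \<Rightarrow> real" and P :: "real ^ 'n \<Rightarrow> real ^ 'n"
    and J :: "'j set" and q :: "'j \<Rightarrow> real ^ 'n \<Rightarrow> real" and v :: "'j \<Rightarrow> real ^ 'n"
    and B B1 B2 \<kappa> K C \<Lambda> :: real
  assumes b_measurable [measurable]: "b \<in> borel_measurable borel"
    and b_bound: "\<And>x. norm (b x) \<le> B"
    and a: "0 \<le> a" "a \<le> 1"
    and U_measurable [measurable]: "U \<in> sets borel"
    and V_nonneg: "\<And>x. 0 \<le> V x" and V_outside: "\<And>x. x \<notin> U \<Longrightarrow> \<Lambda> \<le> V x"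
    and P_measurable [measurable]: "P \<in> borel_measurable borel"
    and P_bound: "\<And>x. x \<in> U \<Longrightarrow> norm (P x) \<le> B1"
    and finite_J: "finite J"
    and q_measurable [measurable]: "\<And>j. j \<in> J \<Longrightarrow> q j \<in> borel_measurable borel"
    and q_bound: "\<And>x j. x \<in> U \<Longrightarrow> j \<in> J \<Longrightarrow> \<bar>q j x\<bar> \<le> B2"
    and nonneg: "0 \<le> B1" "0 \<le> B2" "0 \<le> \<kappa>" "0 \<le> K" "0 \<le> C"
    and expansion: "\<And>x h. x \<in> U \<Longrightarrow>
      V (x + h) \<le> V x + P x \<bullet> h + (\<Sum>j\<in>J. q j x * (v j \<bullet> h)\<^sup>2) + \<kappa> * (norm h)\<^sup>2 + K * norm h ^ 3"
    and generator: "\<And>x. x \<in> U \<Longrightarrow> P x \<bullet> b x + a\<^sup>2 * (\<Sum>j\<in>J. q j x * (v j \<bullet> v j)) \<le> C"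
begin

lemma B_nonneg: "0 \<le> B"
  using b_bound[of 0] norm_ge_zero order_trans by blast

text \<open>What is left of the second- and third-order terms per unit time, apart from the
  generator and the \<kappa> term of the noise: powers of the drift are of order \<delta> or
  smaller, the cubic moment of the noise is of order sqrt \<delta>.\<close>

definition step_error :: "real \<Rightarrow> real" where
  "step_error \<delta> = \<delta> * (B2 * B\<^sup>2 * (\<Sum>j\<in>J. v j \<bullet> v j)) + 2 * \<kappa> * (B\<^sup>2 * \<delta>)
     + 8 * K * (B ^ 3 * \<delta>\<^sup>2 + 2 * real CARD('n) ^ 4 * sqrt \<delta>)"

text \<open>\<open>A\<close> is used as the event of no exit so far. The growth of \<open>V\<close>
  is controlled by an explicit majorant \<open>R\<close>, because measurability of \<open>V\<close>
  is not assumed; \<open>R\<close> is nonnegative off \<open>A\<close>, so that it may be summed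
  over all steps, including those after the exit.\<close>

lemma one_step:
  assumes s: "0 \<le> s" and \<delta>: "0 < \<delta>" and A: "A \<in> sets (F s)"
    and X [measurable]: "X \<in> borel_measurable (F s)" and XU: "\<And>\<omega>. \<omega> \<in> A \<Longrightarrow> X \<omega> \<in> U"
  shows "\<exists>R. integrable M R \<and> expectation R \<le> \<delta> * (C + 2 * \<kappa> * real CARD('n) + step_error \<delta>) \<and>
    (\<forall>\<omega>. \<omega> \<notin> A \<longrightarrow> 0 \<le> R \<omega>) \<and>
    (\<forall>\<omega>\<in>A. V (X \<omega> + \<delta> *\<^sub>R b (X \<omega>) + a *\<^sub>R (W (s + \<delta>) \<omega> - W s \<omega>)) - V (X \<omega>) \<le> R \<omega>)"
proof -
  define D where "D \<omega> = W (s + \<delta>) \<omega> - W s \<omega>" for \<omega>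
  have st: "s < s + \<delta>" using \<delta> by simp
  note [measurable] = A
  define I :: "'w \<Rightarrow> real" where "I = indicator A"
  have I [measurable]: "I \<in> borel_measurable (F s)" unfolding I_def by measurable
  \<comment> \<open>Coefficient of the noise \<open>D\<close>: the gradient together with the mixed
    terms of the squared forms at \<delta> b + a D. It is known at time \<open>s\<close>, so its
    contribution has mean zero.\<close>
  define Z where "Z \<omega> = I \<omega> *\<^sub>R (a *\<^sub>R P (X \<omega>) + (\<Sum>j\<in>J. (2 * a * \<delta> * q j (X \<omega>) * (v j \<bullet> b (X \<omega>))) *\<^sub>R v j))" for \<omega>
  define Y where "Y j \<omega> = I \<omega> * (a\<^sup>2 * q j (X \<omega>))" for j \<omega>
  define G where "G \<omega> = I \<omega> * (P (X \<omega>) \<bullet> b (X \<omega>))" for \<omega>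
  define c where "c = \<delta>\<^sup>2 * (B2 * B\<^sup>2 * (\<Sum>j\<in>J. v j \<bullet> v j)) + 2 * \<kappa> * (B\<^sup>2 * \<delta>\<^sup>2) + 8 * K * (B ^ 3 * \<delta> ^ 3)"
  \<comment> \<open>The factors 2 and 8 come from (u + v)^2 \<le> 2 (u^2 + v^2) and (u + v)^3 \<le>
    8 (u^3 + v^3) when the step is split into drift and noise. All terms of indefinite sign carry
    the indicator \<open>I\<close>.\<close>
  define R where "R \<omega> = c + \<delta> * G \<omega> + Z \<omega> \<bullet> D \<omega> + (\<Sum>j\<in>J. Y j \<omega> * (v j \<bullet> D \<omega>)\<^sup>2)
     + 2 * \<kappa> * (norm (D \<omega>))\<^sup>2 + 8 * K * norm (D \<omega>) ^ 3" for \<omega>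
  have a2: "a\<^sup>2 \<le> 1" using a by (simp add: power_le_one)
  have c0: "0 \<le> c" unfolding c_def using nonneg \<delta> B_nonneg
    by (intro add_nonneg_nonneg mult_nonneg_nonneg sum_nonneg) auto
  have Zb: "norm (Z \<omega>) \<le> B1 + (\<Sum>j\<in>J. 2 * \<delta> * B2 * (norm (v j) * B) * norm (v j))" for \<omega>
  proof (cases "\<omega> \<in> A")
    case True
    have "norm (Z \<omega>) \<le> norm (a *\<^sub>R P (X \<omega>)) + (\<Sum>j\<in>J. norm ((2 * a * \<delta> * q j (X \<omega>) * (v j \<bullet> b (X \<omega>))) *\<^sub>R v j))"
      unfolding Z_def using True
      by (auto simp: I_def intro!: order_trans[OF norm_triangle_ineq add_mono] order_trans[OF norm_sum] simp del: norm_scaleR)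
    also have "\<dots> \<le> B1 + (\<Sum>j\<in>J. 2 * \<delta> * B2 * (norm (v j) * B) * norm (v j))"
    proof (intro add_mono sum_mono)
      show "norm (a *\<^sub>R P (X \<omega>)) \<le> B1"
        using P_bound[OF XU[OF True]] a mult_mono[of a 1 "norm (P (X \<omega>))" B1] by simp
      fix j assume j: "j \<in> J"
      have vb: "\<bar>v j \<bullet> b (X \<omega>)\<bar> \<le> norm (v j) * B"
        using Cauchy_Schwarz_ineq2[of "v j" "b (X \<omega>)"] mult_left_mono[OF b_bound[of "X \<omega>"], of "norm (v j)"] by simp
      have "norm ((2 * a * \<delta> * q j (X \<omega>) * (v j \<bullet> b (X \<omega>))) *\<^sub>R v j)
          = (2 * a * \<delta>) * \<bar>q j (X \<omega>)\<bar> * \<bar>v j \<bullet> b (X \<omega>)\<bar> * norm (v j)"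
        using a \<delta> by (simp add: abs_mult)
      also have "\<dots> \<le> 2 * \<delta> * B2 * (norm (v j) * B) * norm (v j)"
        using vb q_bound[OF XU[OF True] j] a \<delta> nonneg
        by (intro mult_right_mono mult_mono) auto
      finally show "norm ((2 * a * \<delta> * q j (X \<omega>) * (v j \<bullet> b (X \<omega>))) *\<^sub>R v j)
          \<le> 2 * \<delta> * B2 * (norm (v j) * B) * norm (v j)" .
    qed
    finally show ?thesis .
  next
    case False
    then show ?thesis using nonneg \<delta> B_nonneg by (auto simp: Z_def I_def intro!: add_nonneg_nonneg sum_nonneg)
  qed
  have Yb: "\<bar>Y j \<omega>\<bar> \<le> B2" if j: "j \<in> J" for j \<omega>
  proof (cases "\<omega> \<in> A")
    case True
    then show ?thesis
      using mult_mono[OF a2 q_bound[OF XU[OF True] j]] nonneg by (simp add: Y_def I_def abs_mult)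
  qed (use nonneg in \<open>simp add: Y_def I_def\<close>)
  have Gb: "\<bar>G \<omega>\<bar> \<le> B1 * B" for \<omega>
  proof (cases "\<omega> \<in> A")
    case True
    have "\<bar>P (X \<omega>) \<bullet> b (X \<omega>)\<bar> \<le> norm (P (X \<omega>)) * norm (b (X \<omega>))" by (rule Cauchy_Schwarz_ineq2)
    also have "\<dots> \<le> B1 * B" using P_bound[OF XU[OF True]] b_bound nonneg by (intro mult_mono) auto
    finally show ?thesis using True by (simp add: G_def I_def)
  qed (use nonneg B_nonneg in \<open>simp add: G_def I_def\<close>)
  have Zm: "Z \<in> borel_measurable (F s)"
    unfolding Z_def by measurable
  have Ym: "Y j \<in> borel_measurable (F s)" if [measurable]: "j \<in> J" for j
    unfolding Y_def by measurable
  have Gm: "G \<in> borel_measurable (F s)" unfolding G_def by measurable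
  note past = past_inner_increment[OF s st Zm Zb, folded D_def]
    past_increment_square[OF s st Ym Yb, folded D_def]
    increment_norm_square[OF s st, folded D_def] increment_norm_cube[OF s st, folded D_def]
  have Yi: "integrable M (Y j)" if "j \<in> J" for j
    by (rule integrable_const_bound[of _ B2])
       (use Yb[OF that] measurable_from_subalg[OF subalgebra_F[OF s] Ym[OF that]] in auto)
  have Gi: "integrable M G"
    by (rule integrable_const_bound[of _ "B1 * B"])
       (use Gb measurable_from_subalg[OF subalgebra_F[OF s] Gm] in auto)
  have Ri: "integrable M R"
    unfolding R_def
    by (intro Bochner_Integration.integrable_add Bochner_Integration.integrable_sum integrable_mult_right past Gi) auto
  have "expectation R = c + \<delta> * expectation G + (\<Sum>j\<in>J. expectation (Y j) * ((v j \<bullet> v j) * \<delta>))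
     + 2 * \<kappa> * (real CARD('n) * \<delta>) + 8 * K * expectation (\<lambda>\<omega>. norm (D \<omega>) ^ 3)"
    unfolding R_def
    using past Gi prob_space
    by (simp add: Bochner_Integration.integral_sum)
  moreover have "\<delta> * expectation G + (\<Sum>j\<in>J. expectation (Y j) * ((v j \<bullet> v j) * \<delta>))
      = \<delta> * expectation (\<lambda>\<omega>. G \<omega> + (\<Sum>j\<in>J. Y j \<omega> * (v j \<bullet> v j)))"
    using Gi Yi by (simp add: Bochner_Integration.integral_sum sum_distrib_left algebra_simps)
  ultimately have "expectation R = c + \<delta> * expectation (\<lambda>\<omega>. G \<omega> + (\<Sum>j\<in>J. Y j \<omega> * (v j \<bullet> v j)))
     + 2 * \<kappa> * (real CARD('n) * \<delta>) + 8 * K * expectation (\<lambda>\<omega>. norm (D \<omega>) ^ 3)" by linarith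
  \<comment> \<open>Independence has replaced the squared increments by their variances; the
    integrand is now the generator, bounded pointwise by \<open>C\<close>.\<close>
  also have "expectation (\<lambda>\<omega>. G \<omega> + (\<Sum>j\<in>J. Y j \<omega> * (v j \<bullet> v j))) \<le> expectation (\<lambda>\<omega>. C)"
  proof (rule integral_mono)
    show "G \<omega> + (\<Sum>j\<in>J. Y j \<omega> * (v j \<bullet> v j)) \<le> C" for \<omega>
    proof (cases "\<omega> \<in> A")
      case True
      then show ?thesis using generator[OF XU[OF True]]
        by (simp add: G_def Y_def I_def sum_distrib_left mult_ac)
    qed (use nonneg in \<open>simp add: G_def Y_def I_def\<close>)
  qed (use Gi Yi in auto)
  also have "expectation (\<lambda>\<omega>. C) = C" using prob_space by simp
  also have "expectation (\<lambda>\<omega>. norm (D \<omega>) ^ 3) \<le> 2 * real CARD('n) ^ 4 * sqrt \<delta> ^ 3"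
    using past by simp
  also have "c + \<delta> * C + 2 * \<kappa> * (real CARD('n) * \<delta>) + 8 * K * (2 * real CARD('n) ^ 4 * sqrt \<delta> ^ 3)
     = \<delta> * (C + 2 * \<kappa> * real CARD('n) + step_error \<delta>)"
  proof -
    have "sqrt \<delta> ^ 3 = \<delta> * sqrt \<delta>" using \<delta> by (simp add: power3_eq_cube)
    then show ?thesis
      by (simp add: c_def step_error_def algebra_simps power2_eq_square power3_eq_cube)
  qed
  finally have ER: "expectation R \<le> \<delta> * (C + 2 * \<kappa> * real CARD('n) + step_error \<delta>)"
    using \<delta> nonneg by (simp add: mult_left_mono)
  have R0: "0 \<le> R \<omega>" if "\<omega> \<notin> A" for \<omega>
    using that c0 nonneg by (simp add: R_def Z_def Y_def G_def I_def)
  have RV: "V (X \<omega> + \<delta> *\<^sub>R b (X \<omega>) + a *\<^sub>R D \<omega>) - V (X \<omega>) \<le> R \<omega>" if w: "\<omega> \<in> A" for \<omega>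
  proof -
    define h where "h = \<delta> *\<^sub>R b (X \<omega>) + a *\<^sub>R D \<omega>"
    have "norm h \<le> norm (\<delta> *\<^sub>R b (X \<omega>)) + norm (a *\<^sub>R D \<omega>)" unfolding h_def by (rule norm_triangle_ineq)
    also have "\<dots> \<le> \<delta> * B + norm (D \<omega>)"
      using a \<delta> b_bound[of "X \<omega>"] by (intro add_mono) (auto simp: mult_left_le_one_le)
    finally have h: "norm h \<le> \<delta> * B + norm (D \<omega>)" .
    have "(norm h)\<^sup>2 \<le> (\<delta> * B + norm (D \<omega>))\<^sup>2" using h by (intro power_mono) auto
    also have "\<dots> \<le> 2 * (B\<^sup>2 * \<delta>\<^sup>2 + (norm (D \<omega>))\<^sup>2)"
      using sum_squares_bound[of "\<delta> * B" "norm (D \<omega>)"] by (simp add: power2_sum power_mult_distrib mult_ac)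
    finally have h2: "\<kappa> * (norm h)\<^sup>2 \<le> 2 * \<kappa> * (B\<^sup>2 * \<delta>\<^sup>2) + 2 * \<kappa> * (norm (D \<omega>))\<^sup>2"
      using nonneg mult_left_mono[of "(norm h)\<^sup>2" "2 * (B\<^sup>2 * \<delta>\<^sup>2 + (norm (D \<omega>))\<^sup>2)" \<kappa>] by (simp add: algebra_simps)
    have "norm h ^ 3 \<le> (\<delta> * B + norm (D \<omega>)) ^ 3" using h by (intro power_mono) auto
    also have "\<dots> \<le> 8 * ((\<delta> * B) ^ 3 + norm (D \<omega>) ^ 3)" using \<delta> B_nonneg by (intro add_power3_le) auto
    finally have h3: "K * norm h ^ 3 \<le> 8 * K * (B ^ 3 * \<delta> ^ 3) + 8 * K * norm (D \<omega>) ^ 3"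
      using nonneg mult_left_mono[of "norm h ^ 3" "8 * ((\<delta> * B) ^ 3 + norm (D \<omega>) ^ 3)" K]
      by (simp add: algebra_simps power_mult_distrib)
    have "(\<Sum>j\<in>J. q j (X \<omega>) * (v j \<bullet> h)\<^sup>2) \<le> (\<Sum>j\<in>J. \<delta>\<^sup>2 * (B2 * B\<^sup>2 * (v j \<bullet> v j))
        + (2 * a * \<delta> * q j (X \<omega>) * (v j \<bullet> b (X \<omega>))) * (v j \<bullet> D \<omega>) + Y j \<omega> * (v j \<bullet> D \<omega>)\<^sup>2)"
    proof (rule sum_mono)
      fix j assume j: "j \<in> J"
      have "(v j \<bullet> b (X \<omega>))\<^sup>2 \<le> (v j \<bullet> v j) * (b (X \<omega>) \<bullet> b (X \<omega>))" by (rule Cauchy_Schwarz_ineq)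
      also have "b (X \<omega>) \<bullet> b (X \<omega>) \<le> B\<^sup>2"
        using b_bound[of "X \<omega>"] by (simp add: power_mono flip: power2_norm_eq_inner)
      finally have *: "(v j \<bullet> b (X \<omega>))\<^sup>2 \<le> (v j \<bullet> v j) * B\<^sup>2" by (simp add: mult_left_mono)
      have "q j (X \<omega>) * (v j \<bullet> b (X \<omega>))\<^sup>2 \<le> B2 * ((v j \<bullet> v j) * B\<^sup>2)"
        using * q_bound[OF XU[OF w] j] nonneg by (intro mult_mono) auto
      from mult_left_mono[OF this, of "\<delta>\<^sup>2"]
      show "q j (X \<omega>) * (v j \<bullet> h)\<^sup>2 \<le> \<delta>\<^sup>2 * (B2 * B\<^sup>2 * (v j \<bullet> v j))
        + (2 * a * \<delta> * q j (X \<omega>) * (v j \<bullet> b (X \<omega>))) * (v j \<bullet> D \<omega>) + Y j \<omega> * (v j \<bullet> D \<omega>)\<^sup>2"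
        using w by (simp add: h_def Y_def I_def inner_add_right power2_eq_square algebra_simps)
    qed
    also have "\<dots> = \<delta>\<^sup>2 * (B2 * B\<^sup>2 * (\<Sum>j\<in>J. v j \<bullet> v j))
        + (\<Sum>j\<in>J. (2 * a * \<delta> * q j (X \<omega>) * (v j \<bullet> b (X \<omega>))) * (v j \<bullet> D \<omega>)) + (\<Sum>j\<in>J. Y j \<omega> * (v j \<bullet> D \<omega>)\<^sup>2)"
      by (simp add: sum.distrib sum_distrib_left mult_ac)
    finally have hq: "(\<Sum>j\<in>J. q j (X \<omega>) * (v j \<bullet> h)\<^sup>2) \<le> \<dots>" .
    have hP: "P (X \<omega>) \<bullet> h + (\<Sum>j\<in>J. (2 * a * \<delta> * q j (X \<omega>) * (v j \<bullet> b (X \<omega>))) * (v j \<bullet> D \<omega>)) = \<delta> * G \<omega> + Z \<omega> \<bullet> D \<omega>"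
      using w by (simp add: h_def Z_def G_def I_def inner_add_right inner_add_left inner_sum_left algebra_simps)
    have "V (X \<omega> + h) - V (X \<omega>) \<le> R \<omega>"
      using expansion[OF XU[OF w], of h] hq h2 h3 hP unfolding R_def c_def by linarith
    then show ?thesis by (simp add: h_def add.assoc)
  qed
  show ?thesis
    using Ri ER R0 RV unfolding D_def by blast
qed

text \<open>Only increments of the forcing enter \<open>euler\<close>. The start \<open>x\<close> is
  passed separately, since \<open>W 0\<close> vanishes only almost surely while the scheme should
  start at \<open>x\<close> on every path.\<close>

definition X :: "real ^ 'n \<Rightarrow> real \<Rightarrow> nat \<Rightarrow> 'w \<Rightarrow> real ^ 'n" where
  "X x \<delta> i \<omega> = euler b x (\<lambda>t. x + a *\<^sub>R W t \<omega>) \<delta> i"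

lemma X_measurable:
  assumes "0 \<le> \<delta>" "i \<le> k"
  shows "X x \<delta> i \<in> borel_measurable (F (real k * \<delta>))"
proof -
  have le: "real i * \<delta> \<le> real k * \<delta>" using assms by (simp add: mult_right_mono)
  show ?thesis unfolding X_def
    by (intro euler_measurable borel_measurable_add borel_measurable_scaleR borel_measurable_const W_measurable b_measurable)
       (use assms le in auto)
qed

text \<open>A Markov inequality at the first exit, without stopped processes. Telescoping up to the
  first exit index yields a value of \<open>V\<close> that is at least \<Lambda>; on paths without
  exit, nonnegativity of \<open>V\<close> is enough. The majorants after the exit are nonnegative,
  so the sum can run up to \<open>N\<close> on every path.\<close>

lemma euler_exit_bound:
  assumes \<delta>: "0 < \<delta>"
  shows "{\<omega> \<in> space M. \<exists>i\<le>N. X x \<delta> i \<omega> \<notin> U} \<in> events"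
    "\<Lambda> * prob {\<omega> \<in> space M. \<exists>i\<le>N. X x \<delta> i \<omega> \<notin> U}
       \<le> V x + real N * (\<delta> * (C + 2 * \<kappa> * real CARD('n) + step_error \<delta>))"
proof -
  define A where "A i = {\<omega> \<in> space M. \<forall>k\<le>i. X x \<delta> k \<omega> \<in> U}" for i
  have A: "A i \<in> sets (F (real i * \<delta>))" for i
  proof -
    have "{\<omega> \<in> space (F (real i * \<delta>)). X x \<delta> k \<omega> \<in> U} \<in> sets (F (real i * \<delta>))" if "k \<le> i" for k
    proof -
      have [measurable]: "X x \<delta> k \<in> borel_measurable (F (real i * \<delta>))"
        using X_measurable[of \<delta> k i x] \<delta> that by simp
      show ?thesis by measurable
    qed
    then have "{\<omega> \<in> space (F (real i * \<delta>)). \<forall>k\<in>{..i}. X x \<delta> k \<omega> \<in> U} \<in> sets (F (real i * \<delta>))"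
      by (intro sets.sets_Collect_finite_All) auto
    then show ?thesis unfolding A_def space_F Ball_def atMost_iff .
  qed
  have Xm [measurable]: "X x \<delta> i \<in> borel_measurable M" for i
    by (rule measurable_from_subalg[OF subalgebra_F X_measurable[of \<delta> i i x]]) (use \<delta> in auto)
  show E: "{\<omega> \<in> space M. \<exists>i\<le>N. X x \<delta> i \<omega> \<notin> U} \<in> events"
    by measurable
  have "\<forall>i. \<exists>R. integrable M R \<and> expectation R \<le> \<delta> * (C + 2 * \<kappa> * real CARD('n) + step_error \<delta>) \<and>
    (\<forall>\<omega>. \<omega> \<notin> A i \<longrightarrow> 0 \<le> R \<omega>) \<and>
    (\<forall>\<omega>\<in>A i. V (X x \<delta> (Suc i) \<omega>) - V (X x \<delta> i \<omega>) \<le> R \<omega>)"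
  proof
    fix i
    have eq: "X x \<delta> i \<omega> + \<delta> *\<^sub>R b (X x \<delta> i \<omega>) + a *\<^sub>R (W (real i * \<delta> + \<delta>) \<omega> - W (real i * \<delta>) \<omega>)
        = X x \<delta> (Suc i) \<omega>" for \<omega>
      by (simp add: X_def algebra_simps)
    show "\<exists>R. integrable M R \<and> expectation R \<le> \<delta> * (C + 2 * \<kappa> * real CARD('n) + step_error \<delta>) \<and>
      (\<forall>\<omega>. \<omega> \<notin> A i \<longrightarrow> 0 \<le> R \<omega>) \<and>
      (\<forall>\<omega>\<in>A i. V (X x \<delta> (Suc i) \<omega>) - V (X x \<delta> i \<omega>) \<le> R \<omega>)"
      unfolding eq[symmetric]
      by (rule one_step[OF _ \<delta> A]) (use \<delta> in \<open>auto simp: A_def intro: X_measurable\<close>)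
  qed
  then obtain R where Ri: "\<And>i. integrable M (R i)"
    and ER: "\<And>i. expectation (R i) \<le> \<delta> * (C + 2 * \<kappa> * real CARD('n) + step_error \<delta>)"
    and R0: "\<And>i \<omega>. \<omega> \<notin> A i \<Longrightarrow> 0 \<le> R i \<omega>"
    and RV: "\<And>i \<omega>. \<omega> \<in> A i \<Longrightarrow> V (X x \<delta> (Suc i) \<omega>) - V (X x \<delta> i \<omega>) \<le> R i \<omega>"
    by metis
  have *: "\<Lambda> * indicator {\<omega> \<in> space M. \<exists>i\<le>N. X x \<delta> i \<omega> \<notin> U} \<omega> \<le> V x + (\<Sum>i<N. R i \<omega>)"
    if w: "\<omega> \<in> space M" for \<omega>
  proof -
    have tele: "V (X x \<delta> m \<omega>) \<le> V x + (\<Sum>i<N. R i \<omega>)"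
      if m: "m \<le> N" "\<And>i. i < m \<Longrightarrow> X x \<delta> i \<omega> \<in> U" "m = N \<or> X x \<delta> m \<omega> \<notin> U" for m
    proof -
      have "V (X x \<delta> m \<omega>) - V (X x \<delta> 0 \<omega>) = (\<Sum>i<m. V (X x \<delta> (Suc i) \<omega>) - V (X x \<delta> i \<omega>))"
        by (rule sum_lessThan_telescope[symmetric])
      also have "\<dots> \<le> (\<Sum>i<m. R i \<omega>)"
        by (intro sum_mono RV) (use m w in \<open>auto simp: A_def\<close>)
      also have "\<dots> \<le> (\<Sum>i<N. R i \<omega>)"
        using m by (intro sum_mono2 R0) (auto simp: A_def)
      finally show ?thesis by (simp add: X_def)
    qed
    show ?thesis
    proof (cases "\<exists>i\<le>N. X x \<delta> i \<omega> \<notin> U")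
      case True
      define m where "m = (LEAST i. X x \<delta> i \<omega> \<notin> U)"
      have m: "X x \<delta> m \<omega> \<notin> U" unfolding m_def using True LeastI_ex[of "\<lambda>i. X x \<delta> i \<omega> \<notin> U"] by blast
      moreover have "m \<le> N" using True unfolding m_def by (auto intro: order_trans[OF Least_le])
      moreover have "X x \<delta> i \<omega> \<in> U" if "i < m" for i using not_less_Least[OF that[unfolded m_def]] by simp
      ultimately have "V (X x \<delta> m \<omega>) \<le> V x + (\<Sum>i<N. R i \<omega>)" by (intro tele) auto
      then show ?thesis using V_outside[OF m] True w by simp
    next
      case False
      then have "V (X x \<delta> N \<omega>) \<le> V x + (\<Sum>i<N. R i \<omega>)" by (intro tele) auto
      then show ?thesis using V_nonneg[of "X x \<delta> N \<omega>"] False w by simp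
    qed
  qed
  have "\<Lambda> * prob {\<omega> \<in> space M. \<exists>i\<le>N. X x \<delta> i \<omega> \<notin> U}
      = expectation (\<lambda>\<omega>. \<Lambda> * indicator {\<omega> \<in> space M. \<exists>i\<le>N. X x \<delta> i \<omega> \<notin> U} \<omega>)"
    using E by simp
  also have "\<dots> \<le> expectation (\<lambda>\<omega>. V x + (\<Sum>i<N. R i \<omega>))"
    using E Ri * by (intro integral_mono) (auto simp: emeasure_eq_measure)
  also have "\<dots> = V x + (\<Sum>i<N. expectation (R i))"
    using Ri prob_space by (simp add: Bochner_Integration.integral_sum)
  also have "\<dots> \<le> V x + (\<Sum>i<N. \<delta> * (C + 2 * \<kappa> * real CARD('n) + step_error \<delta>))"
    by (intro add_left_mono sum_mono ER)
  finally show "\<Lambda> * prob {\<omega> \<in> space M. \<exists>i\<le>N. X x \<delta> i \<omega> \<notin> U}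
       \<le> V x + real N * (\<delta> * (C + 2 * \<kappa> * real CARD('n) + step_error \<delta>))" by simp
qed

text \<open>The right-hand side does not depend on the bounds \<open>B\<close>, \<open>B1\<close>, \<open>B2\<close> and \<open>K\<close>, which blow up
  when the truncation is removed.\<close>

lemma eventual_exit_bound:
  fixes x :: "real ^ 'n"
  assumes T: "0 < T" and \<Lambda>: "0 < \<Lambda>"
  defines "E \<equiv> \<lambda>N. {\<omega> \<in> space M. \<exists>i\<le>N. X x (T / real N) i \<omega> \<notin> U}"
  shows "(\<Union>k. \<Inter>N\<in>{Suc k..}. E N) \<in> events"
    "\<Lambda> * prob (\<Union>k. \<Inter>N\<in>{Suc k..}. E N) \<le> V x + T * (C + 2 * \<kappa> * real CARD('n))"
proof -
  \<comment> \<open>Exit for all N > k. Starting at \<open>Suc k\<close> leaves out N = 0, where the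
    step T / 0 is 0 and the bound for positive steps does not apply. For fixed \<open>k\<close> the
    event is contained in every \<open>E N\<close> with N > k, so the step size can tend to 0 while
    the event is held fixed.\<close>
  let ?L = "\<lambda>k. \<Inter>N\<in>{Suc k..}. E N"
  have E: "E N \<in> events" if "N > 0" for N
    unfolding E_def using T that by (intro euler_exit_bound) auto
  then have L: "?L k \<in> events" for k by (intro sets.countable_INT') auto
  then show "(\<Union>k. ?L k) \<in> events" by auto
  have "(\<lambda>N. step_error (T / real N)) \<longlonglongrightarrow> step_error 0"
    unfolding step_error_def
    by (intro tendsto_intros lim_const_over_n tendsto_eq_rhs[OF tendsto_real_sqrt[OF lim_const_over_n[of T]]]) simp_all
  then have lim: "(\<lambda>N. V x + T * (C + 2 * \<kappa> * real CARD('n) + step_error (T / real N)))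
      \<longlonglongrightarrow> V x + T * (C + 2 * \<kappa> * real CARD('n) + step_error 0)"
    by (intro tendsto_intros)
  have "\<Lambda> * prob (?L k) \<le> V x + T * (C + 2 * \<kappa> * real CARD('n))" for k
  proof -
    have "\<forall>\<^sub>F N in sequentially. \<Lambda> * prob (?L k) \<le> V x + T * (C + 2 * \<kappa> * real CARD('n) + step_error (T / real N))"
      using eventually_ge_at_top[of "Suc k"]
    proof eventually_elim
      case (elim N)
      have "\<Lambda> * prob (?L k) \<le> \<Lambda> * prob (E N)"
        using elim \<Lambda> E[of N] L by (intro mult_left_mono finite_measure_mono) auto
      also have "\<dots> \<le> V x + real N * (T / real N * (C + 2 * \<kappa> * real CARD('n) + step_error (T / real N)))"
        unfolding E_def using T elim by (intro euler_exit_bound) auto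
      also have "\<dots> = V x + T * (C + 2 * \<kappa> * real CARD('n) + step_error (T / real N))"
        using elim by simp
      finally show ?case .
    qed
    from tendsto_lowerbound[OF lim this] show ?thesis by (simp add: step_error_def)
  qed
  moreover have "(\<lambda>k. \<Lambda> * prob (?L k)) \<longlonglongrightarrow> \<Lambda> * prob (\<Union>k. ?L k)"
    using L by (intro tendsto_intros finite_Lim_measure_incseq) (auto simp: incseq_def)
  ultimately show "\<Lambda> * prob (\<Union>k. ?L k) \<le> V x + T * (C + 2 * \<kappa> * real CARD('n))"
    using LIMSEQ_le_const2 by blast
qed

end

section \<open>Truncated hyperbolic drifts\<close>

lemma coth_diff:
  assumes "x \<noteq> 0" "y \<noteq> 0"
  shows "coth x - coth y = sinh (y - x) / (sinh x * sinh y)"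
proof -
  have "coth x - coth y = (cosh x * sinh y - cosh y * sinh x) / (sinh x * sinh y)"
    unfolding coth_def using assms by (intro diff_frac_eq) auto
  also have "cosh x * sinh y - cosh y * sinh x = sinh (y - x)"
    unfolding sinh_diff by (rule arg_cong2[where f = minus, OF mult.commute refl])
  finally show ?thesis .
qed

lemma coth_antimono: "0 < x \<Longrightarrow> x \<le> y \<Longrightarrow> coth y \<le> coth x"
proof -
  assume "0 < x" "x \<le> y"
  then have "0 \<le> sinh (y - x) / (sinh x * sinh y)" by simp
  then show ?thesis using coth_diff[of x y] \<open>0 < x\<close> \<open>x \<le> y\<close> by linarith
qed

lemma coth_pos: "0 < x \<Longrightarrow> 0 < coth x"
  by (simp add: coth_def)

text \<open>Amounts to coth x - 1 = exp (- x) / sinh x \<le> 1 / x, which is exp (2 x) \<ge> 1 + 2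
  x. It bounds the inner product of position and drift by linear growth, uniformly up to the
  boundary of the chamber.\<close>

lemma mult_coth_le:
  assumes "0 < x"
  shows "x * coth x \<le> 1 + x"
proof -
  have "2 * x \<le> exp (2 * x) - 1" using exp_ge_add_one_self[of "2 * x"] by linarith
  then have "x * exp (- x) \<le> (exp (2 * x) - 1) / 2 * exp (- x)" by (intro mult_right_mono) auto
  also have "\<dots> = sinh x * 1"
    by (simp add: sinh_field_def field_simps flip: exp_add)
  finally have "x * (cosh x - sinh x) \<le> sinh x" by (simp add: cosh_minus_sinh)
  then show ?thesis using assms by (simp add: coth_def field_simps)
qed

lemma DERIV_coth: "x \<noteq> 0 \<Longrightarrow> (coth has_real_derivative - 1 / (sinh x)\<^sup>2) (at x)"
proof -
  assume x: "x \<noteq> 0"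
  have "((\<lambda>x. cosh x / sinh x) has_real_derivative
      (sinh x * sinh x - cosh x * cosh x) / (sinh x * sinh x)) (at x)"
    using x by (auto intro!: derivative_eq_intros)
  also have "sinh x * sinh x - cosh x * cosh x = - 1"
    using cosh_square_eq[of x] by (simp add: power2_eq_square)
  finally show ?thesis
    by (simp add: coth_def[abs_def] power2_eq_square)
qed

lemma DERIV_ln_sinh: "0 < x \<Longrightarrow> ((\<lambda>x. ln (sinh x)) has_real_derivative coth x) (at x)"
  by (auto intro!: derivative_eq_intros simp: coth_def)

lemma DERIV_inverse_sinh_square:
  "x \<noteq> 0 \<Longrightarrow> ((\<lambda>x. - 1 / (sinh x)\<^sup>2) has_real_derivative 2 * cosh x / sinh x ^ 3) (at x)"
  by (auto intro!: derivative_eq_intros simp: field_simps power2_eq_square power3_eq_cube)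

lemma coth_max_lipschitz:
  assumes "0 < \<epsilon>"
  shows "\<bar>coth (max u \<epsilon>) - coth (max v \<epsilon>)\<bar> \<le> 1 / (sinh \<epsilon>)\<^sup>2 * \<bar>u - v\<bar>"
proof -
  have "norm (coth (max u \<epsilon>) - coth (max v \<epsilon>)) \<le> 1 / (sinh \<epsilon>)\<^sup>2 * norm (max u \<epsilon> - max v \<epsilon>)"
  proof (rule field_differentiable_bound[where S = "{\<epsilon>..}"])
    fix x assume x: "x \<in> {\<epsilon>..}"
    then show "(coth has_field_derivative - 1 / (sinh x)\<^sup>2) (at x within {\<epsilon>..})"
      using assms by (intro DERIV_subset[OF DERIV_coth]) auto
    have "(sinh \<epsilon>)\<^sup>2 \<le> (sinh x)\<^sup>2" using x assms by (intro power_mono) auto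
    moreover have "0 < (sinh \<epsilon>)\<^sup>2" using assms by simp
    ultimately show "norm (- 1 / (sinh x)\<^sup>2) \<le> 1 / (sinh \<epsilon>)\<^sup>2"
      by (simp add: frac_le)
  qed auto
  also have "\<dots> \<le> 1 / (sinh \<epsilon>)\<^sup>2 * \<bar>u - v\<bar>" by (intro mult_left_mono) auto
  finally show ?thesis by simp
qed

text \<open>Frozen below \<epsilon>, hence not a primitive of the truncated coth there: below
  \<epsilon> it only has to supply the barrier value ln (sinh \<epsilon>), while above \<epsilon>
  its derivative is the coth of the drift.\<close>

definition trunc_log_sinh :: "real \<Rightarrow> real \<Rightarrow> real" where
  "trunc_log_sinh \<epsilon> u = ln (sinh (max u \<epsilon>))"

text \<open>The third derivative 2 coth / sinh^2 is positive and decreasing, hence largest at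
  \<epsilon>; division by 3! gives the cubic constant. The quadratic coefficient is kept exact at
  \<open>u\<close>, since the drift has to compensate it later.\<close>

lemma ln_sinh_taylor:
  assumes "0 < \<epsilon>" "\<epsilon> \<le> u" "\<epsilon> \<le> w"
  shows "ln (sinh u) + coth u * (w - u) - (w - u)\<^sup>2 / (2 * (sinh u)\<^sup>2)
     - coth \<epsilon> / (3 * (sinh \<epsilon>)\<^sup>2) * \<bar>w - u\<bar> ^ 3 \<le> ln (sinh w)"
proof (cases "w = u")
  case False
  define d where "d m = (case m of 0 \<Rightarrow> (\<lambda>x. ln (sinh x)) | Suc 0 \<Rightarrow> coth
     | Suc (Suc 0) \<Rightarrow> (\<lambda>x. - 1 / (sinh x)\<^sup>2) | _ \<Rightarrow> (\<lambda>x. 2 * cosh x / sinh x ^ 3))" for m :: nat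
  have D: "DERIV (d m) t :> d (Suc m) t" if m: "m < 3" "\<epsilon> \<le> t" for m t
  proof -
    have "m = 0 \<or> m = 1 \<or> m = 2" using m by auto
    then show ?thesis
      using DERIV_coth[of t] DERIV_ln_sinh[of t] DERIV_inverse_sinh_square[of t] m assms
      by (auto simp: d_def numeral_2_eq_2)
  qed
  have "\<exists>t. (if w < u then w < t \<and> t < u else u < t \<and> t < w) \<and>
    ln (sinh w) = (\<Sum>m<3. d m u / fact m * (w - u) ^ m) + d 3 t / fact 3 * (w - u) ^ 3"
    by (rule Taylor[where a = \<epsilon> and b = "max u w"]) (use D assms False in \<open>auto simp: d_def\<close>)
  then obtain t where t: "\<epsilon> \<le> t"
    and eq: "ln (sinh w) = (\<Sum>m<3. d m u / fact m * (w - u) ^ m) + d 3 t / fact 3 * (w - u) ^ 3"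
    using assms by (smt (verit))
  have s: "0 < sinh \<epsilon>" "sinh \<epsilon> \<le> sinh t" using assms t by auto
  have "d 3 t = 2 * (coth t * (1 / (sinh t)\<^sup>2))"
    by (simp add: d_def numeral_3_eq_3 coth_def power2_eq_square)
  also have "\<dots> \<le> 2 * (coth \<epsilon> * (1 / (sinh \<epsilon>)\<^sup>2))"
    using s t assms coth_pos[of \<epsilon>]
    by (intro mult_left_mono mult_mono coth_antimono divide_left_mono power_mono) auto
  finally have d3: "d 3 t \<le> 2 * coth \<epsilon> / (sinh \<epsilon>)\<^sup>2" by simp
  have d0: "0 \<le> d 3 t" using s t assms by (simp add: d_def numeral_3_eq_3)
  have "- (coth \<epsilon> / (3 * (sinh \<epsilon>)\<^sup>2) * \<bar>w - u\<bar> ^ 3) \<le> - (d 3 t / 6 * \<bar>w - u\<bar> ^ 3)"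
    using d3 mult_right_mono[of "d 3 t / 6" "coth \<epsilon> / (3 * (sinh \<epsilon>)\<^sup>2)" "\<bar>w - u\<bar> ^ 3"] by (simp add: field_simps)
  also have "\<dots> \<le> d 3 t / 6 * (w - u) ^ 3"
  proof -
    have "- (\<bar>w - u\<bar> ^ 3) \<le> (w - u) ^ 3" by (metis abs_ge_minus_self minus_le_iff power_abs)
    from mult_left_mono[OF this, of "d 3 t / 6"] d0 show ?thesis by simp
  qed
  finally show ?thesis unfolding eq
    by (simp add: lessThan_nat_numeral d_def fact_numeral numeral_2_eq_2)
qed simp

text \<open>If u + h falls below \<epsilon>, the expansion is applied at the clipped point
  \<epsilon> instead. Clipping shortens a downward step, which raises the linear term and shrinks
  both subtracted terms, so the bound for the full step \<open>h\<close> is the weaker one.\<close>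

lemma trunc_log_sinh_expansion:
  assumes e: "0 < \<epsilon>" and u: "\<epsilon> < u"
  shows "trunc_log_sinh \<epsilon> u + coth u * h - 1 / (2 * (sinh u)\<^sup>2) * h\<^sup>2
     - coth \<epsilon> / (3 * (sinh \<epsilon>)\<^sup>2) * \<bar>h\<bar> ^ 3 \<le> trunc_log_sinh \<epsilon> (u + h)"
proof (cases "\<epsilon> \<le> u + h")
  case True
  then show ?thesis using ln_sinh_taylor[of \<epsilon> u "u + h"] assms
    by (simp add: trunc_log_sinh_def max_absorb1)
next
  case False
  have c: "0 < coth u" "0 < coth \<epsilon>" using assms coth_pos by auto
  have le: "coth u * h - 1 / (2 * (sinh u)\<^sup>2) * h\<^sup>2 \<le> coth u * (\<epsilon> - u) - 1 / (2 * (sinh u)\<^sup>2) * (\<epsilon> - u)\<^sup>2"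
  proof -
    have "(\<epsilon> - u)\<^sup>2 \<le> h\<^sup>2" using False u by (intro abs_le_square_iff[THEN iffD1]) auto
    moreover have "coth u * h \<le> coth u * (\<epsilon> - u)" using False c by (intro mult_left_mono) auto
    moreover from calculation have "1 / (2 * (sinh u)\<^sup>2) * (\<epsilon> - u)\<^sup>2 \<le> 1 / (2 * (sinh u)\<^sup>2) * h\<^sup>2"
      by (intro mult_left_mono) auto
    ultimately show ?thesis by linarith
  qed
  have "\<bar>\<epsilon> - u\<bar> ^ 3 \<le> \<bar>h\<bar> ^ 3" using False u by (intro power_mono) auto
  then have "coth \<epsilon> / (3 * (sinh \<epsilon>)\<^sup>2) * \<bar>\<epsilon> - u\<bar> ^ 3 \<le> coth \<epsilon> / (3 * (sinh \<epsilon>)\<^sup>2) * \<bar>h\<bar> ^ 3"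
    using c by (intro mult_left_mono) auto
  with le show ?thesis using ln_sinh_taylor[of \<epsilon> u \<epsilon>] assms False
    by (simp add: trunc_log_sinh_def max_absorb1 max_absorb2)
qed

text \<open>Origin of the restriction \<epsilon> \<le> 1/2: it makes ln (sinh \<epsilon>) negative,
  so the barrier is positive and the truncated logarithm stays below \<bar>u\<bar>.\<close>

lemma sinh_less_1: "\<epsilon> \<le> 1 / 2 \<Longrightarrow> sinh \<epsilon> < (1 :: real)"
proof -
  assume "\<epsilon> \<le> 1 / 2"
  then have "exp \<epsilon> \<le> exp (1 / 2 :: real)" by simp
  then have "exp \<epsilon> < 2 + exp (- \<epsilon>)" using exp_half_le2 exp_gt_zero[of "- \<epsilon>"] by linarith
  then show ?thesis unfolding sinh_field_def by simp
qed

lemma trunc_log_sinh_le: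
  assumes "0 < \<epsilon>" "\<epsilon> \<le> 1 / 2"
  shows "trunc_log_sinh \<epsilon> u \<le> \<bar>u\<bar>"
proof (cases "u \<le> \<epsilon>")
  case True
  then show ?thesis using assms sinh_less_1[of \<epsilon>] by (auto simp: trunc_log_sinh_def max_absorb2 intro: order_trans[of _ 0])
next
  case False
  have "sinh u \<le> exp u" using order_trans[of "- exp (- u)" 0 "exp u"] unfolding sinh_field_def by simp
  then have "ln (sinh u) \<le> u" using False assms by (metis exp_gt_zero ln_exp ln_le_cancel_iff not_le order.strict_trans sinh_real_pos_iff)
  then show ?thesis using False by (simp add: trunc_log_sinh_def max_absorb1)
qed

section \<open>The truncated drift and the Lyapunov function of a finite family of linear
  forms\<close>

definition trunc_drift :: "real \<Rightarrow> 'j set \<Rightarrow> ('j \<Rightarrow> 'a) \<Rightarrow> 'a \<Rightarrow> 'a::euclidean_space" where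
  "trunc_drift \<epsilon> J \<alpha> x = (1 / 2) *\<^sub>R (\<Sum>j\<in>J. coth (max (\<alpha> j \<bullet> x) \<epsilon>) *\<^sub>R \<alpha> j)"

definition chamber :: "'j set \<Rightarrow> ('j \<Rightarrow> 'a) \<Rightarrow> 'a::euclidean_space set" where
  "chamber J \<alpha> = {x. \<forall>j\<in>J. 0 < \<alpha> j \<bullet> x}"

lemma trunc_drift_eq:
  assumes "\<And>j. j \<in> J \<Longrightarrow> \<epsilon> \<le> \<alpha> j \<bullet> x" "\<delta> \<le> \<epsilon>"
  shows "trunc_drift \<epsilon> J \<alpha> x = trunc_drift \<delta> J \<alpha> x"
  unfolding trunc_drift_def using assms
  by (intro arg_cong[where f = "scaleR _"] sum.cong refl) (fastforce simp: max_absorb1)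

text \<open>Each summand pairs a nonincreasing function of \<alpha> j \<bullet> x with the direction
  \<alpha> j, and truncation keeps it nonincreasing. Positivity of the maximum covers both uses:
  \<epsilon> > 0 on the whole space, and \<epsilon> = 0 on the chamber, where it is the original
  drift.\<close>

lemma trunc_drift_monotone:
  assumes "\<And>j. j \<in> J \<Longrightarrow> 0 < max (\<alpha> j \<bullet> x) \<epsilon>" "\<And>j. j \<in> J \<Longrightarrow> 0 < max (\<alpha> j \<bullet> y) \<epsilon>"
  shows "(x - y) \<bullet> (trunc_drift \<epsilon> J \<alpha> x - trunc_drift \<epsilon> J \<alpha> y) \<le> 0"
proof -
  have diff: "trunc_drift \<epsilon> J \<alpha> x - trunc_drift \<epsilon> J \<alpha> y =
      (1 / 2) *\<^sub>R (\<Sum>j\<in>J. (coth (max (\<alpha> j \<bullet> x) \<epsilon>) - coth (max (\<alpha> j \<bullet> y) \<epsilon>)) *\<^sub>R \<alpha> j)"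
    by (simp add: trunc_drift_def scaleR_diff_left sum_subtractf scaleR_diff_right)
  have "(x - y) \<bullet> (trunc_drift \<epsilon> J \<alpha> x - trunc_drift \<epsilon> J \<alpha> y) =
     1 / 2 * (\<Sum>j\<in>J. (coth (max (\<alpha> j \<bullet> x) \<epsilon>) - coth (max (\<alpha> j \<bullet> y) \<epsilon>)) * (\<alpha> j \<bullet> x - \<alpha> j \<bullet> y))"
    unfolding diff inner_scaleR_right inner_sum_right
    by (simp add: inner_diff_right inner_commute[of "x - y"])
  also have "\<dots> \<le> 1 / 2 * 0"
  proof (intro mult_left_mono sum_nonpos)
    fix j assume j: "j \<in> J"
    show "(coth (max (\<alpha> j \<bullet> x) \<epsilon>) - coth (max (\<alpha> j \<bullet> y) \<epsilon>)) * (\<alpha> j \<bullet> x - \<alpha> j \<bullet> y) \<le> 0"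
    proof (cases "\<alpha> j \<bullet> x \<le> \<alpha> j \<bullet> y")
      case True
      then show ?thesis
        using assms[OF j] by (intro mult_nonneg_nonpos) (auto intro!: coth_antimono)
    next
      case False
      then show ?thesis
        using assms[OF j] by (intro mult_nonpos_nonneg) (auto intro!: coth_antimono)
    qed
  qed simp
  finally show ?thesis by simp
qed

lemma trunc_drift_lipschitz:
  assumes "0 < \<epsilon>"
  shows "((\<Sum>j\<in>J. (norm (\<alpha> j))\<^sup>2) / (sinh \<epsilon>)\<^sup>2)-lipschitz_on UNIV (trunc_drift \<epsilon> J \<alpha>)"
proof (rule lipschitz_onI)
  fix x y :: 'a
  have "norm (\<Sum>j\<in>J. (coth (max (\<alpha> j \<bullet> x) \<epsilon>) - coth (max (\<alpha> j \<bullet> y) \<epsilon>)) *\<^sub>R \<alpha> j)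
      \<le> (\<Sum>j\<in>J. (norm (\<alpha> j))\<^sup>2 / (sinh \<epsilon>)\<^sup>2 * norm (x - y))"
  proof (rule sum_norm_le)
    fix j
    have "\<bar>coth (max (\<alpha> j \<bullet> x) \<epsilon>) - coth (max (\<alpha> j \<bullet> y) \<epsilon>)\<bar> \<le> 1 / (sinh \<epsilon>)\<^sup>2 * \<bar>\<alpha> j \<bullet> x - \<alpha> j \<bullet> y\<bar>"
      by (rule coth_max_lipschitz[OF assms])
    also have "\<dots> \<le> 1 / (sinh \<epsilon>)\<^sup>2 * (norm (\<alpha> j) * norm (x - y))"
      using Cauchy_Schwarz_ineq2[of "\<alpha> j" "x - y"] by (intro mult_left_mono) (auto simp: inner_diff_right)
    finally show "norm ((coth (max (\<alpha> j \<bullet> x) \<epsilon>) - coth (max (\<alpha> j \<bullet> y) \<epsilon>)) *\<^sub>R \<alpha> j)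
        \<le> (norm (\<alpha> j))\<^sup>2 / (sinh \<epsilon>)\<^sup>2 * norm (x - y)"
      using mult_right_mono[of _ _ "norm (\<alpha> j)"] by (fastforce simp: power2_eq_square mult_ac)
  qed
  also have "\<dots> = (\<Sum>j\<in>J. (norm (\<alpha> j))\<^sup>2) / (sinh \<epsilon>)\<^sup>2 * norm (x - y)"
    by (simp add: sum_distrib_right sum_divide_distrib)
  finally have "norm ((1 / 2) *\<^sub>R (\<Sum>j\<in>J. (coth (max (\<alpha> j \<bullet> x) \<epsilon>) - coth (max (\<alpha> j \<bullet> y) \<epsilon>)) *\<^sub>R \<alpha> j))
      \<le> (\<Sum>j\<in>J. (norm (\<alpha> j))\<^sup>2) / (sinh \<epsilon>)\<^sup>2 * norm (x - y)"
    using norm_ge_zero[of "\<Sum>j\<in>J. (coth (max (\<alpha> j \<bullet> x) \<epsilon>) - coth (max (\<alpha> j \<bullet> y) \<epsilon>)) *\<^sub>R \<alpha> j"]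
    unfolding norm_scaleR by linarith
  then show "dist (trunc_drift \<epsilon> J \<alpha> x) (trunc_drift \<epsilon> J \<alpha> y) \<le> (\<Sum>j\<in>J. (norm (\<alpha> j))\<^sup>2) / (sinh \<epsilon>)\<^sup>2 * dist x y"
    by (simp add: dist_norm trunc_drift_def scaleR_diff_left sum_subtractf scaleR_diff_right)
qed (auto intro!: divide_nonneg_nonneg sum_nonneg)

lemma trunc_drift_bound:
  assumes "0 < \<epsilon>"
  shows "norm (trunc_drift \<epsilon> J \<alpha> x) \<le> (\<Sum>j\<in>J. coth \<epsilon> * norm (\<alpha> j))"
proof -
  have "norm (\<Sum>j\<in>J. coth (max (\<alpha> j \<bullet> x) \<epsilon>) *\<^sub>R \<alpha> j) \<le> (\<Sum>j\<in>J. coth \<epsilon> * norm (\<alpha> j))"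
  proof (rule sum_norm_le)
    fix j
    have "0 < coth (max (\<alpha> j \<bullet> x) \<epsilon>)" "coth (max (\<alpha> j \<bullet> x) \<epsilon>) \<le> coth \<epsilon>"
      using assms by (auto intro!: coth_pos coth_antimono)
    then show "norm (coth (max (\<alpha> j \<bullet> x) \<epsilon>) *\<^sub>R \<alpha> j) \<le> coth \<epsilon> * norm (\<alpha> j)"
      by (simp add: mult_right_mono)
  qed
  then show ?thesis
    using norm_ge_zero[of "\<Sum>j\<in>J. coth (max (\<alpha> j \<bullet> x) \<epsilon>) *\<^sub>R \<alpha> j"]
    by (simp add: trunc_drift_def del: norm_ge_zero)
qed

lemma trunc_drift_continuous:
  assumes "0 < \<epsilon>"
  shows "continuous_on A (trunc_drift \<epsilon> J \<alpha>)"
  using lipschitz_on_continuous_on[OF trunc_drift_lipschitz[OF assms]] continuous_on_subset by blast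

lemma trunc_drift_continuous_chamber: "continuous_on (chamber J \<alpha>) (trunc_drift 0 J \<alpha>)"
  unfolding trunc_drift_def chamber_def coth_def
  by (intro continuous_intros) (auto simp: max_absorb1 dest!: bspec)

text \<open>A Lyapunov function that dominates minus the potential of the drift; the radial term absorbs
  the linear growth of the potential at infinity.\<close>

definition lyapunov :: "real \<Rightarrow> 'j set \<Rightarrow> ('j \<Rightarrow> 'a) \<Rightarrow> 'a::euclidean_space \<Rightarrow> real" where
  "lyapunov \<epsilon> J \<alpha> x = (\<Sum>j\<in>J. norm (\<alpha> j)) * sqrt (1 + x \<bullet> x) - (\<Sum>j\<in>J. trunc_log_sinh \<epsilon> (\<alpha> j \<bullet> x))"

text \<open>The square root is concave, so sqrt (r^2 + d) \<le> r + d / (2 r); r \<ge> 1 then bounds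
  the quadratic coefficient by a constant. The constant \<kappa> of the Lyapunov estimate comes from
  here alone.\<close>

lemma sqrt_one_plus_square_expansion:
  fixes x h :: "'a::real_inner"
  shows "sqrt (1 + (x + h) \<bullet> (x + h)) \<le> sqrt (1 + x \<bullet> x) + (x \<bullet> h) / sqrt (1 + x \<bullet> x) + (norm h)\<^sup>2 / 2"
proof -
  define r where "r = sqrt (1 + x \<bullet> x)"
  have r: "1 \<le> r" "r * r = 1 + x \<bullet> x" by (simp_all add: r_def)
  define d where "d = 2 * (x \<bullet> h) + h \<bullet> h"
  have e: "1 + (x + h) \<bullet> (x + h) = r * r + d" unfolding r d_def by (simp add: inner_simps inner_commute)
  have n: "0 \<le> r * r + d" unfolding e[symmetric] by (simp add: add_nonneg_nonneg)
  have "sqrt (1 + (x + h) \<bullet> (x + h)) \<le> r + d / (2 * r)"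
    unfolding e
  proof (rule real_le_lsqrt)
    have "r + d / (2 * r) = (r * r + (r * r + d)) / (2 * r)" using r by (simp add: field_simps)
    moreover have "0 \<le> (r * r + (r * r + d)) / (2 * r)"
      by (rule divide_nonneg_nonneg[OF add_nonneg_nonneg[OF _ n]]) (use r(1) in auto)
    ultimately show "0 \<le> r + d / (2 * r)" by (simp only:)
    have "(r + d / (2 * r))\<^sup>2 = r * r + 2 * r * (d / (2 * r)) + (d / (2 * r))\<^sup>2"
      by (simp only: power2_sum) (simp add: power2_eq_square)
    also have "2 * r * (d / (2 * r)) = d" using r(1) by simp
    finally have "(r + d / (2 * r))\<^sup>2 = r * r + d + (d / (2 * r))\<^sup>2" .
    then show "r * r + d \<le> (r + d / (2 * r))\<^sup>2" by simp
  qed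
  also have "d / (2 * r) = (x \<bullet> h) / r + (norm h)\<^sup>2 / (2 * r)"
    using r by (simp add: d_def field_simps power2_norm_eq_inner)
  also have "(norm h)\<^sup>2 / (2 * r) \<le> (norm h)\<^sup>2 / 2"
    using r by (intro divide_left_mono) auto
  finally show ?thesis by (simp add: r_def)
qed

lemma abs_inner_le_sqrt: "\<bar>v \<bullet> x\<bar> \<le> norm v * sqrt (1 + x \<bullet> x)"
proof -
  have "\<bar>v \<bullet> x\<bar> \<le> norm v * norm x" by (rule Cauchy_Schwarz_ineq2)
  also have "norm x \<le> sqrt (1 + x \<bullet> x)" by (simp add: norm_eq_sqrt_inner)
  finally show ?thesis by (simp add: mult_left_mono)
qed

lemma sum_abs_inner_le: "(\<Sum>j\<in>J. \<bar>\<alpha> j \<bullet> x\<bar>) \<le> (\<Sum>j\<in>J. norm (\<alpha> j)) * sqrt (1 + x \<bullet> x)"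
  by (simp add: sum_distrib_right sum_mono abs_inner_le_sqrt)

text \<open>The weight of the radial term is chosen for this purpose: it dominates the sum of
  \<bar>\<alpha> j \<bullet> x\<bar>, which in turn dominates the truncated logarithms.\<close>

lemma lyapunov_nonneg:
  assumes "0 < \<epsilon>" "\<epsilon> \<le> 1 / 2"
  shows "0 \<le> lyapunov \<epsilon> J \<alpha> x"
  using sum_abs_inner_le[of \<alpha> x J] sum_mono[of J "\<lambda>j. trunc_log_sinh \<epsilon> (\<alpha> j \<bullet> x)" "\<lambda>j. \<bar>\<alpha> j \<bullet> x\<bar>"]
    trunc_log_sinh_le[OF assms]
  unfolding lyapunov_def by (smt (verit))

text \<open>Only the logarithm of one form at or below \<epsilon> is kept; the radial term pays for
  all the others, so the full barrier remains.\<close>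

lemma lyapunov_outside:
  assumes "0 < \<epsilon>" "\<epsilon> \<le> 1 / 2" "finite J" "j \<in> J" "\<alpha> j \<bullet> x \<le> \<epsilon>"
  shows "- ln (sinh \<epsilon>) \<le> lyapunov \<epsilon> J \<alpha> x"
proof -
  have "(\<Sum>i\<in>J. trunc_log_sinh \<epsilon> (\<alpha> i \<bullet> x)) = trunc_log_sinh \<epsilon> (\<alpha> j \<bullet> x) + (\<Sum>i\<in>J - {j}. trunc_log_sinh \<epsilon> (\<alpha> i \<bullet> x))"
    using assms by (intro sum.remove)
  also have "\<dots> \<le> ln (sinh \<epsilon>) + (\<Sum>i\<in>J - {j}. \<bar>\<alpha> i \<bullet> x\<bar>)"
    using assms by (intro add_mono sum_mono trunc_log_sinh_le) (auto simp: trunc_log_sinh_def max_absorb2)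
  also have "(\<Sum>i\<in>J - {j}. \<bar>\<alpha> i \<bullet> x\<bar>) \<le> (\<Sum>i\<in>J. \<bar>\<alpha> i \<bullet> x\<bar>)"
    using assms by (intro sum_mono2) auto
  also have "\<dots> \<le> (\<Sum>j\<in>J. norm (\<alpha> j)) * sqrt (1 + x \<bullet> x)" by (rule sum_abs_inner_le)
  finally show ?thesis unfolding lyapunov_def by linarith
qed

lemma lyapunov_expansion:
  assumes "0 < \<epsilon>" and U: "\<And>j. j \<in> J \<Longrightarrow> \<epsilon> < \<alpha> j \<bullet> x"
  shows "lyapunov \<epsilon> J \<alpha> (x + h) \<le> lyapunov \<epsilon> J \<alpha> x
    + (((\<Sum>j\<in>J. norm (\<alpha> j)) / sqrt (1 + x \<bullet> x)) *\<^sub>R x - (\<Sum>j\<in>J. coth (\<alpha> j \<bullet> x) *\<^sub>R \<alpha> j)) \<bullet> h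
    + (\<Sum>j\<in>J. 1 / (2 * (sinh (\<alpha> j \<bullet> x))\<^sup>2) * (\<alpha> j \<bullet> h)\<^sup>2) + (\<Sum>j\<in>J. norm (\<alpha> j)) / 2 * (norm h)\<^sup>2
    + coth \<epsilon> / (3 * (sinh \<epsilon>)\<^sup>2) * (\<Sum>j\<in>J. norm (\<alpha> j) ^ 3) * norm h ^ 3"
proof -
  have "(\<Sum>j\<in>J. trunc_log_sinh \<epsilon> (\<alpha> j \<bullet> x) + coth (\<alpha> j \<bullet> x) * (\<alpha> j \<bullet> h)
      - 1 / (2 * (sinh (\<alpha> j \<bullet> x))\<^sup>2) * (\<alpha> j \<bullet> h)\<^sup>2 - coth \<epsilon> / (3 * (sinh \<epsilon>)\<^sup>2) * (norm (\<alpha> j) ^ 3 * norm h ^ 3))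
     \<le> (\<Sum>j\<in>J. trunc_log_sinh \<epsilon> (\<alpha> j \<bullet> (x + h)))"
  proof (rule sum_mono)
    fix j assume j: "j \<in> J"
    have "\<bar>\<alpha> j \<bullet> h\<bar> ^ 3 \<le> norm (\<alpha> j) ^ 3 * norm h ^ 3"
      using Cauchy_Schwarz_ineq2[of "\<alpha> j" h] by (metis abs_ge_zero power_mono power_mult_distrib)
    then have "coth \<epsilon> / (3 * (sinh \<epsilon>)\<^sup>2) * \<bar>\<alpha> j \<bullet> h\<bar> ^ 3 \<le> coth \<epsilon> / (3 * (sinh \<epsilon>)\<^sup>2) * (norm (\<alpha> j) ^ 3 * norm h ^ 3)"
      using coth_pos[OF assms(1)] by (intro mult_left_mono) auto
    then show "trunc_log_sinh \<epsilon> (\<alpha> j \<bullet> x) + coth (\<alpha> j \<bullet> x) * (\<alpha> j \<bullet> h)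
      - 1 / (2 * (sinh (\<alpha> j \<bullet> x))\<^sup>2) * (\<alpha> j \<bullet> h)\<^sup>2 - coth \<epsilon> / (3 * (sinh \<epsilon>)\<^sup>2) * (norm (\<alpha> j) ^ 3 * norm h ^ 3)
      \<le> trunc_log_sinh \<epsilon> (\<alpha> j \<bullet> (x + h))"
      using trunc_log_sinh_expansion[OF assms(1) U[OF j], of "\<alpha> j \<bullet> h"] unfolding inner_add_right by linarith
  qed
  moreover have "(\<Sum>j\<in>J. norm (\<alpha> j)) * sqrt (1 + (x + h) \<bullet> (x + h))
     \<le> (\<Sum>j\<in>J. norm (\<alpha> j)) * (sqrt (1 + x \<bullet> x) + (x \<bullet> h) / sqrt (1 + x \<bullet> x) + (norm h)\<^sup>2 / 2)"
    by (intro mult_left_mono sqrt_one_plus_square_expansion sum_nonneg) auto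
  moreover have "(((\<Sum>j\<in>J. norm (\<alpha> j)) / sqrt (1 + x \<bullet> x)) *\<^sub>R x - (\<Sum>j\<in>J. coth (\<alpha> j \<bullet> x) *\<^sub>R \<alpha> j)) \<bullet> h
     = (\<Sum>j\<in>J. norm (\<alpha> j)) * ((x \<bullet> h) / sqrt (1 + x \<bullet> x)) - (\<Sum>j\<in>J. coth (\<alpha> j \<bullet> x) * (\<alpha> j \<bullet> h))"
    by (simp add: inner_diff_left inner_sum_left)
  moreover have "(\<Sum>j\<in>J. coth \<epsilon> / (3 * (sinh \<epsilon>)\<^sup>2) * (norm (\<alpha> j) ^ 3 * norm h ^ 3))
     = coth \<epsilon> / (3 * (sinh \<epsilon>)\<^sup>2) * (\<Sum>j\<in>J. norm (\<alpha> j) ^ 3) * norm h ^ 3"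
    by (simp add: sum_distrib_left sum_distrib_right sum_divide_distrib mult_ac)
  moreover have "(\<Sum>j\<in>J. norm (\<alpha> j)) * ((norm h)\<^sup>2 / 2) = (\<Sum>j\<in>J. norm (\<alpha> j)) / 2 * (norm h)\<^sup>2"
    by simp
  ultimately show ?thesis
    unfolding lyapunov_def sum.distrib sum_subtractf distrib_left by linarith
qed

section \<open>Solutions driven by a Wiener process\<close>

text \<open>With \<Phi> = \<Sum> ln (sinh (\<alpha> j \<bullet> x)) this says that minus the
  Laplacian of \<Phi> is at most |grad \<Phi>|^2, that is, exp \<Phi>, the product of the sinh, is
  subharmonic on the chamber.\<close>

definition energy_inequality :: "'j set \<Rightarrow> ('j \<Rightarrow> 'a::euclidean_space) \<Rightarrow> bool" where
  "energy_inequality J \<alpha> \<longleftrightarrow> (\<forall>x\<in>chamber J \<alpha>.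
     (\<Sum>j\<in>J. (\<alpha> j \<bullet> \<alpha> j) / (sinh (\<alpha> j \<bullet> x))\<^sup>2) \<le> (norm (\<Sum>j\<in>J. coth (\<alpha> j \<bullet> x) *\<^sub>R \<alpha> j))\<^sup>2)"

lemma open_chamber:
  assumes "finite J"
  shows "open (chamber J \<alpha>)"
proof -
  have "chamber J \<alpha> = (\<Inter>j\<in>J. {x. 0 < \<alpha> j \<bullet> x})" by (auto simp: chamber_def)
  then show ?thesis using assms by (auto intro!: open_INT open_halfspace_gt open_Collect_less continuous_intros)
qed

text \<open>Inside the region the drift is half of the gradient \<open>s\<close>. The potential
  contributes -(s \<bullet> s) / 2 plus a^2 / 2 times the left-hand side of the energy inequality,
  which is nonpositive in total for a^2 \<le> 1. The radial part is at most a constant by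
  \<open>mult_coth_le\<close>, and this constant is free of \<epsilon>.\<close>

lemma lyapunov_generator:
  fixes \<alpha> :: "'j \<Rightarrow> 'a::euclidean_space"
  assumes \<epsilon>: "0 < \<epsilon>" and U: "\<And>j. j \<in> J \<Longrightarrow> \<epsilon> < \<alpha> j \<bullet> x"
    and a: "a\<^sup>2 \<le> 1" and en: "energy_inequality J \<alpha>"
  shows "(((\<Sum>j\<in>J. norm (\<alpha> j)) / sqrt (1 + x \<bullet> x)) *\<^sub>R x - (\<Sum>j\<in>J. coth (\<alpha> j \<bullet> x) *\<^sub>R \<alpha> j)) \<bullet> trunc_drift \<epsilon> J \<alpha> x
    + a\<^sup>2 * (\<Sum>j\<in>J. 1 / (2 * (sinh (\<alpha> j \<bullet> x))\<^sup>2) * (\<alpha> j \<bullet> \<alpha> j))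
    \<le> (\<Sum>j\<in>J. norm (\<alpha> j)) * (\<Sum>j\<in>J. 1 + norm (\<alpha> j)) / 2"
proof -
  define N where "N = (\<Sum>j\<in>J. norm (\<alpha> j))"
  define r where "r = sqrt (1 + x \<bullet> x)"
  define s where "s = (\<Sum>j\<in>J. coth (\<alpha> j \<bullet> x) *\<^sub>R \<alpha> j)"
  have "x \<in> chamber J \<alpha>"
    using order.strict_trans[OF \<epsilon> U] by (auto simp: chamber_def)
  have N: "0 \<le> N" unfolding N_def by (simp add: sum_nonneg)
  have r: "1 \<le> r" by (simp add: r_def)
  have b: "trunc_drift \<epsilon> J \<alpha> x = (1 / 2) *\<^sub>R s"
    unfolding trunc_drift_def s_def
    by (intro arg_cong[where f = "scaleR _"] sum.cong refl) (use U in \<open>auto simp: max_absorb1 less_imp_le\<close>)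
  have "x \<bullet> s = (\<Sum>j\<in>J. (\<alpha> j \<bullet> x) * coth (\<alpha> j \<bullet> x))"
    by (simp add: s_def inner_sum_right inner_commute mult.commute)
  also have "\<dots> \<le> (\<Sum>j\<in>J. (1 + norm (\<alpha> j)) * r)"
  proof (rule sum_mono)
    fix j assume j: "j \<in> J"
    have "(\<alpha> j \<bullet> x) * coth (\<alpha> j \<bullet> x) \<le> 1 + \<alpha> j \<bullet> x"
      using U[OF j] \<epsilon> by (intro mult_coth_le) auto
    also have "\<dots> \<le> 1 * r + norm (\<alpha> j) * r"
      using abs_inner_le_sqrt[of "\<alpha> j" x] r unfolding r_def by linarith
    finally show "(\<alpha> j \<bullet> x) * coth (\<alpha> j \<bullet> x) \<le> (1 + norm (\<alpha> j)) * r" by (simp add: algebra_simps)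
  qed
  also have "\<dots> = (\<Sum>j\<in>J. 1 + norm (\<alpha> j)) * r" by (simp add: sum_distrib_right)
  finally have "N / (2 * r) * (x \<bullet> s) \<le> N / (2 * r) * ((\<Sum>j\<in>J. 1 + norm (\<alpha> j)) * r)"
    using N r by (intro mult_left_mono) auto
  also have "\<dots> = N * (\<Sum>j\<in>J. 1 + norm (\<alpha> j)) / 2" using r by simp
  finally have 1: "N / (2 * r) * (x \<bullet> s) \<le> N * (\<Sum>j\<in>J. 1 + norm (\<alpha> j)) / 2" .
  have "a\<^sup>2 * (\<Sum>j\<in>J. 1 / (2 * (sinh (\<alpha> j \<bullet> x))\<^sup>2) * (\<alpha> j \<bullet> \<alpha> j)) \<le> 1 * (\<Sum>j\<in>J. 1 / (2 * (sinh (\<alpha> j \<bullet> x))\<^sup>2) * (\<alpha> j \<bullet> \<alpha> j))"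
    using a by (intro mult_right_mono sum_nonneg) auto
  also have "\<dots> = 1 / 2 * (\<Sum>j\<in>J. (\<alpha> j \<bullet> \<alpha> j) / (sinh (\<alpha> j \<bullet> x))\<^sup>2)"
    by (simp add: sum_distrib_left)
  also have "\<dots> \<le> 1 / 2 * (norm s)\<^sup>2"
    using en \<open>x \<in> chamber J \<alpha>\<close> unfolding s_def energy_inequality_def
    by (intro mult_left_mono) auto
  also have "\<dots> = s \<bullet> s / 2" by (simp add: power2_norm_eq_inner)
  finally have 2: "a\<^sup>2 * (\<Sum>j\<in>J. 1 / (2 * (sinh (\<alpha> j \<bullet> x))\<^sup>2) * (\<alpha> j \<bullet> \<alpha> j)) \<le> s \<bullet> s / 2" .
  have 3: "((N / r) *\<^sub>R x - s) \<bullet> trunc_drift \<epsilon> J \<alpha> x = N / (2 * r) * (x \<bullet> s) - s \<bullet> s / 2"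
    by (simp add: b inner_diff_left inner_scaleR_right)
  show ?thesis
    using 1 2 3 unfolding N_def[symmetric] r_def[symmetric] s_def[symmetric] by linarith
qed

text \<open>The constants \<kappa> and \<open>C\<close>, which survive in the exit bound, are
  independent of \<epsilon>, and the barrier tends to infinity as \<epsilon> \<rightarrow> 0. The
  bounds \<open>B\<close>, \<open>B1\<close>, \<open>B2\<close> and \<open>K\<close> blow up in that
  limit.\<close>

lemma (in wiener_process) trunc_euler_lyapunov:
  fixes \<alpha> :: "'j \<Rightarrow> real ^ 'n"
  assumes J: "finite J" and a: "0 \<le> a" "a \<le> 1" and \<epsilon>: "0 < \<epsilon>" "\<epsilon> \<le> 1 / 2"
    and en: "energy_inequality J \<alpha>"
  shows "euler_lyapunov M F W (trunc_drift \<epsilon> J \<alpha>) a {x. \<forall>j\<in>J. \<epsilon> < \<alpha> j \<bullet> x} (lyapunov \<epsilon> J \<alpha>)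
    (\<lambda>x. ((\<Sum>j\<in>J. norm (\<alpha> j)) / sqrt (1 + x \<bullet> x)) *\<^sub>R x - (\<Sum>j\<in>J. coth (\<alpha> j \<bullet> x) *\<^sub>R \<alpha> j))
    J (\<lambda>j x. 1 / (2 * (sinh (\<alpha> j \<bullet> x))\<^sup>2)) \<alpha>
    (\<Sum>j\<in>J. coth \<epsilon> * norm (\<alpha> j))
    ((\<Sum>j\<in>J. norm (\<alpha> j)) + (\<Sum>j\<in>J. coth \<epsilon> * norm (\<alpha> j)))
    (1 / (2 * (sinh \<epsilon>)\<^sup>2))
    ((\<Sum>j\<in>J. norm (\<alpha> j)) / 2)
    (coth \<epsilon> / (3 * (sinh \<epsilon>)\<^sup>2) * (\<Sum>j\<in>J. norm (\<alpha> j) ^ 3))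
    ((\<Sum>j\<in>J. norm (\<alpha> j)) * (\<Sum>j\<in>J. 1 + norm (\<alpha> j)) / 2)
    (- ln (sinh \<epsilon>))"
proof unfold_locales
  have [measurable]: "(sinh :: real \<Rightarrow> real) \<in> borel_measurable borel" "(cosh :: real \<Rightarrow> real) \<in> borel_measurable borel"
    by (intro borel_measurable_continuous_onI continuous_intros)+
  have [measurable]: "coth \<in> borel_measurable borel" unfolding coth_def[abs_def] by measurable
  have cp: "0 < coth \<epsilon>" using coth_pos \<epsilon> by simp
  show "trunc_drift \<epsilon> J \<alpha> \<in> borel_measurable borel"
    by (intro borel_measurable_continuous_onI trunc_drift_continuous \<epsilon>)
  show "norm (trunc_drift \<epsilon> J \<alpha> x) \<le> (\<Sum>j\<in>J. coth \<epsilon> * norm (\<alpha> j))" for x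
    by (rule trunc_drift_bound[OF \<epsilon>(1)])
  show "0 \<le> a" "a \<le> 1" by fact+
  show "{x. \<forall>j\<in>J. \<epsilon> < \<alpha> j \<bullet> x} \<in> sets borel"
  proof -
    have "{x. \<forall>j\<in>J. \<epsilon> < \<alpha> j \<bullet> x} = (\<Inter>j\<in>J. {x. \<epsilon> < \<alpha> j \<bullet> x})" by auto
    also have "open \<dots>" using J by (intro open_INT) (auto intro!: open_Collect_less continuous_intros)
    finally show ?thesis by simp
  qed
  show "0 \<le> lyapunov \<epsilon> J \<alpha> x" for x using \<epsilon> by (rule lyapunov_nonneg)
  show "- ln (sinh \<epsilon>) \<le> lyapunov \<epsilon> J \<alpha> x" if "x \<notin> {x. \<forall>j\<in>J. \<epsilon> < \<alpha> j \<bullet> x}" for x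
    using that lyapunov_outside[OF \<epsilon> J] by (auto simp: not_less)
  show "(\<lambda>x. ((\<Sum>j\<in>J. norm (\<alpha> j)) / sqrt (1 + x \<bullet> x)) *\<^sub>R x - (\<Sum>j\<in>J. coth (\<alpha> j \<bullet> x) *\<^sub>R \<alpha> j)) \<in> borel_measurable borel"
    by measurable
  show "(\<lambda>x. 1 / (2 * (sinh (\<alpha> j \<bullet> x))\<^sup>2)) \<in> borel_measurable borel" for j
    by measurable
  show "finite J" by fact
  show "\<bar>1 / (2 * (sinh (\<alpha> j \<bullet> x))\<^sup>2)\<bar> \<le> 1 / (2 * (sinh \<epsilon>)\<^sup>2)"
    if "x \<in> {x. \<forall>j\<in>J. \<epsilon> < \<alpha> j \<bullet> x}" "j \<in> J" for x j
  proof -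
    have "sinh \<epsilon> \<le> sinh (\<alpha> j \<bullet> x)" using that by (auto intro: less_imp_le)
    then have "(sinh \<epsilon>)\<^sup>2 \<le> (sinh (\<alpha> j \<bullet> x))\<^sup>2" using \<epsilon> by (intro power_mono) auto
    then show ?thesis using \<epsilon> by (auto intro!: frac_le)
  qed
  show "norm (((\<Sum>j\<in>J. norm (\<alpha> j)) / sqrt (1 + x \<bullet> x)) *\<^sub>R x - (\<Sum>j\<in>J. coth (\<alpha> j \<bullet> x) *\<^sub>R \<alpha> j))
      \<le> (\<Sum>j\<in>J. norm (\<alpha> j)) + (\<Sum>j\<in>J. coth \<epsilon> * norm (\<alpha> j))"
    if x: "x \<in> {x. \<forall>j\<in>J. \<epsilon> < \<alpha> j \<bullet> x}" for x
  proof (rule order_trans[OF norm_triangle_ineq4 add_mono])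
    have "norm x \<le> sqrt (1 + x \<bullet> x)" by (simp add: norm_eq_sqrt_inner)
    then have "norm x / sqrt (1 + x \<bullet> x) \<le> 1" by (simp add: divide_le_eq add_pos_nonneg)
    then have "(\<Sum>j\<in>J. norm (\<alpha> j)) * (norm x / sqrt (1 + x \<bullet> x)) \<le> (\<Sum>j\<in>J. norm (\<alpha> j)) * 1"
      by (intro mult_left_mono sum_nonneg) auto
    then show "norm (((\<Sum>j\<in>J. norm (\<alpha> j)) / sqrt (1 + x \<bullet> x)) *\<^sub>R x) \<le> (\<Sum>j\<in>J. norm (\<alpha> j))"
      by (simp add: sum_nonneg)
    show "norm (\<Sum>j\<in>J. coth (\<alpha> j \<bullet> x) *\<^sub>R \<alpha> j) \<le> (\<Sum>j\<in>J. coth \<epsilon> * norm (\<alpha> j))"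
    proof (rule sum_norm_le)
      fix j assume "j \<in> J"
      then have "\<epsilon> < \<alpha> j \<bullet> x" using x by auto
      then have "0 < coth (\<alpha> j \<bullet> x)" "coth (\<alpha> j \<bullet> x) \<le> coth \<epsilon>"
        using \<epsilon> coth_pos[of "\<alpha> j \<bullet> x"] coth_antimono[of \<epsilon> "\<alpha> j \<bullet> x"] by auto
      then show "norm (coth (\<alpha> j \<bullet> x) *\<^sub>R \<alpha> j) \<le> coth \<epsilon> * norm (\<alpha> j)" by (simp add: mult_right_mono)
    qed
  qed
  show "0 \<le> (\<Sum>j\<in>J. norm (\<alpha> j)) + (\<Sum>j\<in>J. coth \<epsilon> * norm (\<alpha> j))"
    "0 \<le> 1 / (2 * (sinh \<epsilon>)\<^sup>2)" "0 \<le> (\<Sum>j\<in>J. norm (\<alpha> j)) / 2"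
    "0 \<le> coth \<epsilon> / (3 * (sinh \<epsilon>)\<^sup>2) * (\<Sum>j\<in>J. norm (\<alpha> j) ^ 3)"
    "0 \<le> (\<Sum>j\<in>J. norm (\<alpha> j)) * (\<Sum>j\<in>J. 1 + norm (\<alpha> j)) / 2"
    using cp by (auto intro!: add_nonneg_nonneg mult_nonneg_nonneg sum_nonneg divide_nonneg_nonneg)
  show "lyapunov \<epsilon> J \<alpha> (x + h) \<le> lyapunov \<epsilon> J \<alpha> x
    + (((\<Sum>j\<in>J. norm (\<alpha> j)) / sqrt (1 + x \<bullet> x)) *\<^sub>R x - (\<Sum>j\<in>J. coth (\<alpha> j \<bullet> x) *\<^sub>R \<alpha> j)) \<bullet> h
    + (\<Sum>j\<in>J. 1 / (2 * (sinh (\<alpha> j \<bullet> x))\<^sup>2) * (\<alpha> j \<bullet> h)\<^sup>2) + (\<Sum>j\<in>J. norm (\<alpha> j)) / 2 * (norm h)\<^sup>2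
    + coth \<epsilon> / (3 * (sinh \<epsilon>)\<^sup>2) * (\<Sum>j\<in>J. norm (\<alpha> j) ^ 3) * norm h ^ 3"
    if "x \<in> {x. \<forall>j\<in>J. \<epsilon> < \<alpha> j \<bullet> x}" for x h
    using that \<epsilon> by (intro lyapunov_expansion) auto
  show "(((\<Sum>j\<in>J. norm (\<alpha> j)) / sqrt (1 + x \<bullet> x)) *\<^sub>R x - (\<Sum>j\<in>J. coth (\<alpha> j \<bullet> x) *\<^sub>R \<alpha> j)) \<bullet> trunc_drift \<epsilon> J \<alpha> x
    + a\<^sup>2 * (\<Sum>j\<in>J. 1 / (2 * (sinh (\<alpha> j \<bullet> x))\<^sup>2) * (\<alpha> j \<bullet> \<alpha> j))
    \<le> (\<Sum>j\<in>J. norm (\<alpha> j)) * (\<Sum>j\<in>J. 1 + norm (\<alpha> j)) / 2"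
    if "x \<in> {x. \<forall>j\<in>J. \<epsilon> < \<alpha> j \<bullet> x}" for x
    using that \<epsilon> a en by (intro lyapunov_generator) (auto simp: power_le_one)
qed

text \<open>If a truncated path drops strictly below \<epsilon> m, all sufficiently fine Euler paths
  reach the level \<epsilon> m, so the outcome lies in \<open>H m\<close>. The probability of
  \<open>H m\<close> is eventually at most a constant over -ln (sinh (\<epsilon> m)) and tends to 0;
  hence almost every outcome avoids some \<open>H m\<close>.\<close>

lemma (in wiener_process) no_exit:
  fixes \<alpha> :: "'j \<Rightarrow> real ^ 'n" and \<epsilon> :: "nat \<Rightarrow> real"
  assumes J: "finite J" and a: "0 \<le> a" "a \<le> 1" and en: "energy_inequality J \<alpha>"
    and \<epsilon>: "\<And>m. 0 < \<epsilon> m" "\<And>m. \<epsilon> m \<le> 1 / 2" "\<epsilon> \<longlonglongrightarrow> 0"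
    and x: "x \<in> chamber J \<alpha>" and T: "0 < T"
    and y: "AE \<omega> in M. W 0 \<omega> = 0 \<and> (\<forall>m. continuous_on {0..} (y m \<omega>) \<and>
      (\<forall>t\<ge>0. y m \<omega> t = x + a *\<^sub>R W t \<omega> + integral {0..t} (\<lambda>s. trunc_drift (\<epsilon> m) J \<alpha> (y m \<omega> s))))"
  shows "AE \<omega> in M. \<exists>m. \<forall>t\<in>{0..T}. \<forall>j\<in>J. \<epsilon> m \<le> \<alpha> j \<bullet> y m \<omega> t"
proof -
  define U where "U m = {x. \<forall>j\<in>J. \<epsilon> m < \<alpha> j \<bullet> x}" for m
  define E where "E m N = {\<omega> \<in> space M. \<exists>i\<le>N.
      euler (trunc_drift (\<epsilon> m) J \<alpha>) x (\<lambda>t. x + a *\<^sub>R W t \<omega>) (T / real N) i \<notin> U m}" for m N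
  define H where "H m = (\<Union>k. \<Inter>N\<in>{Suc k..}. E m N)" for m
  define c where "c = T * ((\<Sum>j\<in>J. norm (\<alpha> j)) * (\<Sum>j\<in>J. 1 + norm (\<alpha> j)) / 2
     + 2 * ((\<Sum>j\<in>J. norm (\<alpha> j)) / 2) * real CARD('n))"
  have \<Lambda>: "0 < - ln (sinh (\<epsilon> m))" for m
    using \<epsilon>(1)[of m] sinh_less_1[OF \<epsilon>(2), of m] by simp
  have H: "H m \<in> events" "- ln (sinh (\<epsilon> m)) * prob (H m) \<le> lyapunov (\<epsilon> m) J \<alpha> x + c" for m
  proof -
    interpret L: euler_lyapunov M F W "trunc_drift (\<epsilon> m) J \<alpha>" a "U m" "lyapunov (\<epsilon> m) J \<alpha>"
      "\<lambda>x. ((\<Sum>j\<in>J. norm (\<alpha> j)) / sqrt (1 + x \<bullet> x)) *\<^sub>R x - (\<Sum>j\<in>J. coth (\<alpha> j \<bullet> x) *\<^sub>R \<alpha> j)"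
      J "\<lambda>j x. 1 / (2 * (sinh (\<alpha> j \<bullet> x))\<^sup>2)" \<alpha>
      "\<Sum>j\<in>J. coth (\<epsilon> m) * norm (\<alpha> j)"
      "(\<Sum>j\<in>J. norm (\<alpha> j)) + (\<Sum>j\<in>J. coth (\<epsilon> m) * norm (\<alpha> j))"
      "1 / (2 * (sinh (\<epsilon> m))\<^sup>2)"
      "(\<Sum>j\<in>J. norm (\<alpha> j)) / 2"
      "coth (\<epsilon> m) / (3 * (sinh (\<epsilon> m))\<^sup>2) * (\<Sum>j\<in>J. norm (\<alpha> j) ^ 3)"
      "(\<Sum>j\<in>J. norm (\<alpha> j)) * (\<Sum>j\<in>J. 1 + norm (\<alpha> j)) / 2"
      "- ln (sinh (\<epsilon> m))"
      unfolding U_def using J a \<epsilon>(1,2) en by (rule trunc_euler_lyapunov)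
    show "H m \<in> events" "- ln (sinh (\<epsilon> m)) * prob (H m) \<le> lyapunov (\<epsilon> m) J \<alpha> x + c"
      unfolding H_def E_def c_def
      by (rule L.eventual_exit_bound[OF T \<Lambda>, of x, unfolded L.X_def])+
  qed
  \<comment> \<open>Value of the Lyapunov function at the start once \<epsilon> m lies below all
    \<alpha> j \<bullet> x; from then on it no longer depends on \<open>m\<close>.\<close>
  define l where "l = (\<Sum>j\<in>J. norm (\<alpha> j)) * sqrt (1 + x \<bullet> x) - (\<Sum>j\<in>J. ln (sinh (\<alpha> j \<bullet> x)))"
  have "\<forall>\<^sub>F m in sequentially. \<forall>j\<in>J. \<epsilon> m < \<alpha> j \<bullet> x"
    using J x \<epsilon>(3) by (intro eventually_ball_finite ballI order_tendstoD) (auto simp: chamber_def)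
  then have "\<forall>\<^sub>F m in sequentially. prob (H m) \<le> (l + c) / - ln (sinh (\<epsilon> m))"
  proof eventually_elim
    case (elim m)
    then have "lyapunov (\<epsilon> m) J \<alpha> x = l"
      by (auto simp: lyapunov_def l_def trunc_log_sinh_def max_absorb1 less_imp_le intro!: sum.cong)
    then show ?case using H(2)[of m] \<Lambda>[of m] by (simp only: pos_le_divide_eq mult.commute)
  qed
  moreover have "(\<lambda>m. (l + c) / - ln (sinh (\<epsilon> m))) \<longlonglongrightarrow> 0"
  proof (rule real_tendsto_divide_at_top[OF tendsto_const])
    have "(\<lambda>m. sinh (\<epsilon> m)) \<longlonglongrightarrow> sinh 0" by (intro tendsto_intros \<epsilon>)
    then have "filterlim (\<lambda>m. sinh (\<epsilon> m)) (at_right 0) sequentially"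
      using \<epsilon>(1) less_imp_neq[OF \<epsilon>(1), symmetric]
      by (auto simp: filterlim_at intro!: always_eventually)
    then show "LIM m sequentially. - ln (sinh (\<epsilon> m)) :> at_top"
      using filterlim_compose[OF ln_at_0] by (simp add: filterlim_uminus_at_top)
  qed
  ultimately have lim: "(\<lambda>m. prob (H m)) \<longlonglongrightarrow> 0"
    by (intro tendsto_sandwich[of "\<lambda>_. 0" "\<lambda>m. prob (H m)"]) auto
  have Hm: "(\<Inter>m. H m) \<in> events" using H by auto
  have "prob (\<Inter>m. H m) \<le> 0"
    by (rule tendsto_lowerbound[OF lim]) (use H in \<open>auto intro!: always_eventually finite_measure_mono\<close>)
  then have "prob (\<Inter>m. H m) = 0" by (simp add: antisym)
  then have "AE \<omega> in M. \<omega> \<notin> (\<Inter>m. H m)"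
    using Hm by (intro AE_not_in) (simp add: null_sets_def emeasure_eq_measure)
  then show ?thesis
    using y AE_space
  proof eventually_elim
    case (elim \<omega>)
    then obtain m where m: "\<omega> \<notin> H m" by auto
    have W0: "x + a *\<^sub>R W 0 \<omega> = x" using elim by simp
    have "\<epsilon> m \<le> \<alpha> j \<bullet> y m \<omega> t" if t: "t \<in> {0..T}" and j: "j \<in> J" for t j
    proof (rule ccontr)
      assume neg: "\<not> \<epsilon> m \<le> \<alpha> j \<bullet> y m \<omega> t"
      \<comment> \<open>At distance \<open>d\<close> between the paths, the values of the form
        \<alpha> j differ by at most the gap below \<epsilon> m. Adding 1 avoids a vanishing
        denominator.\<close>
      define d where "d = (\<epsilon> m - \<alpha> j \<bullet> y m \<omega> t) / (norm (\<alpha> j) + 1)"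
      have n1: "0 < norm (\<alpha> j) + 1" by (simp add: add_nonneg_pos)
      have d: "0 < d" using neg n1 by (simp add: d_def)
      have "\<forall>\<^sub>F N in sequentially. \<forall>i\<le>N. \<forall>s\<in>{0..T}. \<bar>s - real i * (T / real N)\<bar> \<le> T / real N \<longrightarrow>
           norm (y m \<omega> s - euler (trunc_drift (\<epsilon> m) J \<alpha>) (x + a *\<^sub>R W 0 \<omega>) (\<lambda>t. x + a *\<^sub>R W t \<omega>) (T / real N) i) < d"
        using elim T by (intro euler_converges[OF trunc_drift_lipschitz[OF \<epsilon>(1)] _ _ _ d]) auto
      then obtain k where k: "\<And>N i s. k \<le> N \<Longrightarrow> i \<le> N \<Longrightarrow> s \<in> {0..T} \<Longrightarrow> \<bar>s - real i * (T / real N)\<bar> \<le> T / real N \<Longrightarrow>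
           norm (y m \<omega> s - euler (trunc_drift (\<epsilon> m) J \<alpha>) x (\<lambda>t. x + a *\<^sub>R W t \<omega>) (T / real N) i) < d"
        unfolding eventually_sequentially W0 by blast
      have "\<omega> \<in> E m N" if N: "Suc k \<le> N" for N
      proof -
        obtain i where i: "i \<le> N" "\<bar>t - real i * (T / real N)\<bar> \<le> T / real N"
          by (rule nearest_grid_point[of N t T]) (use N t in auto)
        define z where "z = euler (trunc_drift (\<epsilon> m) J \<alpha>) x (\<lambda>t. x + a *\<^sub>R W t \<omega>) (T / real N) i"
        have z: "norm (y m \<omega> t - z) < d" using k[of N i t] N i t by (simp add: z_def)
        have "\<alpha> j \<bullet> z - \<alpha> j \<bullet> y m \<omega> t \<le> norm (\<alpha> j) * norm (y m \<omega> t - z)"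
          using Cauchy_Schwarz_ineq2[of "\<alpha> j" "y m \<omega> t - z"] by (simp add: inner_diff_right)
        also have "\<dots> \<le> (norm (\<alpha> j) + 1) * d" using z d by (intro mult_mono) auto
        also have "\<dots> = \<epsilon> m - \<alpha> j \<bullet> y m \<omega> t" using n1 by (simp add: d_def)
        finally have "\<alpha> j \<bullet> z \<le> \<epsilon> m" by simp
        then have "z \<notin> U m" using j by (auto simp: U_def not_less)
        then show ?thesis using i elim by (auto simp: E_def z_def)
      qed
      then have "\<omega> \<in> H m" by (auto simp: H_def)
      with m show False by simp
    qed
    then show ?case by blast
  qed
qed

section \<open>Uniqueness in an open region and construction of the strong solution\<close>

lemma continuous_on_atLeastI:
  fixes f :: "real \<Rightarrow> 'a::topological_space"
  assumes "\<And>T. 0 \<le> T \<Longrightarrow> continuous_on {0..T} f"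
  shows "continuous_on {0..} f"
  unfolding continuous_on_eq_continuous_within
proof
  fix t :: real assume t: "t \<in> {0..}"
  have "continuous (at t within {0..t + 1}) f"
    using assms[of "t + 1"] t by (simp add: continuous_on_eq_continuous_within)
  moreover have "at t within {0..t + 1} = at t within {0..}"
    by (rule at_within_nhd[of t "{..<t + 1}"]) auto
  ultimately show "continuous (at t within {0..}) f" by simp
qed

text \<open>Only \<open>y\<close> is known to stay in the region. As \<open>C\<close> is open, there
  would be a first time at which \<open>z\<close> is outside; before it both paths agree by
  monotonicity, and by continuity they agree at that time too, where \<open>y\<close> is inside.
  This excludes competitors that leave the chamber.\<close>

lemma integral_equation_unique_open:
  fixes b :: "'a::euclidean_space \<Rightarrow> 'a" and y z :: "real \<Rightarrow> 'a"
  assumes C: "open C" and cb: "continuous_on C b"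
    and mono: "\<And>x y. x \<in> C \<Longrightarrow> y \<in> C \<Longrightarrow> (x - y) \<bullet> (b x - b y) \<le> 0"
    and y: "continuous_on {0..} y" "\<And>t. 0 \<le> t \<Longrightarrow> y t \<in> C"
      "\<And>t. 0 \<le> t \<Longrightarrow> y t = p t + integral {0..t} (\<lambda>s. b (y s))"
    and z: "continuous_on {0..} z" "\<And>t. 0 \<le> t \<Longrightarrow> z t = p t + integral {0..t} (\<lambda>s. b (z s))"
    and t: "0 \<le> t"
  shows "z t = y t"
proof -
  have eq: "z u = y u" if u: "u \<in> {0..s}" and zC: "\<And>u. u \<in> {0..s} \<Longrightarrow> z u \<in> C" for s u :: real
  proof (rule integral_equation_unique[where T = s and p = p])
    show "continuous_on {0..s} (\<lambda>u. b (z u))" "continuous_on {0..s} (\<lambda>u. b (y u))"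
      using zC y(2) by (auto intro!: continuous_on_compose2[OF cb] continuous_on_subset[OF y(1)] continuous_on_subset[OF z(1)])
    show "(z u - y u) \<bullet> (b (z u) - b (y u)) \<le> 0" if "u \<in> {0..s}" for u
      using that zC y(2) by (intro mono) auto
  qed (use y z u in auto)
  have zC: "z s \<in> C" if s: "0 \<le> s" for s
  proof (rule ccontr)
    assume neg: "z s \<notin> C"
    define S where "S = {0..s} \<inter> z -` (- C)"
    have "closed S" unfolding S_def
      using C by (intro continuous_closed_preimage continuous_on_subset[OF z(1)]) auto
    then have "compact ({0..s} \<inter> S)" by (intro compact_Int_closed) auto
    also have "{0..s} \<inter> S = S" by (auto simp: S_def)
    finally have "compact S" .
    moreover have "S \<noteq> {}" using neg s by (auto simp: S_def)
    ultimately have "\<exists>m\<in>S. \<forall>u\<in>S. m \<le> u" by (rule compact_attains_inf)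
    then obtain m where m: "m \<in> S" "\<And>u. u \<in> S \<Longrightarrow> m \<le> u" by blast
    have zy: "z u = y u" if "u \<in> {0..<m}" for u
    proof (rule eq[of u u])
      show "z v \<in> C" if v: "v \<in> {0..u}" for v
      proof (rule ccontr)
        assume "z v \<notin> C"
        moreover have "v \<in> {0..s}" using v \<open>u \<in> {0..<m}\<close> m(1) by (auto simp: S_def)
        ultimately have "m \<le> v" by (intro m(2)) (simp add: S_def)
        then show False using v \<open>u \<in> {0..<m}\<close> by simp
      qed
    qed (use that in simp)
    have "z m = y m"
    proof (cases "m = 0")
      case True
      then show ?thesis using y(3)[of 0] z(2)[of 0] by simp
    next
      case False
      then have m0: "0 < m" using m by (auto simp: S_def)
      have "z m - y m = 0"
        by (rule continuous_constant_on_closure[of "{0..<m}" "\<lambda>u. z u - y u"])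
           (use m0 zy in \<open>auto intro!: continuous_intros continuous_on_subset[OF y(1)] continuous_on_subset[OF z(1)]\<close>)
      then show ?thesis by simp
    qed
    then show False using y(2)[of m] m by (auto simp: S_def)
  qed
  show ?thesis by (rule eq[of t t]) (use zC t in auto)
qed

lemma augmented_natural_filtration:
  fixes M :: "'w measure" and W :: "real \<Rightarrow> 'w \<Rightarrow> 'b::topological_space"
  defines "G \<equiv> augmented_filtration M (natural_filtration M W)"
  assumes WM: "\<And>s. 0 \<le> s \<Longrightarrow> W s \<in> borel_measurable M"
  shows "space (G t) = space M" "null_sets M \<subseteq> sets (G t)"
    "0 \<le> s \<Longrightarrow> s \<le> t \<Longrightarrow> W s \<in> borel_measurable (G t)"
proof -
  let ?N = "\<Union>s\<in>{0..t}. {W s -` A \<inter> space M |A. A \<in> sets borel}"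
  have sub: "?N \<subseteq> Pow (space M)" by auto
  have N: "sets (natural_filtration M W t) = sigma_sets (space M) ?N"
    unfolding natural_filtration_def by (rule sets_measure_of[OF sub])
  have sub2: "sets (natural_filtration M W t) \<union> null_sets M \<subseteq> Pow (space M)"
    unfolding N using sigma_sets_into_sp[OF sub] sets.sets_into_space by (fastforce simp: null_sets_def)
  show sp: "space (G t) = space M"
    unfolding G_def augmented_filtration_def using sub2 by (rule space_measure_of)
  have G: "sets (G t) = sigma_sets (space M) (sets (natural_filtration M W t) \<union> null_sets M)"
    unfolding G_def augmented_filtration_def using sub2 by (rule sets_measure_of)
  show "null_sets M \<subseteq> sets (G t)" unfolding G by (auto intro: sigma_sets.Basic)
  show "W s \<in> borel_measurable (G t)" if s: "0 \<le> s" "s \<le> t"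
  proof (rule measurableI)
    fix A :: "'b set" assume "A \<in> sets borel"
    then have "W s -` A \<inter> space M \<in> ?N" using s by (intro UN_I[of s] CollectI exI[of _ A]) auto
    then show "W s -` A \<inter> space (G t) \<in> sets (G t)"
      unfolding sp G N by (intro sigma_sets.Basic UnI1)
  qed simp
qed

text \<open>For the hyperbolic system it then remains to find the linear forms, to identify the
  drift on their chamber and to prove the energy inequality.\<close>

theorem (in wiener_process) chamber_strong_solution:
  fixes \<alpha> :: "'j \<Rightarrow> real ^ 'n"
  assumes J: "finite J" and a: "0 \<le> a" "a \<le> 1" and en: "energy_inequality J \<alpha>"
    and x: "x \<in> chamber J \<alpha>" and D: "chamber J \<alpha> \<subseteq> D"
    and b: "\<And>z. z \<in> chamber J \<alpha> \<Longrightarrow> b z = trunc_drift 0 J \<alpha> z"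
  shows "\<exists>\<sigma>. strong_solution M W D b a x \<sigma> \<and>
    (\<forall>G \<tau>. sde_solution M G W D b a x \<tau> \<longrightarrow> (AE \<omega> in M. \<forall>t\<ge>0. \<tau> t \<omega> = \<sigma> t \<omega>)) \<and>
    (AE \<omega> in M. \<forall>t\<ge>0. \<sigma> t \<omega> \<in> chamber J \<alpha>)"
proof -
  define G where "G = augmented_filtration M (natural_filtration M W)"
  note G = augmented_natural_filtration[of W M, OF W_measurable_M, folded G_def]
  have "AE \<omega> in M. W 0 \<omega> = 0 \<and> continuous_on {0..} (\<lambda>t. W t \<omega>)"
    using start_zero continuous_paths by eventually_elim simp
  then obtain N where N: "N \<in> null_sets M"
    "{\<omega> \<in> space M. \<not> (W 0 \<omega> = 0 \<and> continuous_on {0..} (\<lambda>t. W t \<omega>))} \<subseteq> N"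
    unfolding eventually_ae_filter by blast
  \<comment> \<open>All paths are made continuous with start 0 by changing \<open>W\<close> on a
    null set. The augmented filtration contains that set, so adaptedness survives.\<close>
  define w where "w t \<omega> = (if \<omega> \<in> N then 0 else W t \<omega>)" for t \<omega>
  have w: "w 0 \<omega> = 0" "continuous_on {0..} (\<lambda>t. w t \<omega>)" if "\<omega> \<in> space M" for \<omega>
  proof -
    show "w 0 \<omega> = 0" using N that by (auto simp: w_def)
    show "continuous_on {0..} (\<lambda>t. w t \<omega>)" using N that by (cases "\<omega> \<in> N") (auto simp: w_def)
  qed
  have AEw: "AE \<omega> in M. \<omega> \<in> space M \<and> \<omega> \<notin> N"
    using AE_not_in[OF N(1)] AE_space by eventually_elim simp
  have wm: "w s \<in> borel_measurable (G t)" if "0 \<le> s" "s \<le> t" for s t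
  proof -
    have [measurable]: "N \<in> sets (G t)" using G(2)[of t] N(1) by blast
    have [measurable]: "W s \<in> borel_measurable (G t)" using G(3) that by blast
    show ?thesis unfolding w_def by measurable
  qed
  define \<epsilon> :: "nat \<Rightarrow> real" where "\<epsilon> m = 1 / (2 + real m)" for m
  have \<epsilon>: "0 < \<epsilon> m" "\<epsilon> m \<le> 1 / 2" for m by (simp_all add: \<epsilon>_def field_simps)
  have \<epsilon>0: "\<epsilon> \<longlonglongrightarrow> 0" unfolding \<epsilon>_def
    by (intro tendsto_divide_0[OF tendsto_const] filterlim_at_top_imp_at_infinity
        filterlim_tendsto_add_at_top[OF tendsto_const] filterlim_real_sequentially)
  have \<epsilon>_mono: "\<epsilon> m \<le> \<epsilon> k" if "k \<le> m" for k m
    using that by (auto simp: \<epsilon>_def intro!: divide_left_mono)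
  define B where "B m = trunc_drift (\<epsilon> m) J \<alpha>" for m
  define p where "p \<omega> t = x + a *\<^sub>R w t \<omega>" for \<omega> t
  have cp: "continuous_on {0..} (p \<omega>)" if "\<omega> \<in> space M" for \<omega>
    unfolding p_def using w[OF that] by (intro continuous_intros)
  \<comment> \<open>The choice is made path by path. Any chosen solution is the limit of its Euler
    scheme, which gives measurability below.\<close>
  define y where "y m \<omega> = (SOME y. continuous_on {0..} y \<and>
      (\<forall>t\<ge>0. y t = p \<omega> t + integral {0..t} (\<lambda>s. B m (y s))))" for m \<omega>
  have y': "continuous_on {0..} (y m \<omega>) \<and> (\<forall>t\<ge>0. y m \<omega> t = p \<omega> t + integral {0..t} (\<lambda>s. B m (y m \<omega> s)))"
    if "\<omega> \<in> space M" for m \<omega>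
    unfolding y_def B_def
    by (rule someI_ex[OF integral_equation_exists[OF trunc_drift_lipschitz[OF \<epsilon>(1)] trunc_drift_bound[OF \<epsilon>(1)] cp[OF that]]])
  have y: "continuous_on {0..} (y m \<omega>)"
    "0 \<le> t \<Longrightarrow> y m \<omega> t = p \<omega> t + integral {0..t} (\<lambda>s. B m (y m \<omega> s))"
    if "\<omega> \<in> space M" for m \<omega> t
    using y'[OF that] by blast+
  have ym: "(\<lambda>\<omega>. y m \<omega> t) \<in> borel_measurable (G t)" if t: "0 \<le> t" for m t
  proof (rule borel_measurable_LIMSEQ_metric)
    fix N
    have "(\<lambda>\<omega>. euler (B m) x (\<lambda>t. p \<omega> t) (t / real N) N) \<in> borel_measurable (G t)"
    proof (rule euler_measurable)
      show "B m \<in> borel_measurable borel"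
        unfolding B_def by (intro borel_measurable_continuous_onI trunc_drift_continuous \<epsilon>)
      show "(\<lambda>\<omega>. p \<omega> s) \<in> borel_measurable (G t)" if "0 \<le> s" "s \<le> real N * (t / real N)" for s
      proof -
        have "s \<le> t" using that t by (cases "N = 0") auto
        then have [measurable]: "w s \<in> borel_measurable (G t)" using wm that by blast
        show ?thesis unfolding p_def by measurable
      qed
    qed (use t in auto)
    then show "(\<lambda>\<omega>. euler (B m) x (p \<omega>) (t / real N) N) \<in> borel_measurable (G t)" by simp
  next
    fix \<omega> assume "\<omega> \<in> space (G t)"
    then have \<omega>: "\<omega> \<in> space M" using G(1) by simp
    have "(\<lambda>N. euler (B m) (p \<omega> 0) (p \<omega>) (t / real N) N) \<longlonglongrightarrow> y m \<omega> t"
      using y[OF \<omega>] t unfolding B_def by (intro euler_tendsto[OF trunc_drift_lipschitz[OF \<epsilon>(1)]]) auto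
    then show "(\<lambda>N. euler (B m) x (p \<omega>) (t / real N) N) \<longlonglongrightarrow> y m \<omega> t"
      using w(1)[OF \<omega>] by (simp add: p_def)
  qed
  \<comment> \<open>On good paths the sequence is eventually constant, as shown below; writing it as
    a limit gives measurability for all \<omega> at once.\<close>
  define \<sigma> where "\<sigma> t \<omega> = lim (\<lambda>m. y m \<omega> t)" for t \<omega>
  have \<sigma>m: "\<sigma> t \<in> borel_measurable (G t)" if "0 \<le> t" for t
    unfolding \<sigma>_def using ym[OF that] by (intro borel_measurable_lim_metric)
  have good: "AE \<omega> in M. W 0 \<omega> = 0 \<and> (\<forall>m. continuous_on {0..} (y m \<omega>) \<and>
      (\<forall>t\<ge>0. y m \<omega> t = x + a *\<^sub>R W t \<omega> + integral {0..t} (\<lambda>s. trunc_drift (\<epsilon> m) J \<alpha> (y m \<omega> s))))"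
    using AEw
  proof eventually_elim
    case (elim \<omega>)
    then show ?case using y[of \<omega>] w(1)[of \<omega>] by (auto simp: p_def w_def B_def)
  qed
  \<comment> \<open>Countably many horizons suffice; \<open>Suc k\<close> keeps them
    positive.\<close>
  have "AE \<omega> in M. \<forall>k. \<exists>m. \<forall>t\<in>{0..real (Suc k)}. \<forall>j\<in>J. \<epsilon> m \<le> \<alpha> j \<bullet> y m \<omega> t"
    unfolding AE_all_countable
    by (intro allI no_exit[OF J a en \<epsilon> \<epsilon>0 x _ good]) simp
  then have main: "AE \<omega> in M. continuous_on {0..} (\<lambda>t. \<sigma> t \<omega>) \<and> (\<forall>t\<ge>0. \<sigma> t \<omega> \<in> chamber J \<alpha>) \<and>
      (\<forall>t\<ge>0. \<sigma> t \<omega> = x + a *\<^sub>R W t \<omega> + integral {0..t} (\<lambda>s. b (\<sigma> s \<omega>)))"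
    using good AEw
  proof eventually_elim
    case (elim \<omega>)
    have inside: "\<exists>m. \<forall>t\<in>{0..T}. \<forall>j\<in>J. \<epsilon> m \<le> \<alpha> j \<bullet> y m \<omega> t" for T
    proof -
      obtain k where "T \<le> real k" using real_arch_simple by blast
      then show ?thesis using elim(1) by (meson atLeastAtMost_iff of_nat_le_iff order_trans le_SucI order_refl)
    qed
    have loc: "\<exists>m. (\<forall>t\<in>{0..T}. \<sigma> t \<omega> = y m \<omega> t \<and> (\<forall>j\<in>J. \<epsilon> m \<le> \<alpha> j \<bullet> y m \<omega> t))" for T
    proof -
      obtain k where k: "\<And>t j. t \<in> {0..T} \<Longrightarrow> j \<in> J \<Longrightarrow> \<epsilon> k \<le> \<alpha> j \<bullet> y k \<omega> t" using inside[of T] by blast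
      \<comment> \<open>On [0,T] the path \<open>y k\<close> stays above \<epsilon> k \<ge>
        \<epsilon> m, so neither truncation is active along it and it solves the m-th equation as
        well. Uniqueness for the monotone drift \<open>B m\<close> identifies the two paths.\<close>
      have agree: "y m \<omega> t = y k \<omega> t" if m: "k \<le> m" and t: "t \<in> {0..T}" for m t
      proof (rule integral_equation_unique[where T = T and p = "p \<omega>" and g = "\<lambda>s. B m (y k \<omega> s)"])
        have yc: "continuous_on {0..T} (y i \<omega>)" for i
          using elim by (auto intro: continuous_on_subset)
        show "continuous_on {0..T} (\<lambda>s. B m (y m \<omega> s))" "continuous_on {0..T} (\<lambda>s. B m (y k \<omega> s))"
          unfolding B_def
          by (auto intro!: continuous_on_compose2[OF trunc_drift_continuous[OF \<epsilon>(1)]] yc)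
        show "y m \<omega> t = p \<omega> t + integral {0..t} (\<lambda>s. B m (y m \<omega> s))" if "t \<in> {0..T}" for t
          using y(2) elim that by simp
        show "y k \<omega> t = p \<omega> t + integral {0..t} (\<lambda>s. B m (y k \<omega> s))" if t: "t \<in> {0..T}" for t
        proof -
          have "integral {0..t} (\<lambda>s. B m (y k \<omega> s)) = integral {0..t} (\<lambda>s. B k (y k \<omega> s))"
            unfolding B_def using t k \<epsilon>_mono[OF m]
            by (intro Henstock_Kurzweil_Integration.integral_cong trunc_drift_eq[symmetric]) auto
          then show ?thesis using y(2)[of \<omega> t k] elim t by simp
        qed
        show "(y m \<omega> t - y k \<omega> t) \<bullet> (B m (y m \<omega> t) - B m (y k \<omega> t)) \<le> 0" for t
          unfolding B_def using \<epsilon>(1)[of m] by (intro trunc_drift_monotone) auto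
      qed (rule t)
      have "\<forall>\<^sub>F m in sequentially. y m \<omega> t = y k \<omega> t" if "t \<in> {0..T}" for t
        unfolding eventually_sequentially using agree that by blast
      then have "\<sigma> t \<omega> = y k \<omega> t" if "t \<in> {0..T}" for t
        unfolding \<sigma>_def using that by (intro limI tendsto_eventually)
      then show ?thesis using k by blast
    qed
    show ?case
    proof (intro conjI allI impI)
      show "continuous_on {0..} (\<lambda>t. \<sigma> t \<omega>)"
      proof (rule continuous_on_atLeastI)
        fix T :: real
        obtain m where m: "\<And>t. t \<in> {0..T} \<Longrightarrow> \<sigma> t \<omega> = y m \<omega> t" using loc[of T] by blast
        have "continuous_on {0..T} (y m \<omega>)" using elim by (auto intro: continuous_on_subset)
        then show "continuous_on {0..T} (\<lambda>t. \<sigma> t \<omega>)" by (rule continuous_on_eq) (simp add: m)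
      qed
      show ch: "\<sigma> t \<omega> \<in> chamber J \<alpha>" if "0 \<le> t" for t
      proof -
        obtain m where m: "\<forall>s\<in>{0..t}. \<sigma> s \<omega> = y m \<omega> s \<and> (\<forall>j\<in>J. \<epsilon> m \<le> \<alpha> j \<bullet> y m \<omega> s)"
          using loc[of t] by blast
        have "\<sigma> t \<omega> = y m \<omega> t" "\<And>j. j \<in> J \<Longrightarrow> \<epsilon> m \<le> \<alpha> j \<bullet> y m \<omega> t"
          using bspec[OF m, of t] that by auto
        then show ?thesis using less_le_trans[OF \<epsilon>(1)] by (auto simp: chamber_def)
      qed
      show "\<sigma> t \<omega> = x + a *\<^sub>R W t \<omega> + integral {0..t} (\<lambda>s. b (\<sigma> s \<omega>))" if t: "0 \<le> t" for t
      proof -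
        obtain m where m: "\<And>s. s \<in> {0..t} \<Longrightarrow> \<sigma> s \<omega> = y m \<omega> s"
          "\<And>s j. s \<in> {0..t} \<Longrightarrow> j \<in> J \<Longrightarrow> \<epsilon> m \<le> \<alpha> j \<bullet> y m \<omega> s"
          using loc[of t] by blast
        have "integral {0..t} (\<lambda>s. b (\<sigma> s \<omega>)) = integral {0..t} (\<lambda>s. trunc_drift (\<epsilon> m) J \<alpha> (y m \<omega> s))"
        proof (rule Henstock_Kurzweil_Integration.integral_cong)
          fix s assume s: "s \<in> {0..t}"
          have "b (\<sigma> s \<omega>) = trunc_drift 0 J \<alpha> (\<sigma> s \<omega>)" using s ch by (intro b) auto
          also have "\<dots> = trunc_drift (\<epsilon> m) J \<alpha> (y m \<omega> s)"
            using m s \<epsilon>(1)[of m] by (simp add: trunc_drift_eq[of J "\<epsilon> m" \<alpha> _ 0])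
          finally show "b (\<sigma> s \<omega>) = trunc_drift (\<epsilon> m) J \<alpha> (y m \<omega> s)" .
        qed
        then show ?thesis using elim t m(1)[of t] by simp
      qed
    qed
  qed
  have cb: "continuous_on (chamber J \<alpha>) b"
    using trunc_drift_continuous_chamber by (rule continuous_on_cong[THEN iffD1, rotated -1]) (simp_all add: b)
  have integrable_b: "set_integrable lborel {0..t} (\<lambda>s. b (\<sigma> s \<omega>))"
    if "continuous_on {0..} (\<lambda>t. \<sigma> t \<omega>)" "\<forall>t\<ge>0. \<sigma> t \<omega> \<in> chamber J \<alpha>" for t \<omega>
  proof (rule borel_integrable_atLeastAtMost')
    show "continuous_on {0..t} (\<lambda>s. b (\<sigma> s \<omega>))"
      using that by (intro continuous_on_compose2[OF cb] continuous_on_subset[OF that(1)]) auto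
  qed
  have "strong_solution M W D b a x \<sigma>"
    unfolding strong_solution_def sde_solution_def G_def[symmetric]
  proof (intro conjI)
    show "\<forall>t\<ge>0. \<sigma> t \<in> borel_measurable (G t)" using \<sigma>m by blast
    show "AE \<omega> in M. \<sigma> 0 \<omega> = x" using main start_zero by eventually_elim auto
    show "AE \<omega> in M. continuous_on {0..} (\<lambda>t. \<sigma> t \<omega>)" using main by eventually_elim simp
    show "AE \<omega> in M. AE s in lborel. 0 \<le> s \<longrightarrow> \<sigma> s \<omega> \<in> D"
      using main
    proof eventually_elim
      case (elim \<omega>)
      then have "0 \<le> s \<Longrightarrow> \<sigma> s \<omega> \<in> D" for s using D by blast
      then show ?case by simp
    qed
    show "AE \<omega> in M. \<forall>t\<ge>0. set_integrable lborel {0..t} (\<lambda>s. b (\<sigma> s \<omega>))"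
      using main by eventually_elim (use integrable_b in blast)
    show "AE \<omega> in M. \<forall>t\<ge>0. \<sigma> t \<omega> = x + set_lebesgue_integral lborel {0..t} (\<lambda>s. b (\<sigma> s \<omega>)) + a *\<^sub>R W t \<omega>"
      using main
    proof eventually_elim
      case (elim \<omega>)
      show ?case
      proof (intro allI impI)
        fix t :: real assume t: "0 \<le> t"
        have "set_lebesgue_integral lborel {0..t} (\<lambda>s. b (\<sigma> s \<omega>)) = integral {0..t} (\<lambda>s. b (\<sigma> s \<omega>))"
          by (rule set_borel_integral_eq_integral(2)[OF integrable_b]) (use elim in blast)+
        moreover have "\<sigma> t \<omega> = x + a *\<^sub>R W t \<omega> + integral {0..t} (\<lambda>s. b (\<sigma> s \<omega>))"
          using elim t by blast
        ultimately show "\<sigma> t \<omega> = x + set_lebesgue_integral lborel {0..t} (\<lambda>s. b (\<sigma> s \<omega>)) + a *\<^sub>R W t \<omega>"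
          by (simp only: ac_simps)
      qed
    qed
  qed
  \<comment> \<open>The comparison with \<sigma> is made path by path, so it holds for every
    filtration \<open>G'\<close>.\<close>
  moreover have "AE \<omega> in M. \<forall>t\<ge>0. \<tau> t \<omega> = \<sigma> t \<omega>" if \<tau>: "sde_solution M G' W D b a x \<tau>" for G' \<tau>
  proof -
    have "AE \<omega> in M. continuous_on {0..} (\<lambda>t. \<tau> t \<omega>)"
      "AE \<omega> in M. \<forall>t\<ge>0. set_integrable lborel {0..t} (\<lambda>s. b (\<tau> s \<omega>))"
      "AE \<omega> in M. \<forall>t\<ge>0. \<tau> t \<omega> = x + set_lebesgue_integral lborel {0..t} (\<lambda>s. b (\<tau> s \<omega>)) + a *\<^sub>R W t \<omega>"
      using \<tau> unfolding sde_solution_def by blast+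
    then show ?thesis
      using main
    proof eventually_elim
      case (elim \<omega>)
      show ?case
      proof (intro allI impI)
        fix t :: real assume t: "0 \<le> t"
        show "\<tau> t \<omega> = \<sigma> t \<omega>"
        proof (rule integral_equation_unique_open[OF open_chamber[OF J] cb])
          show "(u - v) \<bullet> (b u - b v) \<le> 0" if uv: "u \<in> chamber J \<alpha>" "v \<in> chamber J \<alpha>" for u v
            unfolding b[OF uv(1)] b[OF uv(2)]
            using uv by (intro trunc_drift_monotone) (auto simp: chamber_def)
          show "\<tau> s \<omega> = (x + a *\<^sub>R W s \<omega>) + integral {0..s} (\<lambda>s. b (\<tau> s \<omega>))" if s: "0 \<le> s" for s
            using elim s set_borel_integral_eq_integral(2)[of "{0..s}" "\<lambda>s. b (\<tau> s \<omega>)"]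
            by (simp add: algebra_simps)
        qed (use elim t in auto)
      qed
    qed
  qed
  moreover have "AE \<omega> in M. \<forall>t\<ge>0. \<sigma> t \<omega> \<in> chamber J \<alpha>" using main by eventually_elim blast
  ultimately show ?thesis by blast
qed

section \<open>The hyperbolic Dyson drift\<close>

text \<open>The directions \<open>e\<^sub>k\<close> and \<open>(e\<^sub>k \<plusminus> e\<^sub>l) / 2\<close>, the signs being chosen such that all of them are
  positive at \<open>z\<close>. In these terms \<open>sinh \<sigma>\<^sub>k / (cosh \<sigma>\<^sub>k - cosh \<sigma>\<^sub>l)\<close> is a sum of two hyperbolic
  cotangents.\<close>

definition hroot :: "'n \<times> 'n \<times> bool \<Rightarrow> real ^ 'n" where
  "hroot = (\<lambda>(k, l, s). (1 / 2) *\<^sub>R (axis k 1 + (if s then 1 else - 1) *\<^sub>R axis l 1))"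

definition hroots :: "real ^ 'n \<Rightarrow> ('n \<times> 'n \<times> bool) set" where
  "hroots z = {(k, l, s). z $ l < z $ k \<or> k = l \<and> s}"

lemma inner_root: "hroot (k, l, s) \<bullet> x = (x $ k + (if s then x $ l else - (x $ l))) / 2"
  by (simp add: hroot_def inner_add_left inner_axis')

lemma root_inner_root: "k \<noteq> l \<Longrightarrow> hroot (k, l, s) \<bullet> hroot (k, l, s) = 1 / 2"
  by (simp add: inner_root) (simp add: hroot_def axis_def)

lemma root_diagonal: "hroot (k, k, True) = axis k 1"
  by (simp add: hroot_def flip: scaleR_2)

lemma power2_norm_vec: "(norm v)\<^sup>2 = (\<Sum>k\<in>UNIV. (v $ k)\<^sup>2)" for v :: "real ^ 'n"
  unfolding power2_norm_eq_inner inner_vec_def by (simp add: power2_eq_square)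

lemma sum_roots:
  "sum f (hroots z) = (\<Sum>k\<in>UNIV. f (k, k, True))
     + (\<Sum>k\<in>UNIV. \<Sum>l | z $ l < z $ k. f (k, l, True) + f (k, l, False))"
  for z :: "real ^ 'n" and f :: "_ \<Rightarrow> 'b::comm_monoid_add"
proof -
  have "sum f (hroots z) = (\<Sum>j\<in>UNIV. if j \<in> hroots z then f j else 0)"
    by (simp add: sum.If_cases)
  also have "\<dots> = (\<Sum>k\<in>UNIV. \<Sum>l\<in>UNIV. \<Sum>s\<in>UNIV. if (k, l, s) \<in> hroots z then f (k, l, s) else 0)"
    by (simp add: sum.cartesian_product flip: UNIV_Times_UNIV)
  also have "\<dots> = (\<Sum>k\<in>UNIV. \<Sum>l\<in>UNIV. (if k = l then f (k, l, True) else 0)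
      + (if z $ l < z $ k then f (k, l, True) + f (k, l, False) else 0))"
    by (intro sum.cong refl) (auto simp: UNIV_bool hroots_def add.commute)
  also have "\<dots> = (\<Sum>k\<in>UNIV. f (k, k, True))
     + (\<Sum>k\<in>UNIV. \<Sum>l | z $ l < z $ k. f (k, l, True) + f (k, l, False))"
    by (simp add: sum.distrib sum.If_cases)
  finally show ?thesis .
qed

text \<open>As the coordinates of \<open>z\<close> are distinct, each unordered pair of indices has
  exactly one orientation in \<open>hroots z\<close>. Symmetrizing removes the order of the
  coordinates from the resulting sums.\<close>

lemma sum_symmetrize:
  fixes z :: "real ^ 'n" and f :: "'n \<Rightarrow> 'n \<Rightarrow> 'b::comm_monoid_add"
  assumes "\<And>k l. k \<noteq> l \<Longrightarrow> z $ k \<noteq> z $ l"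
  shows "(\<Sum>k\<in>UNIV. \<Sum>l | z $ l < z $ k. f k l + f l k) = (\<Sum>k\<in>UNIV. \<Sum>l\<in>UNIV - {k}. f k l)"
proof -
  have "(\<Sum>k\<in>UNIV. \<Sum>l\<in>UNIV - {k}. f k l) = (\<Sum>k\<in>UNIV. (\<Sum>l | z $ l < z $ k. f k l) + (\<Sum>l | z $ k < z $ l. f k l))"
  proof (rule sum.cong[OF refl])
    fix k
    have "z $ l < z $ k \<or> z $ k < z $ l" if "l \<noteq> k" for l
      using assms[of k l] that by (auto simp: neq_iff)
    then have eq: "UNIV - {k} = {l. z $ l < z $ k} \<union> {l. z $ k < z $ l}" by auto
    show "(\<Sum>l\<in>UNIV - {k}. f k l) = (\<Sum>l | z $ l < z $ k. f k l) + (\<Sum>l | z $ k < z $ l. f k l)"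
      unfolding eq by (rule sum.union_disjoint) auto
  qed
  also have "\<dots> = (\<Sum>k\<in>UNIV. \<Sum>l | z $ l < z $ k. f k l) + (\<Sum>k\<in>UNIV. \<Sum>l | z $ k < z $ l. f k l)"
    by (rule sum.distrib)
  also have "(\<Sum>k\<in>UNIV. \<Sum>l | z $ k < z $ l. f k l) = (\<Sum>l\<in>UNIV. \<Sum>k | z $ k < z $ l. f k l)"
    using sum.swap_restrict[of UNIV UNIV f "\<lambda>k l. z $ k < z $ l"] by simp
  finally show ?thesis by (simp add: sum.distrib)
qed

section \<open>Hyperbolic identities for the drift and the energy inequality\<close>

lemma cosh_product_identities:
  fixes x y :: real
  defines "p \<equiv> (x + y) / 2" and "q \<equiv> (x - y) / 2"
  shows "cosh x - cosh y = 2 * sinh p * sinh q"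
    "sinh x = sinh p * cosh q + cosh p * sinh q" "sinh y = sinh p * cosh q - cosh p * sinh q"
    "cosh x * cosh y - 1 = (sinh p)\<^sup>2 + (sinh q)\<^sup>2"
proof -
  have xy: "x = p + q" "y = p - q" by (simp_all add: p_def q_def field_simps)
  show "cosh x - cosh y = 2 * sinh p * sinh q"
    unfolding xy by (simp add: cosh_add cosh_diff)
  show "sinh x = sinh p * cosh q + cosh p * sinh q" unfolding xy by (rule sinh_add)
  show "sinh y = sinh p * cosh q - cosh p * sinh q" unfolding xy by (rule sinh_diff)
  have "cosh x * cosh y - 1 = (cosh p)\<^sup>2 * (cosh q)\<^sup>2 - (sinh p)\<^sup>2 * (sinh q)\<^sup>2 - 1"
    unfolding xy cosh_add cosh_diff by (simp add: algebra_simps power2_eq_square)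
  also have "\<dots> = (sinh p)\<^sup>2 + (sinh q)\<^sup>2"
    unfolding cosh_square_eq by (simp add: algebra_simps)
  finally show "cosh x * cosh y - 1 = (sinh p)\<^sup>2 + (sinh q)\<^sup>2" .
qed

text \<open>The first two are the partial derivatives of ln \<bar>cosh x - cosh y\<bar>, computed
  after factoring into sinh of the half sum and the half difference; the third is minus its
  Laplacian.\<close>

lemma coth_half_sum:
  fixes x y :: real
  assumes "(x + y) / 2 \<noteq> 0" "(x - y) / 2 \<noteq> 0"
  shows "(coth ((x + y) / 2) + coth ((x - y) / 2)) / 2 = sinh x / (cosh x - cosh y)"
    "(coth ((x + y) / 2) - coth ((x - y) / 2)) / 2 = sinh y / (cosh y - cosh x)"
    "1 / 2 / (sinh ((x + y) / 2))\<^sup>2 + 1 / 2 / (sinh ((x - y) / 2))\<^sup>2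
      = 2 * ((cosh x * cosh y - 1) / (cosh x - cosh y)\<^sup>2)"
proof -
  define p q where "p = (x + y) / 2" and "q = (x - y) / 2"
  note id = cosh_product_identities[where x = x and y = y, folded p_def q_def]
  have nz: "sinh p \<noteq> 0" "sinh q \<noteq> 0" using assms by (auto simp: p_def q_def)
  show "(coth ((x + y) / 2) + coth ((x - y) / 2)) / 2 = sinh x / (cosh x - cosh y)"
    unfolding id(1,2) p_def[symmetric] q_def[symmetric] coth_def using nz by (simp add: field_simps)
  have d: "cosh y - cosh x = - (2 * sinh p * sinh q)" using id(1) by simp
  show "(coth ((x + y) / 2) - coth ((x - y) / 2)) / 2 = sinh y / (cosh y - cosh x)"
    unfolding id(3) d p_def[symmetric] q_def[symmetric] coth_def using nz by (simp add: field_simps)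
  show "1 / 2 / (sinh ((x + y) / 2))\<^sup>2 + 1 / 2 / (sinh ((x - y) / 2))\<^sup>2
      = 2 * ((cosh x * cosh y - 1) / (cosh x - cosh y)\<^sup>2)"
    unfolding id(1,4) p_def[symmetric] q_def[symmetric] using nz
    by (simp add: field_simps power2_eq_square)
qed

text \<open>The left-hand side is the second divided difference of t^2 - 1 at a, b, c, which equals
  the leading coefficient 1.\<close>

lemma cyclic_identity:
  fixes a b c :: real
  assumes "a \<noteq> b" "b \<noteq> c" "a \<noteq> c"
  shows "(a\<^sup>2 - 1) / ((a - b) * (a - c)) + (b\<^sup>2 - 1) / ((b - c) * (b - a)) + (c\<^sup>2 - 1) / ((c - a) * (c - b)) = 1"
proof -
  have *: "X / (A * C) + Y / (B * - A) + Z / (- C * - B) = (X * B - Y * C + Z * A) / (A * B * C)"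
    if "A \<noteq> 0" "B \<noteq> 0" "C \<noteq> 0" for A B C X Y Z :: real
    using that by (simp add: field_simps)
  have nz: "a - b \<noteq> 0" "b - c \<noteq> 0" "a - c \<noteq> 0" using assms by auto
  have "(a\<^sup>2 - 1) / ((a - b) * (a - c)) + (b\<^sup>2 - 1) / ((b - c) * (b - a)) + (c\<^sup>2 - 1) / ((c - a) * (c - b))
     = ((a\<^sup>2 - 1) * (b - c) - (b\<^sup>2 - 1) * (a - c) + (c\<^sup>2 - 1) * (a - b)) / ((a - b) * (b - c) * (a - c))"
    using *[OF nz] by (simp only: minus_diff_eq)
  also have "(a\<^sup>2 - 1) * (b - c) - (b\<^sup>2 - 1) * (a - c) + (c\<^sup>2 - 1) * (a - b) = (a - b) * (b - c) * (a - c)"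
    by (simp add: algebra_simps power2_eq_square)
  finally show ?thesis using nz by simp
qed

text \<open>Rotating a triple of distinct indices permutes the index set, and by
  \<open>cyclic_identity\<close> the three rotations of a summand add up to 1. The sum is thus one
  third of the number of triples.\<close>

lemma sum_triples_nonneg:
  fixes c :: "'n::finite \<Rightarrow> real"
  assumes "inj c"
  shows "0 \<le> (\<Sum>m\<in>UNIV. \<Sum>l\<in>UNIV - {m}. \<Sum>k\<in>UNIV - {m} - {l}. ((c m)\<^sup>2 - 1) / ((c m - c l) * (c m - c k)))"
proof -
  define D where "D = (SIGMA m:UNIV. SIGMA l:UNIV - {m}. UNIV - {m} - {l :: 'n})"
  define g where "g = (\<lambda>(m, l, k). ((c m)\<^sup>2 - 1) / ((c m - c l) * (c m - c k)))"
  define r :: "'n \<times> 'n \<times> 'n \<Rightarrow> 'n \<times> 'n \<times> 'n" where "r = (\<lambda>(m, l, k). (l, k, m))"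
  have D: "(m, l, k) \<in> D \<longleftrightarrow> m \<noteq> l \<and> m \<noteq> k \<and> l \<noteq> k" for m l k by (auto simp: D_def)
  have bij: "bij_betw r D D"
    by (rule bij_betwI[where g = "\<lambda>(l, k, m). (m, l, k)"]) (auto simp: r_def D)
  have "(\<Sum>t\<in>D. g t) = (\<Sum>t\<in>D. g (r t))" using sum.reindex_bij_betw[OF bij, of g] by simp
  moreover have "(\<Sum>t\<in>D. g (r t)) = (\<Sum>t\<in>D. g (r (r t)))" using sum.reindex_bij_betw[OF bij, of "\<lambda>t. g (r t)"] by simp
  ultimately have "3 * (\<Sum>t\<in>D. g t) = (\<Sum>t\<in>D. g t + g (r t) + g (r (r t)))"
    by (simp add: sum.distrib)
  also have "\<dots> = (\<Sum>t\<in>D. 1)"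
  proof (rule sum.cong[OF refl])
    fix t assume "t \<in> D"
    then obtain m l k where t: "t = (m, l, k)" "m \<noteq> l" "m \<noteq> k" "l \<noteq> k"
      by (cases t) (auto simp: D)
    then have "c m \<noteq> c l" "c l \<noteq> c k" "c m \<noteq> c k" using assms by (auto dest: injD)
    then show "g t + g (r t) + g (r (r t)) = 1"
      using cyclic_identity[of "c m" "c l" "c k"] by (simp add: t g_def r_def)
  qed
  finally have "0 \<le> (\<Sum>t\<in>D. g t)" by simp
  also have "(\<Sum>t\<in>D. g t) = (\<Sum>m\<in>UNIV. \<Sum>l\<in>UNIV - {m}. \<Sum>k\<in>UNIV - {m} - {l}. ((c m)\<^sup>2 - 1) / ((c m - c l) * (c m - c k)))"
    by (simp add: D_def g_def sum.Sigma)
  finally show ?thesis .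
qed

lemma chamber_roots:
  fixes z x :: "real ^ 'n"
  assumes "x \<in> chamber (hroots z) hroot"
  shows "0 < x $ k" "z $ l < z $ k \<Longrightarrow> x $ l < x $ k"
proof -
  show "0 < x $ k" using bspec[of "hroots z" _ "(k, k, True)"] assms
    by (auto simp: chamber_def hroots_def inner_root)
  assume "z $ l < z $ k"
  then have "(k, l, False) \<in> hroots z" by (simp add: hroots_def)
  then show "x $ l < x $ k" using assms by (auto simp: chamber_def inner_root)
qed

context
  fixes z :: "real ^ 'n"
  assumes z: "\<And>k l. k \<noteq> l \<Longrightarrow> z $ k \<noteq> z $ l"
begin

lemma chamber_roots_distinct:
  "x \<in> chamber (hroots z) hroot \<Longrightarrow> k \<noteq> l \<Longrightarrow> x $ k \<noteq> x $ l"
  using z[of k l] chamber_roots[of x z] by (metis less_irrefl neq_iff)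

lemma inj_cosh_chamber:
  assumes "x \<in> chamber (hroots z) hroot"
  shows "inj (\<lambda>k. cosh (x $ k))"
  by (rule injI) (use assms chamber_roots(1) chamber_roots_distinct cosh_eq_iff_of_pos in blast)

text \<open>Identifies the gradient of the potential with twice the drift. The two forms of a pair
  k, l contribute to component \<open>m\<close> only when \<open>m\<close> is one of the two
  indices, which is what the auxiliary \<open>f\<close> records.\<close>

lemma root_sum_component:
  assumes x: "x \<in> chamber (hroots z) hroot"
  shows "(\<Sum>j\<in>hroots z. coth (hroot j \<bullet> x) *\<^sub>R hroot j) $ m
     = coth (x $ m) + (\<Sum>l\<in>UNIV - {m}. sinh (x $ m) / (cosh (x $ m) - cosh (x $ l)))"
proof -
  define f where "f k l = (if k = m then sinh (x $ k) / (cosh (x $ k) - cosh (x $ l)) else 0)" for k l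
  have "(\<Sum>j\<in>hroots z. coth (hroot j \<bullet> x) *\<^sub>R hroot j) $ m = (\<Sum>j\<in>hroots z. coth (hroot j \<bullet> x) * hroot j $ m)"
    by simp
  also have "\<dots> = (\<Sum>k\<in>UNIV. coth (x $ k) * axis k 1 $ m) +
      (\<Sum>k\<in>UNIV. \<Sum>l | z $ l < z $ k. coth ((x $ k + x $ l) / 2) * hroot (k, l, True) $ m
         + coth ((x $ k - x $ l) / 2) * hroot (k, l, False) $ m)"
    by (simp add: sum_roots root_diagonal inner_root inner_axis')
  also have "(\<Sum>k\<in>UNIV. coth (x $ k) * axis k 1 $ m) = coth (x $ m)"
    by (simp add: axis_def if_distrib cong: if_cong)
  also have "(\<Sum>k\<in>UNIV. \<Sum>l | z $ l < z $ k. coth ((x $ k + x $ l) / 2) * hroot (k, l, True) $ m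
         + coth ((x $ k - x $ l) / 2) * hroot (k, l, False) $ m)
      = (\<Sum>k\<in>UNIV. \<Sum>l | z $ l < z $ k. f k l + f l k)"
  proof (intro sum.cong refl)
    fix k l assume "l \<in> {l. z $ l < z $ k}"
    then have kl: "z $ l < z $ k" by simp
    then have "x $ l < x $ k" using chamber_roots[OF x] by blast
    moreover have "0 < x $ l" using chamber_roots[OF x] by blast
    ultimately have "(x $ k + x $ l) / 2 \<noteq> 0" "(x $ k - x $ l) / 2 \<noteq> 0" by auto
    note id = coth_half_sum(1,2)[OF this, symmetric]
    have r: "hroot (k, l, True) $ m = ((if k = m then 1 else 0) + (if l = m then 1 else 0)) / 2"
      "hroot (k, l, False) $ m = ((if k = m then 1 else 0) - (if l = m then 1 else 0)) / 2"
      by (simp_all add: hroot_def axis_def)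
    have "k \<noteq> l" using kl by auto
    then show "coth ((x $ k + x $ l) / 2) * hroot (k, l, True) $ m
         + coth ((x $ k - x $ l) / 2) * hroot (k, l, False) $ m = f k l + f l k"
      unfolding f_def id r by (auto simp: field_simps)
  qed
  also have "\<dots> = (\<Sum>k\<in>UNIV. \<Sum>l\<in>UNIV - {k}. f k l)" by (rule sum_symmetrize[OF z])
  also have "\<dots> = (\<Sum>k\<in>UNIV. if k = m then \<Sum>l\<in>UNIV - {k}. sinh (x $ k) / (cosh (x $ k) - cosh (x $ l)) else 0)"
    by (intro sum.cong refl) (simp add: f_def)
  also have "\<dots> = (\<Sum>l\<in>UNIV - {m}. sinh (x $ m) / (cosh (x $ m) - cosh (x $ l)))"
    by simp
  finally show ?thesis .
qed

lemma drift_eq_root_drift: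
  assumes "x \<in> chamber (hroots z) hroot"
  shows "drift x = trunc_drift 0 (hroots z) hroot x"
proof -
  have "trunc_drift 0 (hroots z) hroot x = (1 / 2) *\<^sub>R (\<Sum>j\<in>hroots z. coth (hroot j \<bullet> x) *\<^sub>R hroot j)"
    unfolding trunc_drift_def using assms
    by (intro arg_cong[where f = "scaleR _"] sum.cong refl) (auto simp: chamber_def max_absorb1 less_imp_le)
  then show ?thesis
    by (simp add: vec_eq_iff drift_def root_sum_component[OF assms] del: sum_component)
qed

text \<open>Expanding the squared gradient reproduces the left-hand side plus n + 3 Q plus the sum
  over triples. Each pair contributes 1 to \<open>Q\<close> and each triple on average 1/3 to the
  last sum, so the difference of the two sides does not even depend on \<open>x\<close>.\<close>

lemma energy_inequality_roots: "energy_inequality (hroots z) hroot"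
  unfolding energy_inequality_def
proof
  fix x assume x: "x \<in> chamber (hroots z) hroot"
  define c s where "c k = cosh (x $ k)" and "s k = sinh (x $ k)" for k
  have s: "0 < s k" for k using chamber_roots(1)[OF x] by (simp add: s_def)
  have s2: "(s k)\<^sup>2 = (c k)\<^sup>2 - 1" for k by (simp add: s_def c_def cosh_square_eq)
  have inj: "inj c" unfolding c_def by (rule inj_cosh_chamber[OF x])
  then have cne: "k \<noteq> l \<Longrightarrow> c k - c l \<noteq> 0" for k l by (auto dest: injD)
  define Q where "Q = (\<Sum>k\<in>UNIV. \<Sum>l\<in>UNIV - {k}. c k / (c k - c l))"
  have "Q = (\<Sum>k\<in>UNIV. \<Sum>l | z $ l < z $ k. c k / (c k - c l) + c l / (c l - c k))"
    unfolding Q_def by (rule sum_symmetrize[OF z, symmetric])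
  also have "\<dots> = (\<Sum>k\<in>UNIV. \<Sum>l | z $ l < z $ k. 1)"
  proof (intro sum.cong refl)
    fix k l assume "l \<in> {l. z $ l < z $ k}"
    then have "c k - c l \<noteq> 0" by (intro cne) auto
    moreover from this have "c l / (c l - c k) = - (c l / (c k - c l))"
      by (metis minus_diff_eq minus_divide_right)
    ultimately show "c k / (c k - c l) + c l / (c l - c k) = 1"
      by (simp flip: diff_divide_distrib)
  qed
  finally have Q: "0 \<le> Q" by (simp add: sum_nonneg)
  have "(\<Sum>j\<in>hroots z. (hroot j \<bullet> hroot j) / (sinh (hroot j \<bullet> x))\<^sup>2)
     = (\<Sum>k\<in>UNIV. 1 / (s k)\<^sup>2) + (\<Sum>k\<in>UNIV. \<Sum>l | z $ l < z $ k.
         1 / 2 / (sinh ((x $ k + x $ l) / 2))\<^sup>2 + 1 / 2 / (sinh ((x $ k - x $ l) / 2))\<^sup>2)"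
  proof -
    have "(\<Sum>k\<in>UNIV. \<Sum>l | z $ l < z $ k. hroot (k, l, True) \<bullet> hroot (k, l, True) / (sinh (hroot (k, l, True) \<bullet> x))\<^sup>2
        + hroot (k, l, False) \<bullet> hroot (k, l, False) / (sinh (hroot (k, l, False) \<bullet> x))\<^sup>2)
      = (\<Sum>k\<in>UNIV. \<Sum>l | z $ l < z $ k.
         1 / 2 / (sinh ((x $ k + x $ l) / 2))\<^sup>2 + 1 / 2 / (sinh ((x $ k - x $ l) / 2))\<^sup>2)"
    proof (rule sum.cong[OF refl], rule sum.cong[OF refl])
      fix k l assume "l \<in> {l. z $ l < z $ k}"
      then have "k \<noteq> l" by auto
      then show "hroot (k, l, True) \<bullet> hroot (k, l, True) / (sinh (hroot (k, l, True) \<bullet> x))\<^sup>2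
          + hroot (k, l, False) \<bullet> hroot (k, l, False) / (sinh (hroot (k, l, False) \<bullet> x))\<^sup>2
        = 1 / 2 / (sinh ((x $ k + x $ l) / 2))\<^sup>2 + 1 / 2 / (sinh ((x $ k - x $ l) / 2))\<^sup>2"
        unfolding root_inner_root[OF \<open>k \<noteq> l\<close>] by (simp add: inner_root)
    qed
    moreover have "(\<Sum>k\<in>UNIV. hroot (k, k, True) \<bullet> hroot (k, k, True) / (sinh (hroot (k, k, True) \<bullet> x))\<^sup>2)
        = (\<Sum>k\<in>UNIV. 1 / (s k)\<^sup>2)"
      by (simp add: root_diagonal s_def inner_axis')
    ultimately show ?thesis unfolding sum_roots by (simp only:)
  qed
  also have "(\<Sum>k\<in>UNIV. \<Sum>l | z $ l < z $ k.
         1 / 2 / (sinh ((x $ k + x $ l) / 2))\<^sup>2 + 1 / 2 / (sinh ((x $ k - x $ l) / 2))\<^sup>2)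
     = (\<Sum>k\<in>UNIV. \<Sum>l | z $ l < z $ k. (c k * c l - 1) / (c k - c l)\<^sup>2 + (c l * c k - 1) / (c l - c k)\<^sup>2)"
  proof (intro sum.cong refl)
    fix k l assume "l \<in> {l. z $ l < z $ k}"
    then have "x $ l < x $ k" "0 < x $ l" using chamber_roots[OF x] by auto
    then have "(x $ k + x $ l) / 2 \<noteq> 0" "(x $ k - x $ l) / 2 \<noteq> 0" by auto
    from coth_half_sum(3)[OF this]
    show "1 / 2 / (sinh ((x $ k + x $ l) / 2))\<^sup>2 + 1 / 2 / (sinh ((x $ k - x $ l) / 2))\<^sup>2
       = (c k * c l - 1) / (c k - c l)\<^sup>2 + (c l * c k - 1) / (c l - c k)\<^sup>2"
      by (simp add: c_def power2_commute[of "cosh (x $ l)"] mult.commute[of "cosh (x $ l)"])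
  qed
  also have "\<dots> = (\<Sum>k\<in>UNIV. \<Sum>l\<in>UNIV - {k}. (c k * c l - 1) / (c k - c l)\<^sup>2)"
    by (rule sum_symmetrize[OF z])
  finally have lhs: "(\<Sum>j\<in>hroots z. (hroot j \<bullet> hroot j) / (sinh (hroot j \<bullet> x))\<^sup>2)
     = (\<Sum>k\<in>UNIV. 1 / (s k)\<^sup>2 + (\<Sum>l\<in>UNIV - {k}. (c k * c l - 1) / (c k - c l)\<^sup>2))"
    by (simp add: sum.distrib)
  have "(norm (\<Sum>j\<in>hroots z. coth (hroot j \<bullet> x) *\<^sub>R hroot j))\<^sup>2
     = (\<Sum>k\<in>UNIV. (c k / s k + (\<Sum>l\<in>UNIV - {k}. s k / (c k - c l)))\<^sup>2)"
    unfolding power2_norm_vec root_sum_component[OF x] by (simp add: coth_def c_def s_def)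
  also have "\<dots> = (\<Sum>k\<in>UNIV. (1 / (s k)\<^sup>2 + (\<Sum>l\<in>UNIV - {k}. (c k * c l - 1) / (c k - c l)\<^sup>2))
     + (1 + 3 * (\<Sum>l\<in>UNIV - {k}. c k / (c k - c l))
        + (\<Sum>l\<in>UNIV - {k}. \<Sum>m\<in>UNIV - {k} - {l}. ((c k)\<^sup>2 - 1) / ((c k - c l) * (c k - c m)))))"
  proof (rule sum.cong[OF refl])
    fix k
    let ?R = "\<lambda>l. s k / (c k - c l)" and ?U = "UNIV - {k}"
    have 1: "(c k / s k)\<^sup>2 = 1 / (s k)\<^sup>2 + 1"
      using s[of k] s2[of k] by (simp add: power_divide field_simps)
    \<comment> \<open>This mixed term enters twice in the square, and the diagonal of the squared
      sum below yields a third copy; hence the factor 3.\<close>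
    have 2: "c k / s k * (\<Sum>l\<in>?U. ?R l) = (\<Sum>l\<in>?U. c k / (c k - c l))"
      using less_imp_neq[OF s[of k]] by (simp add: sum_distrib_left)
    have "(\<Sum>l\<in>?U. ?R l)\<^sup>2 = (\<Sum>l\<in>?U. \<Sum>m\<in>?U. ?R l * ?R m)"
      by (simp add: power2_eq_square sum_product)
    also have "\<dots> = (\<Sum>l\<in>?U. (?R l)\<^sup>2 + (\<Sum>m\<in>?U - {l}. ?R l * ?R m))"
      by (intro sum.cong refl) (simp add: sum.remove[of ?U] power2_eq_square)
    also have "\<dots> = (\<Sum>l\<in>?U. (c k * c l - 1) / (c k - c l)\<^sup>2 + c k / (c k - c l)
        + (\<Sum>m\<in>?U - {l}. ((c k)\<^sup>2 - 1) / ((c k - c l) * (c k - c m))))"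
    proof (intro sum.cong arg_cong2[where f = "(+)"] refl)
      \<comment> \<open>The diagonal term is split by (c k)^2 - 1 = (c k * c l - 1) + c k * (c k - c
        l), so that the part occurring on the left-hand side of the inequality separates.\<close>
      fix l assume l: "l \<in> ?U"
      then have nz: "c k - c l \<noteq> 0" by (intro cne) auto
      have "(?R l)\<^sup>2 = ((c k * c l - 1) + c k * (c k - c l)) / (c k - c l)\<^sup>2"
        unfolding power_divide s2 by (simp add: power2_eq_square algebra_simps)
      also have "\<dots> = (c k * c l - 1) / (c k - c l)\<^sup>2 + c k / (c k - c l)"
        using nz by (simp add: add_divide_distrib power2_eq_square)
      finally show "(?R l)\<^sup>2 = (c k * c l - 1) / (c k - c l)\<^sup>2 + c k / (c k - c l)" .
      fix m
      show "?R l * ?R m = ((c k)\<^sup>2 - 1) / ((c k - c l) * (c k - c m))"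
        using s2[of k] by (simp add: power2_eq_square)
    qed
    finally have 3: "(\<Sum>l\<in>?U. ?R l)\<^sup>2 = (\<Sum>l\<in>?U. (c k * c l - 1) / (c k - c l)\<^sup>2) + (\<Sum>l\<in>?U. c k / (c k - c l))
        + (\<Sum>l\<in>?U. \<Sum>m\<in>?U - {l}. ((c k)\<^sup>2 - 1) / ((c k - c l) * (c k - c m)))"
      by (simp add: sum.distrib)
    show "(c k / s k + (\<Sum>l\<in>?U. ?R l))\<^sup>2 = (1 / (s k)\<^sup>2 + (\<Sum>l\<in>?U. (c k * c l - 1) / (c k - c l)\<^sup>2))
     + (1 + 3 * (\<Sum>l\<in>?U. c k / (c k - c l))
        + (\<Sum>l\<in>?U. \<Sum>m\<in>?U - {l}. ((c k)\<^sup>2 - 1) / ((c k - c l) * (c k - c m))))"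
      unfolding power2_sum 1 3 using 2 by (simp add: mult.assoc)
  qed
  also have "\<dots> = (\<Sum>j\<in>hroots z. (hroot j \<bullet> hroot j) / (sinh (hroot j \<bullet> x))\<^sup>2) + real CARD('n) + 3 * Q
      + (\<Sum>k\<in>UNIV. \<Sum>l\<in>UNIV - {k}. \<Sum>m\<in>UNIV - {k} - {l}. ((c k)\<^sup>2 - 1) / ((c k - c l) * (c k - c m)))"
    unfolding lhs Q_def by (simp add: sum.distrib sum_distrib_left)
  finally show "(\<Sum>j\<in>hroots z. (hroot j \<bullet> hroot j) / (sinh (hroot j \<bullet> x))\<^sup>2)
      \<le> (norm (\<Sum>j\<in>hroots z. coth (hroot j \<bullet> x) *\<^sub>R hroot j))\<^sup>2"
    using Q sum_triples_nonneg[OF inj] by linarith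
qed

end

text \<open>The form in which \<beta> \<ge> 2 enters the argument; \<beta> = \<infinity> is the
  noiseless case with coefficient 0.\<close>

lemma noise_coeff_bounds:
  assumes "2 \<le> \<beta>"
  shows "0 \<le> noise_coeff \<beta>" "noise_coeff \<beta> \<le> 1"
proof -
  have "0 \<le> noise_coeff \<beta> \<and> noise_coeff \<beta> \<le> 1"
  proof (cases \<beta>)
    case (real r)
    then have "2 \<le> r" using assms by simp
    then show ?thesis unfolding real noise_coeff_real[OF \<open>2 \<le> r\<close>] by (simp add: real_le_lsqrt)
  next
    case PInf
    then show ?thesis by (simp add: noise_coeff_infinity)
  qed (use assms in auto)
  then show "0 \<le> noise_coeff \<beta>" "noise_coeff \<beta> \<le> 1" by simp_all
qed

theorem theorem9:
  fixes c :: "nat \<Rightarrow> real"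
    and \<beta> :: ereal
    and \<sigma>0 :: "(real, 'n::{finite,linorder}) vec"
    and M :: "'w measure"
    and F :: "real \<Rightarrow> 'w measure"
    and W :: "real \<Rightarrow> 'w \<Rightarrow> (real, 'n) vec"
  assumes "2 \<le> \<beta>"
    and "\<And>k. \<sigma>0 $ k > 0"
    and "S c \<sigma>0 > -\<infinity>"
    and "wiener_process M F W"
  shows "\<exists>\<sigma>. strong_solution M W drift_domain drift (noise_coeff \<beta>) \<sigma>0 \<sigma>
    \<and> (\<forall>\<tau>. sde_solution M (augmented_filtration M F) W drift_domain drift (noise_coeff \<beta>) \<sigma>0 \<tau>
          \<longrightarrow> (AE \<omega> in M. \<forall>t\<ge>0. \<tau> t \<omega> = \<sigma> t \<omega>))
    \<and> (AE \<omega> in M. \<forall>t>0. S c (\<sigma> t \<omega>) > -\<infinity>)"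
proof -
  interpret wiener_process M F W by fact
  \<comment> \<open>The forms are oriented by the order of the initial coordinates, so that
    \<sigma>0 lies in the chamber. Every point of it has positive coordinates in the same order as
    \<sigma>0, hence finite \<open>S\<close>.\<close>
  let ?C = "chamber (hroots \<sigma>0) hroot :: (real, 'n) vec set"
  have distinct: "\<sigma>0 $ k \<noteq> \<sigma>0 $ l" if "k \<noteq> l" for k l
    using assms(3) that unfolding S_gt_minus_infinity_iff by blast
  have S: "S c x > -\<infinity>" if "x \<in> ?C" for x
    unfolding S_gt_minus_infinity_iff
    using chamber_roots(1)[OF that] chamber_roots_distinct[OF distinct that] by blast
  have "\<sigma>0 \<in> ?C"
    using assms(2) by (auto simp: chamber_def hroots_def inner_root add_pos_pos)
  moreover have "?C \<subseteq> drift_domain"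
    using S S_gt_minus_infinity_imp_drift_domain by blast
  ultimately obtain \<sigma> where \<sigma>: "strong_solution M W drift_domain drift (noise_coeff \<beta>) \<sigma>0 \<sigma>"
    "\<And>G \<tau>. sde_solution M G W drift_domain drift (noise_coeff \<beta>) \<sigma>0 \<tau> \<Longrightarrow> (AE \<omega> in M. \<forall>t\<ge>0. \<tau> t \<omega> = \<sigma> t \<omega>)"
    "AE \<omega> in M. \<forall>t\<ge>0. \<sigma> t \<omega> \<in> ?C"
    using chamber_strong_solution[of "hroots \<sigma>0" "noise_coeff \<beta>" hroot \<sigma>0 drift_domain drift]
      noise_coeff_bounds[OF assms(1)] energy_inequality_roots[of \<sigma>0] drift_eq_root_drift[of \<sigma>0] distinct
    by auto
  have "AE \<omega> in M. \<forall>t>0. S c (\<sigma> t \<omega>) > -\<infinity>"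
    using \<sigma>(3) by eventually_elim (use S less_imp_le in blast)
  with \<sigma>(1,2) show ?thesis by blast
qed

end
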